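(* Let $k:\mathbb N\to\mathbb N$, $p:\mathbb N\to(0,1)$ and let $\{\mathcal G^k(N,p)\}_N$ be any $k$-wise independent random graph. Then, with probability tending to $1$ as $N\to\infty$, $\mathcal G^k(N,p)$ is Hamiltonian (and, for even $N$, contains a perfect matching), whenever either (1) $k\ge 4$ and $p(N)\ge \frac{\log^2 N}{\sqrt N}$; or (2) $k(N)\ge 4\log N$ and $p(N)\ge\frac{\log^2 N}{N}$.
   Context: A $k$-wise independent random graph $\{\mathcal G^k(N,p)\}_N$ is a sequence, indexed by $N$, of probability distributions on simple undirected graphs with vertex set $\{1,\dots,N\}$ such that every potential edge appears with probability $p(N)$ and the indicator random variables of the appearance of any $k(N)$ potential edges are mutually independent. $\log$ is the base-2 logarithm. *)

theory Defs
  imports "HOL-Probability.Probability"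
begin

text \<open>A simple undirected graph on the vertex set \<open>{1..N}\<close> is represented by its edge set,
  a subset of \<open>potential_edges N\<close>.\<close>

definition potential_edges :: "nat \<Rightarrow> nat set set" where
  "potential_edges N = {e. e \<subseteq> {1..N} \<and> card e = 2}"

text \<open>Independence is required of every set of at most \<open>k N\<close> potential edges. This agrees with
  ``exactly \<open>k N\<close>'' as long as there are at least \<open>k N\<close> potential edges, and means full
  independence, rather than no condition at all, when there are fewer. The indicator of the
  appearance of \<open>e\<close> is taken as a Boolean random variable.\<close>

definition kwise_independent_random_graph ::
    "(nat \<Rightarrow> nat) \<Rightarrow> (nat \<Rightarrow> real) \<Rightarrow> (nat \<Rightarrow> nat set set pmf) \<Rightarrow> bool" where
  "kwise_independent_random_graph k p G \<longleftrightarrow>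
     (\<forall>N. set_pmf (G N) \<subseteq> Pow (potential_edges N) \<and>
          (\<forall>e\<in>potential_edges N. measure_pmf.prob (G N) {E. e \<in> E} = p N) \<and>
          (\<forall>S\<subseteq>potential_edges N. card S \<le> k N \<longrightarrow>
             prob_space.indep_vars (measure_pmf (G N)) (\<lambda>_. count_space UNIV) (\<lambda>e E. e \<in> E) S))"

definition hamiltonian_cycle :: "nat \<Rightarrow> nat set set \<Rightarrow> nat list \<Rightarrow> bool" where
  "hamiltonian_cycle N E vs \<longleftrightarrow>
     3 \<le> N \<and> length vs = N \<and> distinct vs \<and> set vs = {1..N} \<and>
     (\<forall>i<N. {vs ! i, vs ! (Suc i mod N)} \<in> E)"

definition hamiltonian :: "nat \<Rightarrow> nat set set \<Rightarrow> bool" where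
  "hamiltonian N E \<longleftrightarrow> (\<exists>vs. hamiltonian_cycle N E vs)"

definition perfect_matching :: "nat \<Rightarrow> nat set set \<Rightarrow> nat set set \<Rightarrow> bool" where
  "perfect_matching N E M \<longleftrightarrow> M \<subseteq> E \<and> (\<forall>v\<in>{1..N}. \<exists>!e. e \<in> M \<and> v \<in> e)"

end

theory Submission
  imports Defs "HOL-Real_Asymp.Real_Asymp"
begin

text \<open>Let \<open>M\<close> be the adjacency matrix centred by \<open>p\<close>. Since \<open>M\<close> has entries of mean zero,
  \<open>E tr M\<^sup>2\<^sup>m\<close> only counts closed walks that use every edge at least twice, each weighted by at most
  \<open>p\<close> per edge, as soon as \<open>2m \<le> k\<close>. Following Bandeira and van Handel, pattern by pattern these
  walks are at most \<open>N / n\<close> times as many as the unweighted ones on \<open>n = N p + m + 1\<close> vertices, and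
  the latter are dominated by \<open>E tr Y\<^sup>2\<^sup>m\<close> for a random symmetric \<open>n \<times> n\<close> matrix \<open>Y\<close> with independent
  bounded entries, where a net argument gives norm \<open>O(sqrt n)\<close>. Hence \<open>\<parallel>M\<parallel>\<close> is smaller than
  \<open>N p\<close> by almost a factor \<open>log N\<close>: with \<open>m = 2\<close> in the first regime, \<open>log N < m \<le> 2 log N\<close> in the
  second. The degrees are controlled by the same comparison.

  Consequently sets of size \<open>q\<close>, about \<open>N sqrt (log log N) / log N\<close>, are pairwise joined, and smaller
  sets expand by a factor \<open>sqrt (log N)\<close>. In such a graph \<open>O(log N / log log N)\<close> rotations
  at each end of a longest path reach linearly many endpoints. Cut the path into a
  slightly larger number of blocks, each still much longer than \<open>q\<close>. Few vertices lack a neighbour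
  in the well-connected part of some block, so both endpoints can be moved to vertices without that
  defect while two blocks stay intact. Further rotations inside the intact blocks give more than
  \<open>q\<close> possible endpoints on each side, hence an edge closing the path to a cycle; by connectivity and
  maximality it is Hamiltonian.\<close>


section \<open>Paths and rotations\<close>

text \<open>Under k-wise independence the edges cannot be exposed in independent rounds, so
  randomness enters only through two moment bounds, for the trace and for the degrees; all else is
  deterministic. Both regimes are calibrated alike. The trace bound reads
  \<open>norm(M)^(2m) \<le> N (C N p)^m\<close> up to constants; \<open>m = 2\<close> with
  \<open>p \<ge> log^2 N / sqrt N\<close>, and \<open>m > log N\<close> with
  \<open>p \<ge> log^2 N / N\<close>, both make the norm of order at most
  \<open>N p / log N\<close>. Sets of size \<open>q\<close> are then joined if
  \<open>q log N / N\<close> is large; for \<open>m = 2\<close> it must tend to infinity for the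
  failure probability to vanish. On the other side about \<open>2 t\<close> blocks longer than
  \<open>13 q\<close> must fit into the path. With \<open>t\<close> about
  \<open>2 log N / log log N\<close> rotations this forces \<open>q log N / (N log log N)\<close> to
  tend to 0. The factor \<open>sqrt (log log N)\<close> in \<open>q\<close> lies midway between the
  two demands. Expansion by a constant factor would need \<open>t\<close> of order
  \<open>log N\<close>, and the blocks would not fit; hence the growing expansion factor, and hence
  a norm bound that loses no logarithm.\<close>

definition is_path :: "'a set set \<Rightarrow> 'a list \<Rightarrow> bool" where
  "is_path E l \<longleftrightarrow> distinct l \<and> successively (\<lambda>x y. {x, y} \<in> E) l"

definition ladj :: "'a list \<Rightarrow> 'a \<Rightarrow> 'a \<Rightarrow> bool" where
  "ladj l x y \<longleftrightarrow> (\<exists>us vs. l = us @ x # y # vs) \<or> (\<exists>us vs. l = us @ y # x # vs)"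

text \<open>\<open>rots E R l n r\<close>: the path \<open>r\<close> arises from \<open>l\<close> by \<open>n\<close> Posa rotations that keep the last vertex
  and move the head, each new head lying in \<open>R\<close>.\<close>

inductive rots :: "'a set set \<Rightarrow> 'a set \<Rightarrow> 'a list \<Rightarrow> nat \<Rightarrow> 'a list \<Rightarrow> bool" for E R l where
  rots_refl: "rots E R l 0 l"
| rots_step: "rots E R l n (pre @ post) \<Longrightarrow> pre \<noteq> [] \<Longrightarrow> post \<noteq> [] \<Longrightarrow> {hd pre, hd post} \<in> E
    \<Longrightarrow> last pre \<in> R \<Longrightarrow> rots E R l (Suc n) (rev pre @ post)"

lemma is_path_rev: "is_path E (rev l) \<longleftrightarrow> is_path E l"
  by (auto simp: is_path_def insert_commute)

lemma is_path_append_iff: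
  "is_path E (xs @ ys) \<longleftrightarrow> is_path E xs \<and> is_path E ys \<and> set xs \<inter> set ys = {} \<and>
     (xs \<noteq> [] \<longrightarrow> ys \<noteq> [] \<longrightarrow> {last xs, hd ys} \<in> E)"
  by (auto simp: is_path_def successively_append_iff)

lemma is_path_rotate:
  assumes "is_path E (pre @ post)" "pre \<noteq> []" "{hd pre, hd post} \<in> E"
  shows "is_path E (rev pre @ post)"
  using assms by (auto simp: is_path_append_iff is_path_rev last_rev)

lemma rots_inv:
  assumes "rots E R l n r" "is_path E l"
  shows "is_path E r \<and> set r = set l \<and> last r = last l \<and> length r = length l"
  using assms
proof induction
  case (rots_step n pre post)
  then show ?case by (auto intro: is_path_rotate)
qed auto

lemma ladj_sym: "ladj l x y \<longleftrightarrow> ladj l y x"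
  by (auto simp: ladj_def)

text \<open>Reversing a prefix destroys a single adjacency, the one across the cut, and
  \<open>last pre\<close> is one of its two ends.\<close>

lemma ladj_rotate:
  assumes "ladj (pre @ post) x y" "pre \<noteq> []" "last pre \<noteq> x" "last pre \<noteq> y"
  shows "ladj (rev pre @ post) x y"
proof -
  have main: "ladj (rev pre @ post) x y"
    if eq: "pre @ post = us @ x # y # vs" and nx: "last pre \<noteq> x" for us vs x y
  proof -
    from eq consider ws where "pre = us @ ws" "ws @ post = x # y # vs"
      | ws where "pre @ ws = us" "post = ws @ x # y # vs"
      by (auto simp: append_eq_append_conv2)
    then show ?thesis
    proof cases
      case 1
      consider "ws = []" | "ws = [x]" | ws' where "ws = x # y # ws'"
        using 1(2) by (cases ws; cases "tl ws") auto
      then show ?thesis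
      proof cases
        case a: 1
        then show ?thesis using 1 unfolding ladj_def by auto
      next
        case a: 2
        then show ?thesis using 1 nx by auto
      next
        case a: 3
        then have "rev pre @ post = rev ws' @ y # x # (rev us @ post)" using 1 by simp
        then show ?thesis unfolding ladj_def by blast
      qed
    next
      case 2
      then have "rev pre @ post = (rev pre @ ws) @ x # y # vs" by simp
      then show ?thesis unfolding ladj_def by blast
    qed
  qed
  from assms(1) show ?thesis
    unfolding ladj_def[of "pre @ post"]
    using main[of _ x y] main[of _ y x] assms(3,4) ladj_sym by metis
qed

lemma ladj_at:
  assumes "distinct (pre @ y # post)" "ladj (pre @ y # post) x y"
  shows "(pre \<noteq> [] \<and> x = last pre) \<or> (post \<noteq> [] \<and> x = hd post)"
proof -
  from assms(2) consider us vs where "pre @ y # post = us @ x # y # vs"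
    | us vs where "pre @ y # post = us @ y # x # vs"
    by (auto simp: ladj_def)
  then show ?thesis
  proof cases
    case 1
    then have "pre @ y # post = (us @ [x]) @ y # vs" by simp
    then have "pre = us @ [x]" using assms(1)
      by (subst (asm) append_Cons_eq_iff) auto
    then show ?thesis by simp
  next
    case 2
    then have "pre = us \<and> post = x # vs" using assms(1)
      by (subst (asm) append_Cons_eq_iff) auto
    then show ?thesis by simp
  qed
qed

lemma card_ladj_le:
  assumes "distinct l"
  shows "finite {y. ladj l x y} \<and> card {y. ladj l x y} \<le> 2"
proof (cases "x \<in> set l")
  case True
  then obtain pre post where l: "l = pre @ x # post" by (meson split_list)
  have "{y. ladj l x y} \<subseteq> {last pre, hd post}"
    using ladj_at[of pre x post] assms unfolding l by (auto simp: ladj_sym)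
  moreover have "card {last pre, hd post} \<le> 2" by (simp add: card_insert_if)
  ultimately show ?thesis by (meson card_mono finite.emptyI finite_insert finite_subset le_trans)
next
  case False
  then have "{y. ladj l x y} = {}" by (auto simp: ladj_def)
  then show ?thesis by simp
qed

lemma card_ladj_UN_le:
  assumes "distinct l" "finite U"
  shows "finite {y. \<exists>x\<in>U. ladj l x y} \<and> card {y. \<exists>x\<in>U. ladj l x y} \<le> 2 * card U"
proof -
  have eq: "{y. \<exists>x\<in>U. ladj l x y} = (\<Union>x\<in>U. {y. ladj l x y})" by auto
  have "card (\<Union>x\<in>U. {y. ladj l x y}) \<le> (\<Sum>x\<in>U. card {y. ladj l x y})"
    by (rule card_UN_le[OF assms(2)])
  also have "\<dots> \<le> (\<Sum>x\<in>U. 2)" by (intro sum_mono) (use card_ladj_le[OF assms(1)] in auto)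
  finally show ?thesis unfolding eq using assms card_ladj_le[OF assms(1)] by auto
qed

text \<open>A rotation deletes only the edge between its pivot and the new endpoint, so an edge of the
  original path survives as long as neither of its ends has become an endpoint.\<close>

lemma ladj_rots:
  assumes "rots E R l n r" "ladj l x y"
    and "\<And>m r'. 1 \<le> m \<Longrightarrow> m \<le> n \<Longrightarrow> rots E R l m r' \<Longrightarrow> hd r' \<noteq> x \<and> hd r' \<noteq> y"
  shows "ladj r x y"
  using assms
proof induction
  case (rots_step n pre post)
  have "ladj (pre @ post) x y"
    using rots_step.IH rots_step.prems by (meson le_SucI)
  moreover have "rots E R l (Suc n) (rev pre @ post)"
    using rots_step.hyps by (rule rots.rots_step)
  then have "hd (rev pre @ post) \<noteq> x \<and> hd (rev pre @ post) \<noteq> y"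
    using rots_step.prems(2)[of "Suc n"] by simp
  then have "last pre \<noteq> x \<and> last pre \<noteq> y" using \<open>pre \<noteq> []\<close> by (simp add: hd_rev)
  ultimately show ?case using ladj_rotate \<open>pre \<noteq> []\<close> by metis
qed auto

text \<open>The step behind Posa's lemma: since neither \<open>y\<close> nor a path neighbour of
  \<open>y\<close> has become an endpoint, \<open>y\<close> still has its original neighbours in
  \<open>r\<close>. So the vertex before \<open>y\<close>, which a rotation with pivot
  \<open>y\<close> turns into the head, is one of them.\<close>

lemma rots_pivot:
  assumes r: "rots E R l n r" and l: "is_path E l" and y: "y \<in> set l" "y \<noteq> hd r" "y \<noteq> hd l"
    and new: "\<And>m r' x. 1 \<le> m \<Longrightarrow> m \<le> n \<Longrightarrow> rots E R l m r' \<Longrightarrow> x = y \<or> ladj l x y \<Longrightarrow> hd r' \<noteq> x"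
  obtains pre post where "r = pre @ y # post" "pre \<noteq> []" "ladj l (last pre) y"
proof -
  note inv = rots_inv[OF r l]
  have dl: "distinct l" and dr: "distinct r" using l inv by (auto simp: is_path_def)
  obtain pre post where rr: "r = pre @ y # post" using y(1) inv by (metis split_list)
  have pre: "pre \<noteq> []" using rr y(2) by auto
  obtain us vs where ll: "l = us @ y # vs" using y(1) by (meson split_list)
  have us: "us \<noteq> []" using ll y(3) by auto
  have keep: "ladj r x y" if "ladj l x y" for x
    by (rule ladj_rots[OF r that]) (use new that in blast)
  have ladj1: "ladj l (last us) y"
    using us ll by (metis append.assoc append_Cons append_Nil append_butlast_last_id ladj_def)
  have "ladj l (last pre) y"
  \<comment> \<open>A last vertex has only one path neighbour; rotations fix the last vertex, so
    \<open>y\<close> is still last in \<open>r\<close>.\<close>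
  proof (cases vs)
    case Nil
    then have "last r = y" using inv ll by simp
    then have "post = []" using rr dr by (cases post rule: rev_cases) auto
    then have "last us = last pre"
      using ladj_at[of pre y post "last us"] keep[OF ladj1] dr rr by auto
    then show ?thesis using ladj1 by simp
  next
    case (Cons z zs)
    have ladj2: "ladj l z y" using ll Cons by (auto simp: ladj_def)
    have "z \<noteq> last us" using dl ll Cons us by auto
    then have "last pre = z \<or> last pre = last us"
      using ladj_at[of pre y post] keep[OF ladj1] keep[OF ladj2] dr rr by metis
    then show ?thesis using ladj1 ladj2 by auto
  qed
  then show ?thesis using that rr pre by blast
qed

section \<open>Blocks of a path that survive rotations\<close>

definition unbroken :: "'a list \<Rightarrow> 'a list \<Rightarrow> bool" where
  "unbroken r I \<longleftrightarrow> (\<exists>us vs. r = us @ I @ vs) \<or> (\<exists>us vs. r = us @ rev I @ vs)"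

lemma unbroken_rev: "unbroken (rev r) I \<longleftrightarrow> unbroken r I"
proof -
  have "unbroken (rev r) I" if "unbroken r I" for r
    using that unfolding unbroken_def by (metis append.assoc rev_append rev_rev_ident)
  then show ?thesis by (metis rev_rev_ident)
qed

text \<open>The list is cut in one place only, and a block with vertices on both sides of the cut
  contains \<open>last pre\<close>.\<close>

lemma unbroken_rotate:
  assumes "unbroken (pre @ post) I" "pre \<noteq> []" "last pre \<notin> set I"
  shows "unbroken (rev pre @ post) I"
proof -
  have main: "unbroken (rev pre @ post) I"
    if eq: "pre @ post = us @ J @ vs" and n: "last pre \<notin> set J" and J: "J = I \<or> J = rev I" for us vs J
  proof -
    from eq consider ws where "pre = us @ ws" "ws @ post = J @ vs"
      | ws where "pre @ ws = us" "post = ws @ J @ vs"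
      by (auto simp: append_eq_append_conv2)
    then show ?thesis
    proof cases
      case 1
      from 1(2) consider xs where "ws = J @ xs" "xs @ post = vs"
        | xs where "ws @ xs = J" "post = xs @ vs" by (auto simp: append_eq_append_conv2)
      then show ?thesis
      proof cases
        case a: 1
        then have "rev pre @ post = rev xs @ rev J @ (rev us @ post)" using 1 by simp
        then show ?thesis using J unfolding unbroken_def by (metis rev_rev_ident)
      next
        case a: 2
        show ?thesis
        proof (cases "ws = []")
          case True
          then have "rev pre @ post = rev pre @ J @ vs" using a by simp
          then show ?thesis using J unfolding unbroken_def by metis
        next
          case False
          then have "last pre \<in> set J" using 1(1) a(1) by auto
          then show ?thesis using n by simp
        qed
      qed
    next
      case 2
      then have "rev pre @ post = (rev pre @ ws) @ J @ vs" by simp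
      then show ?thesis using J unfolding unbroken_def by metis
    qed
  qed
  show ?thesis using assms(1) unfolding unbroken_def[of "pre @ post"]
    using main[of _ I] main[of _ "rev I"] assms(3) by auto
qed

text \<open>The blocks are disjoint, so the new head lies in at most one of them and each rotation
  spoils at most one block.\<close>

lemma rots_unbroken:
  assumes "rots E R l n r" and "finite S"
    and disj: "\<And>i j. i \<in> S \<Longrightarrow> j \<in> S \<Longrightarrow> i \<noteq> j \<Longrightarrow> set (b i) \<inter> set (b j) = {}"
  shows "card {i\<in>S. \<not> unbroken r (b i)} \<le> card {i\<in>S. \<not> unbroken l (b i)} + n"
  using assms(1)
proof induction
  case (rots_step n pre post)
  let ?W = "{i\<in>S. last pre \<in> set (b i)}"
  have "\<forall>i\<in>?W. \<forall>j\<in>?W. i = j" using disj by blast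
  then have W: "card ?W \<le> 1" using assms(2) by (auto simp: card_le_Suc0_iff_eq)
  have "{i\<in>S. \<not> unbroken (rev pre @ post) (b i)} \<subseteq> {i\<in>S. \<not> unbroken (pre @ post) (b i)} \<union> ?W"
    using unbroken_rotate[OF _ \<open>pre \<noteq> []\<close>] by blast
  then have "card {i\<in>S. \<not> unbroken (rev pre @ post) (b i)}
      \<le> card ({i\<in>S. \<not> unbroken (pre @ post) (b i)} \<union> ?W)"
    using assms(2) by (intro card_mono) auto
  also have "\<dots> \<le> card {i\<in>S. \<not> unbroken (pre @ post) (b i)} + card ?W" by (rule card_Un_le)
  finally show ?case using rots_step.IH W by simp
qed simp

lemma disjoint_sublists_order:
  assumes eq: "us @ I @ vs = us' @ J @ vs'" and "set I \<inter> set J = {}" "I \<noteq> []" "J \<noteq> []"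
  shows "(\<exists>A B C. us @ I @ vs = A @ I @ B @ J @ C) \<or> (\<exists>A B C. us @ I @ vs = A @ J @ B @ I @ C)"
proof -
  have main: "\<exists>A B C. us @ I @ vs = A @ J @ B @ I @ C"
    if eq: "us @ I @ vs = us' @ J @ vs'" and d: "set I \<inter> set J = {}" and ne: "I \<noteq> []" "J \<noteq> []"
      and u: "us' @ ws = us" for us I vs us' J vs' ws
  proof -
    have "ws @ I @ vs = J @ vs'" using eq u by auto
    then consider xs where "ws = J @ xs" | xs where "ws @ xs = J" "I @ vs = xs @ vs'"
      by (auto simp: append_eq_append_conv2)
    then show ?thesis
    proof cases
      case 1
      then have "us @ I @ vs = us' @ J @ xs @ I @ vs" using u by auto
      then show ?thesis by blast
    next
      case 2
      show ?thesis
      proof (cases xs)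
        case Nil
        then have "us @ I @ vs = us' @ J @ [] @ I @ vs" using u 2 by auto
        then show ?thesis by blast
      next
        case (Cons x xs')
        then have "x \<in> set I" using 2 ne by (cases I) auto
        then show ?thesis using d 2 Cons by auto
      qed
    qed
  qed
  from eq consider ws where "us' @ ws = us" | ws where "us @ ws = us'"
    by (metis append_eq_append_conv2)
  then show ?thesis
  proof cases
    case 1
    then show ?thesis using main[OF eq assms(2-4) 1] by blast
  next
    case 2
    show ?thesis using main[OF eq[symmetric] _ assms(4,3) 2] assms(2) eq by auto
  qed
qed

section \<open>Hamiltonicity of expanding graphs\<close>

locale joined_graph =
  fixes V :: "'a set" and E :: "'a set set" and q :: nat
  assumes finite_V: "finite V" and q_pos: "0 < q"
    and joined: "\<And>A B. A \<subseteq> V \<Longrightarrow> B \<subseteq> V \<Longrightarrow> A \<inter> B = {} \<Longrightarrow> q \<le> card A \<Longrightarrow> q \<le> card B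
      \<Longrightarrow> \<exists>a\<in>A. \<exists>b\<in>B. {a, b} \<in> E"
begin

definition nbhd :: "'a set \<Rightarrow> 'a set" where
  "nbhd U = {y \<in> V. \<exists>u\<in>U. {u, y} \<in> E}"

text \<open>Inner vertices of \<open>I\<close> that avoid \<open>X\<close> together with both of
  their neighbours on \<open>I\<close>. While these surroundings are intact, a rotation with such a
  pivot produces a head in \<open>I\<close> outside \<open>X\<close>.\<close>

definition core :: "'a list \<Rightarrow> 'a set \<Rightarrow> 'a set" where
  "core I X = {y. \<exists>us x z vs. I = us @ x # y # z # vs \<and> x \<notin> X \<and> y \<notin> X \<and> z \<notin> X}"

lemma core_subset: "core I X \<subseteq> set I - X"
  by (auto simp: core_def)

lemma core_antimono: "X \<subseteq> Y \<Longrightarrow> core I Y \<subseteq> core I X"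
  unfolding core_def by blast

text \<open>Each vertex of \<open>X\<close> spoils at most three positions, as left neighbour,
  middle or right neighbour; the two ends of \<open>I\<close> are lost in any case.\<close>

lemma card_core:
  assumes "distinct I" "finite X"
  shows "length I \<le> card (core I X) + 3 * card X + 2"
proof -
  let ?Z = "{i. i + 2 < length I \<and> I ! i \<in> X} \<union> {i. i + 2 < length I \<and> I ! (i+1) \<in> X}
     \<union> {i. i + 2 < length I \<and> I ! (i+2) \<in> X}"
  have c: "card {i. i + 2 < length I \<and> I ! (i+j) \<in> X} \<le> card X" if "j \<le> 2" for j
    by (rule card_inj_on_le[of "\<lambda>i. I ! (i + j)"])
       (use assms that in \<open>auto simp: inj_on_def nth_eq_iff_index_eq\<close>)
  have cZ: "card ?Z \<le> 3 * card X"
    using c[of 0] c[of 1] c[of 2] card_Un_le[of "{i. i + 2 < length I \<and> I ! i \<in> X} \<union> {i. i + 2 < length I \<and> I ! (i+1) \<in> X}"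
       "{i. i + 2 < length I \<and> I ! (i+2) \<in> X}"]
      card_Un_le[of "{i. i + 2 < length I \<and> I ! i \<in> X}" "{i. i + 2 < length I \<and> I ! (i+1) \<in> X}"]
    by simp
  have "(\<lambda>i. I ! (i+1)) ` ({..<length I - 2} - ?Z) \<subseteq> core I X"
  proof
    fix y assume "y \<in> (\<lambda>i. I ! (i+1)) ` ({..<length I - 2} - ?Z)"
    then obtain i where i: "i \<in> {..<length I - 2}" "i \<notin> ?Z" "y = I ! (i+1)" by blast
    then have i2: "i + 2 < length I" by auto
    have "I = take i I @ I ! i # I ! (i+1) # I ! (i+2) # drop (i+3) I"
      using i2 by (simp add: Cons_nth_drop_Suc numeral_3_eq_3)
    moreover have "I ! i \<notin> X" "I ! (i+1) \<notin> X" "I ! (i+2) \<notin> X" using i(2) i2 by auto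
    ultimately show "y \<in> core I X" unfolding core_def i(3) by blast
  qed
  moreover have "finite (core I X)" using core_subset[of I X] by (rule finite_subset) auto
  ultimately have "card ((\<lambda>i. I ! (i+1)) ` ({..<length I - 2} - ?Z)) \<le> card (core I X)"
    by (intro card_mono)
  moreover have "card ((\<lambda>i. I ! (i+1)) ` ({..<length I - 2} - ?Z)) = card ({..<length I - 2} - ?Z)"
    by (rule card_image) (use assms in \<open>auto simp: inj_on_def nth_eq_iff_index_eq\<close>)
  moreover have "length I - 2 - card ?Z \<le> card ({..<length I - 2} - ?Z)"
    using diff_card_le_card_Diff[of ?Z "{..<length I - 2}"] finite_subset[of ?Z "{..<length I}"] by fastforce
  ultimately show ?thesis using cZ by linarith
qed

lemma nbhd_Un: "nbhd (A \<union> B) = nbhd A \<union> nbhd B"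
  by (auto simp: nbhd_def)

text \<open>The largest set violating expansion towards its own core is small, because a violating set of
  size between \<open>q\<close> and \<open>2q\<close> would leave many vertices of \<open>I\<close> not joined to it.\<close>

lemma expanding_part:
  assumes I: "distinct I" "set I \<subseteq> V" "13 * q + 2 \<le> length I"
  obtains X where "X \<subseteq> set I" "card X \<le> q"
    "\<And>U. U \<subseteq> set I - X \<Longrightarrow> U \<noteq> {} \<Longrightarrow> card U \<le> q \<Longrightarrow> 3 * card U < card (nbhd U \<inter> core I X)"
proof -
  define \<Phi> where "\<Phi> X \<longleftrightarrow> X \<subseteq> set I \<and> card (nbhd X \<inter> core I X) \<le> 3 * card X" for X
  have fin: "finite (core I X)" for X using core_subset[of I X] by (rule finite_subset) auto
  have "\<Phi> {} \<and> card {} \<le> q" by (simp add: \<Phi>_def nbhd_def)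
  moreover have "\<forall>X. \<Phi> X \<and> card X \<le> q \<longrightarrow> card X < Suc q" by simp
  ultimately obtain X where X: "\<Phi> X" "card X \<le> q"
    and max: "\<And>Y. \<Phi> Y \<Longrightarrow> card Y \<le> q \<Longrightarrow> card Y \<le> card X"
    using ex_has_greatest_nat[of "\<lambda>X. \<Phi> X \<and> card X \<le> q" "{}" card "Suc q"] by auto
  have "3 * card U < card (nbhd U \<inter> core I X)"
    if U: "U \<subseteq> set I - X" "U \<noteq> {}" "card U \<le> q" for U
  proof (rule ccontr)
    assume "\<not> ?thesis"
    then have le: "card (nbhd U \<inter> core I X) \<le> 3 * card U" by simp
    let ?Z = "X \<union> U"
    have finX: "finite X" and finU: "finite U"
      using X(1) U(1) unfolding \<Phi>_def by (auto intro: finite_subset[OF _ finite_set[of I]])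
    have cZ: "card ?Z = card X + card U" using U(1) finX finU by (intro card_Un_disjoint) auto
    \<comment> \<open>Cores shrink as the removed set grows, so adding the violating
      \<open>U\<close> to \<open>X\<close> keeps the violation.\<close>
    have "nbhd ?Z \<inter> core I ?Z \<subseteq> (nbhd X \<inter> core I X) \<union> (nbhd U \<inter> core I X)"
      using core_antimono[of X ?Z I] by (auto simp: nbhd_Un)
    then have "card (nbhd ?Z \<inter> core I ?Z) \<le> card ((nbhd X \<inter> core I X) \<union> (nbhd U \<inter> core I X))"
      using fin by (intro card_mono) auto
    also have "\<dots> \<le> card (nbhd X \<inter> core I X) + card (nbhd U \<inter> core I X)" by (rule card_Un_le)
    also have "\<dots> \<le> 3 * card ?Z" using X(1) le cZ unfolding \<Phi>_def by simp
    finally have c3: "card (nbhd ?Z \<inter> core I ?Z) \<le> 3 * card ?Z" .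
    then have "\<Phi> ?Z" using X(1) U(1) by (auto simp: \<Phi>_def)
    moreover have "card U > 0" using U(2) finU by (simp add: card_gt_0_iff)
    ultimately have big: "q < card ?Z" using max[of ?Z] cZ by linarith
    let ?B = "core I ?Z - nbhd ?Z"
    have "card ?B = card (core I ?Z) - card (nbhd ?Z \<inter> core I ?Z)"
      using fin by (subst card_Diff_subset_Int) (auto simp: Int_commute)
    \<comment> \<open>Origin of 13: \<open>?Z\<close> has at most \<open>2 q\<close> vertices, so
      its core has at least \<open>13 q - 6 q\<close> of them, of which at most \<open>6 q\<close>
      are neighbours of \<open>?Z\<close>.\<close>
    then have "q \<le> card ?B"
      using card_core[OF I(1), of ?Z] finX finU c3 cZ X(2) U(3) I(3) by simp
    moreover have "?Z \<subseteq> V" "?B \<subseteq> V" "?Z \<inter> ?B = {}"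
      using core_subset[of I ?Z] I(2) X(1) U(1) unfolding \<Phi>_def by auto
    ultimately obtain a b where "a \<in> ?Z" "b \<in> ?B" "{a, b} \<in> E"
      using joined[of ?Z ?B] big by auto
    then show False using \<open>?B \<subseteq> V\<close> unfolding nbhd_def by blast
  qed
  then show ?thesis using that X unfolding \<Phi>_def by blast
qed

text \<open>\<open>l\<close> is the part of a path before the block \<open>I\<close>. Since
  \<open>last I\<close> stays fixed, whatever follows the block can be attached again;
  \<open>R\<close> will be the block itself, which keeps the endpoint sets of different blocks
  disjoint.\<close>

definition endpoints :: "'a set \<Rightarrow> 'a list \<Rightarrow> 'a list \<Rightarrow> 'a set" where
  "endpoints R l I = {s. \<exists>r. is_path E r \<and> set r = set (l @ I) \<and> last r = last I \<and> hd r = s \<and> s \<in> R}"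

text \<open>\<open>T\<close> depends on the block alone and not on \<open>L\<close>, so the vertices
  without a neighbour in it can be counted before any path is rotated. The proof is Posa's argument
  inside the block: the endpoints \<open>S\<close> satisfy
  \<open>card (nbhd S \<inter> T) \<le> 3 * card S\<close>, which \<open>expanding_part\<close>
  forbids up to size \<open>q\<close>.\<close>

lemma segment_rotation:
  assumes I: "distinct I" "set I \<subseteq> V" "13 * q + 2 \<le> length I"
  obtains T where "T \<subseteq> set I" "2 * q \<le> card T"
    "\<And>L. is_path E (L @ I) \<Longrightarrow> (\<exists>y\<in>T. {hd (L @ I), y} \<in> E) \<Longrightarrow> q < card (endpoints (set I) L I)"
proof -
  obtain X where X: "X \<subseteq> set I" "card X \<le> q"
    and ex: "\<And>U. U \<subseteq> set I - X \<Longrightarrow> U \<noteq> {} \<Longrightarrow> card U \<le> q \<Longrightarrow> 3 * card U < card (nbhd U \<inter> core I X)"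
    using expanding_part[OF I] by metis
  define T where "T = core I X"
  have finX: "finite X" using X(1) by (rule finite_subset) auto
  have "2 * q \<le> card T"
    using card_core[OF I(1) finX] X(2) I(3) unfolding T_def by linarith
  moreover have "T \<subseteq> set I" using core_subset T_def by blast
  moreover have "q < card (endpoints (set I) L I)"
    if p: "is_path E (L @ I)" and y: "\<exists>y\<in>T. {hd (L @ I), y} \<in> E" for L
  proof -
    let ?l = "L @ I"
    \<comment> \<open>\<open>n \<ge> 1\<close> drops the initial head, which may lie in
      \<open>L\<close> or in \<open>X\<close>.\<close>
    define S where "S = {hd r |r n. rots E (set I - X) ?l n r \<and> n \<ge> 1}"
    have Ine: "I \<noteq> []" using I(3) by auto
    have dl: "distinct ?l" using p by (simp add: is_path_def)
    have S1: "S \<subseteq> set I - X"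
    proof
      fix s assume "s \<in> S"
      then obtain r n where "rots E (set I - X) ?l n r" "n \<ge> 1" "s = hd r" unfolding S_def by blast
      then show "s \<in> set I - X" by cases (auto simp: hd_rev)
    qed
    have "S \<subseteq> endpoints (set I) L I"
    proof
      fix s assume "s \<in> S"
      then obtain r n where r: "rots E (set I - X) ?l n r" "s = hd r" unfolding S_def by auto
      show "s \<in> endpoints (set I) L I"
        unfolding endpoints_def using rots_inv[OF r(1) p] r(2) \<open>s \<in> S\<close> S1 Ine
        by auto
    qed
    moreover have "finite (endpoints (set I) L I)"
      by (rule finite_subset[of _ "set I"]) (auto simp: endpoints_def)
    ultimately have le: "card S \<le> card (endpoints (set I) L I)" by (rule card_mono[rotated])
    have finS: "finite S" using S1 by (rule finite_subset) auto
    have adjT: "\<exists>x z. ladj ?l x y \<and> ladj ?l z y \<and> x \<notin> X \<and> z \<notin> X \<and> x \<in> set I \<and> z \<in> set I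
        \<and> {w. ladj ?l w y} \<subseteq> {x, z} \<and> y \<in> set I - X \<and> y \<noteq> hd ?l" if "y \<in> T" for y
    proof -
      obtain us x z vs where *: "I = us @ x # y # z # vs" "x \<notin> X" "y \<notin> X" "z \<notin> X"
        using \<open>y \<in> T\<close> unfolding T_def core_def by blast
      have l1: "?l = (L @ us @ [x]) @ y # z # vs" using * by simp
      have a: "ladj ?l x y" using * unfolding ladj_def by (metis append.assoc)
      have b: "ladj ?l z y" unfolding ladj_def using l1 by metis
      have "w \<in> {x, z}" if "ladj ?l w y" for w
        using ladj_at[of "L @ us @ [x]" y "z # vs" w] that dl l1 by auto
      moreover have "y \<noteq> hd ?l"
      proof -
        have "hd ?l = hd (L @ us @ [x])" by (subst l1, subst hd_append) simp
        moreover have "hd (L @ us @ [x]) \<in> set (L @ us @ [x])" by (rule hd_in_set) simp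
        moreover have "y \<notin> set (L @ us @ [x])" using dl unfolding l1 by auto
        ultimately show ?thesis by metis
      qed
      ultimately show ?thesis using * a b by (intro exI[of _ x] exI[of _ z]) auto
    qed
    have step: "last pre \<in> S"
      if r: "rots E (set I - X) ?l n (pre @ y # post)" "pre \<noteq> []" and e: "{hd pre, y} \<in> E"
        and la: "ladj ?l (last pre) y" and "y \<in> T" for n pre y post
    proof -
      have "last pre \<in> set I - X" using adjT[OF \<open>y \<in> T\<close>] la by blast
      then have "rots E (set I - X) ?l (Suc n) (rev pre @ y # post)"
        using rots_step[OF r(1,2)] e by simp
      then show ?thesis unfolding S_def using r(2) by (force simp: hd_rev)
    qed
    have "S \<noteq> {}"
    proof -
      obtain y where y: "y \<in> T" "{hd ?l, y} \<in> E" using y by auto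
      have "y \<noteq> hd ?l" "y \<in> set ?l" using adjT[OF y(1)] by auto
      then obtain pre post where "?l = pre @ y # post" "pre \<noteq> []" "ladj ?l (last pre) y"
        using rots_pivot[OF rots_refl p] by (metis le_zero_eq not_one_le_zero)
      then show ?thesis using step[of 0 pre y post] y rots_refl[of E "set I - X" ?l]
        by (metis empty_iff hd_append2)
    qed
    \<comment> \<open>Otherwise the surroundings of \<open>y\<close> are intact, and rotating there
      would put a path neighbour of \<open>y\<close> into \<open>S\<close>.\<close>
    have "nbhd S \<inter> T \<subseteq> S \<union> {y. \<exists>x\<in>S. ladj ?l x y}"
    proof
      fix y assume "y \<in> nbhd S \<inter> T"
      then obtain u where y: "y \<in> T" "u \<in> S" "{u, y} \<in> E" by (auto simp: nbhd_def)
      then obtain r n where r: "rots E (set I - X) ?l n r" "u = hd r" "n \<ge> 1" by (auto simp: S_def)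
      show "y \<in> S \<union> {y. \<exists>x\<in>S. ladj ?l x y}"
      proof (rule ccontr)
        assume no: "y \<notin> S \<union> {y. \<exists>x\<in>S. ladj ?l x y}"
        have "y \<noteq> hd r" using no y r by auto
        moreover have "y \<noteq> hd ?l" "y \<in> set ?l" using adjT[OF y(1)] by auto
        moreover have "hd r' \<noteq> x" if "1 \<le> m" "rots E (set I - X) ?l m r'" "x = y \<or> ladj ?l x y" for m r' x
          using that no unfolding S_def by auto
        ultimately obtain pre post where "r = pre @ y # post" "pre \<noteq> []" "ladj ?l (last pre) y"
          using rots_pivot[OF r(1) p] by metis
        then show False using step[of n pre y post] r y no by auto
      qed
    qed
    then have "card (nbhd S \<inter> T) \<le> card (S \<union> {y. \<exists>x\<in>S. ladj ?l x y})"
      using card_ladj_UN_le[OF dl finS] finS by (intro card_mono) auto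
    also have "\<dots> \<le> card S + card {y. \<exists>x\<in>S. ladj ?l x y}" by (rule card_Un_le)
    also have "\<dots> \<le> 3 * card S" using card_ladj_UN_le[OF dl finS] by simp
    finally have "q < card S" using ex[OF S1 \<open>S \<noteq> {}\<close>] unfolding T_def by linarith
    then show ?thesis using le by simp
  qed
  ultimately show ?thesis using that by blast
qed

text \<open>Removing \<open>q\<close> unjoined vertices from \<open>T\<close> leaves
  \<open>q\<close> others, as disjoint sets are needed; hence \<open>2 * q\<close>.\<close>

lemma card_not_joined:
  assumes "T \<subseteq> V" "2 * q \<le> card T"
  shows "card {v\<in>V. \<not> (\<exists>y\<in>T. {v, y} \<in> E)} < q"
proof (rule ccontr)
  assume "\<not> ?thesis"
  then obtain Z where Z: "Z \<subseteq> {v\<in>V. \<not> (\<exists>y\<in>T. {v, y} \<in> E)}" "card Z = q"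
    by (meson not_less obtain_subset_with_card_n)
  have finZ: "finite Z" using Z q_pos by (metis card.infinite less_irrefl)
  have "q \<le> card (T - Z)" using diff_card_le_card_Diff[OF finZ, of T] Z assms by linarith
  then obtain a b where "a \<in> Z" "b \<in> T - Z" "{a, b} \<in> E"
    using joined[of Z "T - Z"] Z assms by auto
  then show False using Z by auto
qed

end

section \<open>Longest paths, their endpoints, and closing them to a cycle\<close>

context joined_graph
begin

definition longest :: "'a list \<Rightarrow> bool" where
  "longest l \<longleftrightarrow> is_path E l \<and> set l \<subseteq> V \<and>
     (\<forall>l'. is_path E l' \<longrightarrow> set l' \<subseteq> V \<longrightarrow> length l' \<le> length l)"

lemma longest_exists: "\<exists>l. longest l"
proof -
  have "is_path E [] \<and> set [] \<subseteq> V" by (simp add: is_path_def)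
  moreover have "\<forall>l. is_path E l \<and> set l \<subseteq> V \<longrightarrow> length l < Suc (card V)"
    using finite_V by (metis is_path_def card_mono distinct_card le_imp_less_Suc)
  ultimately show ?thesis
    using ex_has_greatest_nat[of "\<lambda>l. is_path E l \<and> set l \<subseteq> V" "[]" length "Suc (card V)"]
    unfolding longest_def by blast
qed

lemma longest_transfer:
  assumes "longest l" "is_path E r" "set r = set l"
  shows "longest r"
proof -
  have "length r = length l" using assms by (metis distinct_card is_path_def longest_def)
  then show ?thesis using assms by (simp add: longest_def)
qed

lemma longest_nbr:
  assumes "longest r" "{hd r, y} \<in> E" "y \<in> V" "r \<noteq> []"
  shows "y \<in> set r"
proof (rule ccontr)
  assume "y \<notin> set r"
  then have "is_path E (y # r)" "set (y # r) \<subseteq> V"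
    using assms by (auto simp: longest_def is_path_def successively_Cons insert_commute)
  then have "length (y # r) \<le> length r" using assms(1) unfolding longest_def by blast
  then show False by simp
qed

text \<open>The number of rotations is bounded because each of them may break a block.\<close>

definition ends :: "'a list \<Rightarrow> nat \<Rightarrow> 'a set" where
  "ends l n = {hd r |r m. m \<le> n \<and> rots E UNIV l m r}"

lemma ends_mono: "m \<le> n \<Longrightarrow> ends l m \<subseteq> ends l n"
  unfolding ends_def using order_trans by blast

lemma hd_in_ends: "hd l \<in> ends l n"
  unfolding ends_def using rots_refl by blast

lemma ends_subset:
  assumes "is_path E l" "l \<noteq> []"
  shows "ends l n \<subseteq> set l"
proof
  fix x assume "x \<in> ends l n"
  then obtain r m where r: "rots E UNIV l m r" "x = hd r" unfolding ends_def by blast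
  then have "set r = set l" using rots_inv assms by blast
  then show "x \<in> set l" using r(2) assms(2) by (metis hd_in_set set_empty)
qed

text \<open>Posa's lemma level by level: a neighbour \<open>y\<close> of an endpoint lies on the
  path by maximality. Either a path neighbour of \<open>y\<close> is already an endpoint, or one
  more rotation with pivot \<open>y\<close> makes it one.\<close>

lemma nbhd_ends:
  assumes l: "longest l" "l \<noteq> []"
  shows "nbhd (ends l n) - ends l n \<subseteq> {y. \<exists>x\<in>ends l (Suc n). ladj l x y}"
proof
  fix y assume y: "y \<in> nbhd (ends l n) - ends l n"
  have p: "is_path E l" using l by (simp add: longest_def)
  obtain r m where r: "rots E UNIV l m r" "m \<le> n" "{hd r, y} \<in> E" and yV: "y \<in> V"
    using y unfolding nbhd_def ends_def by blast
  have inv: "is_path E r \<and> set r = set l" using rots_inv[OF r(1) p] by blast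
  then have "y \<in> set l"
    using longest_nbr[OF longest_transfer[OF l(1)], of r y] inv r(3) yV l(2) by fastforce
  moreover have "y \<noteq> hd r" using y r unfolding ends_def by blast
  moreover have "y \<noteq> hd l" using y hd_in_ends by blast
  show "y \<in> {y. \<exists>x\<in>ends l (Suc n). ladj l x y}"
  proof (rule ccontr)
    assume no: "y \<notin> {y. \<exists>x\<in>ends l (Suc n). ladj l x y}"
    have "hd r' \<noteq> x" if "1 \<le> k" "k \<le> m" "rots E UNIV l k r'" "x = y \<or> ladj l x y" for k r' x
    proof -
      have "hd r' \<in> ends l n" unfolding ends_def using that r(2) order_trans by blast
      then show ?thesis using that(4) y no ends_mono[of n "Suc n" l] by auto
    qed
    then obtain pre post where pp: "r = pre @ y # post" "pre \<noteq> []" "ladj l (last pre) y"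
      using rots_pivot[OF r(1) p \<open>y \<in> set l\<close> \<open>y \<noteq> hd r\<close> \<open>y \<noteq> hd l\<close>] by metis
    have "rots E UNIV l (Suc m) (rev pre @ y # post)"
      using rots_step[of E UNIV l m pre "y # post"] r pp by simp
    then have "hd (rev pre @ y # post) \<in> ends l (Suc n)" unfolding ends_def using r(2) by blast
    then have "last pre \<in> ends l (Suc n)" using pp(2) by (simp add: hd_rev)
    then show False using no pp(3) by blast
  qed
qed

lemma card_nbhd_ends:
  assumes "longest l" "l \<noteq> []"
  shows "card (nbhd (ends l n) - ends l n) \<le> 2 * card (ends l (Suc n))"
proof -
  have p: "distinct l" "is_path E l" using assms by (auto simp: longest_def is_path_def)
  have "finite (ends l (Suc n))" using ends_subset[OF p(2) assms(2)] by (rule finite_subset) auto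
  from card_ladj_UN_le[OF p(1) this] show ?thesis
    using card_mono nbhd_ends[OF assms, of n] by (meson le_trans)
qed

text \<open>The prefix \<open>A @ I\<close> and the reversed suffix are rotated independently while
  \<open>B\<close> stays in place. The two endpoint sets lie in the disjoint blocks and have more
  than \<open>q\<close> elements, so some edge joins them.\<close>

lemma closing:
  assumes r: "longest (A @ I @ B @ J @ C)" and ne: "I \<noteq> []" "J \<noteq> []"
    and I: "q < card (endpoints (set I) A I)" and J: "q < card (endpoints (set J) (rev C) (rev J))"
  obtains c where "longest c" "set c = set (A @ I @ B @ J @ C)" "{hd c, last c} \<in> E" "c \<noteq> []"
proof -
  have p: "is_path E (A @ I @ B @ J @ C)" using r by (simp add: longest_def)
  let ?X = "endpoints (set I) A I" and ?Y = "endpoints (set J) (rev C) (rev J)"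
  have XY: "?X \<subseteq> set I" "?Y \<subseteq> set J" by (auto simp: endpoints_def)
  have IJ: "set I \<subseteq> V" "set J \<subseteq> V" "set I \<inter> set J = {}"
    using r p by (auto simp: longest_def is_path_def)
  have "?X \<subseteq> V" "?Y \<subseteq> V" "?X \<inter> ?Y = {}" using XY IJ by blast+
  then obtain s1 s2 where s: "s1 \<in> ?X" "s2 \<in> ?Y" "{s1, s2} \<in> E"
    using joined[of ?X ?Y] less_imp_le[OF I] less_imp_le[OF J] by blast
  obtain r1 where r1: "is_path E r1" "set r1 = set (A @ I)" "last r1 = last I" "hd r1 = s1"
    using s(1) by (auto simp: endpoints_def)
  obtain r2 where r2: "is_path E r2" "set r2 = set (rev C @ rev J)" "last r2 = last (rev J)" "hd r2 = s2"
    using s(2) unfolding endpoints_def by blast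
  have ne': "r1 \<noteq> []" "r2 \<noteq> []" using r1 r2 ne by auto
  \<comment> \<open>\<open>r1\<close> runs from \<open>s1\<close> to \<open>last I\<close> and
    \<open>rev r2\<close> from \<open>hd J\<close> to \<open>s2\<close>, so \<open>B\<close> fits
    between them as before.\<close>
  let ?c = "r1 @ B @ rev r2"
  have "is_path E ?c"
  proof -
    have last_r1: "last r1 = last I" and hd_r2: "hd (rev r2) = hd J"
      using r1 r2 ne ne' by (simp_all add: hd_rev last_rev)
    have B: "is_path E B" "set B \<inter> set (A @ I) = {}" "set B \<inter> set (J @ C) = {}"
        "set (A @ I) \<inter> set (J @ C) = {}"
      using p by (auto simp: is_path_append_iff)
    have edges: "B \<noteq> [] \<Longrightarrow> {last I, hd B} \<in> E" "B \<noteq> [] \<Longrightarrow> {last B, hd J} \<in> E"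
        "B = [] \<Longrightarrow> {last I, hd J} \<in> E"
      using p ne by (auto simp: is_path_append_iff)
    have "is_path E (B @ rev r2)"
      using B r2(1,2) edges(2) hd_r2 unfolding is_path_append_iff[of E B] is_path_rev by auto
    moreover have "{last r1, hd (B @ rev r2)} \<in> E"
      using edges(1,3) last_r1 hd_r2 by (cases "B = []") auto
    moreover have "set r1 \<inter> set (B @ rev r2) = {}" using r1(2) r2(2) B by auto
    ultimately show ?thesis using r1(1) unfolding is_path_append_iff[of E r1] by auto
  qed
  moreover have "set ?c = set (A @ I @ B @ J @ C)" using r1 r2 by auto
  moreover have "hd ?c = s1" "last ?c = s2" using r1 r2 ne' by (auto simp: last_rev)
  ultimately show ?thesis using that[of ?c] longest_transfer[OF r] s(3) ne' by auto
qed

text \<open>Opening the cycle at a neighbour of a missed vertex and putting that vertex in front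
  gives a longer path.\<close>

lemma closed_longest_spans:
  assumes c: "longest c" "{hd c, last c} \<in> E" "c \<noteq> []"
    and conn: "\<And>W. W \<noteq> {} \<Longrightarrow> W = V - set c \<Longrightarrow> nbhd W - W \<noteq> {}"
  shows "set c = V"
proof (rule ccontr)
  assume "set c \<noteq> V"
  then have "V - set c \<noteq> {}" using c(1) by (auto simp: longest_def)
  from conn[OF this refl] obtain w x where w: "w \<in> V" "w \<notin> set c" "x \<in> set c" "{w, x} \<in> E"
    unfolding nbhd_def by blast
  obtain xs ys where xy: "c = xs @ x # ys" using w(3) by (meson split_list)
  have p: "is_path E c" using c(1) by (simp add: longest_def)
  let ?l = "[w] @ (x # ys) @ xs"
  have close: "{last (x # ys), hd xs} \<in> E" if "xs \<noteq> []"
    using c(2) that xy by (auto simp: insert_commute)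
  have p1: "is_path E xs" "is_path E (x # ys)" "set xs \<inter> set (x # ys) = {}"
    using p xy by (auto simp: is_path_append_iff)
  have "is_path E ((x # ys) @ xs)" using p1 close unfolding is_path_append_iff by auto
  then have "is_path E ?l" using w xy unfolding is_path_append_iff[of E "[w]"]
    by (auto simp: is_path_def)
  moreover have "set ?l \<subseteq> V" using c(1) w xy by (auto simp: longest_def)
  ultimately have "length ?l \<le> length c" using c(1) unfolding longest_def by blast
  then show False using xy by simp
qed

end

text \<open>The factor \<open>2 * g\<close> is halved by \<open>card_nbhd_ends\<close>, which leaves
  growth by \<open>g\<close> per rotation until \<open>q\<close> is reached after at most
  \<open>t\<close>. In \<open>large\<close>, \<open>2 * t + 4\<close> blocks are needed because
  \<open>t + 1\<close> rotations at each end break at most \<open>2 * t + 2\<close> and two must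
  remain; the last \<open>q\<close> allows for vertices off the path.\<close>

locale expander = joined_graph +
  fixes g t :: nat
  assumes expand: "\<And>U. U \<subseteq> V \<Longrightarrow> U \<noteq> {} \<Longrightarrow> card U \<le> q \<Longrightarrow> 2 * g * card U \<le> card (nbhd U - U)"
    and g_pos: "0 < g" and gt: "q \<le> g ^ t"
    and large: "(13 * q + 2) * (2 * t + 4) + q \<le> card V"
begin

text \<open>Once \<open>q\<close> endpoints are reached, fewer than \<open>q\<close> vertices lie
  outside them and their neighbourhood. By \<open>card_nbhd_ends\<close> that neighbourhood costs
  twice the next endpoint set, and the endpoints themselves once: hence the 3.\<close>

lemma ends_large:
  assumes l: "longest l" "l \<noteq> []"
  shows "card V \<le> q + 3 * card (ends l (Suc t))"
proof -
  have p: "is_path E l" "set l \<subseteq> V" using l by (auto simp: longest_def)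
  have sub: "ends l n \<subseteq> V" for n using ends_subset[OF p(1) l(2)] p(2) by blast
  have fin: "finite (ends l n)" for n using sub finite_V finite_subset by blast
  have ne: "ends l n \<noteq> {}" for n using hd_in_ends by blast
  have "min q (g ^ n) \<le> card (ends l n)" for n
  proof (induction n)
    case 0
    have "0 < card (ends l 0)" using ne fin by (simp add: card_gt_0_iff)
    then show ?case by simp
  next
    case (Suc n)
    show ?case
    proof (cases "card (ends l n) \<le> q")
      case True
      from expand[OF sub ne True] card_nbhd_ends[OF l, of n]
      have le: "g * card (ends l n) \<le> card (ends l (Suc n))" by linarith
      show ?thesis
      proof (cases "q \<le> card (ends l n)")
        case True
        then have "q \<le> g * card (ends l n)" using g_pos by (metis le_trans mult_le_mono1 nat_mult_1 Suc_leI One_nat_def)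
        then show ?thesis using le by simp
      next
        case False
        then have "g ^ n \<le> card (ends l n)" using Suc by linarith
        then have "g ^ Suc n \<le> g * card (ends l n)" by (metis mult_le_mono2 power_Suc)
        then show ?thesis using le by (metis le_trans min.coboundedI2)
      qed
    next
      case False
      moreover have "card (ends l n) \<le> card (ends l (Suc n))" using ends_mono fin by (intro card_mono) auto
      ultimately show ?thesis by simp
    qed
  qed
  from this[of t] have qt: "q \<le> card (ends l t)" using gt by simp
  have "card (V - (ends l t \<union> nbhd (ends l t))) < q"
  proof (rule ccontr)
    assume "\<not> ?thesis"
    then obtain a b where "a \<in> ends l t" "b \<in> V - (ends l t \<union> nbhd (ends l t))" "{a, b} \<in> E"
      using joined[OF sub[of t], of "V - (ends l t \<union> nbhd (ends l t))"] qt by auto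
    then show False unfolding nbhd_def by blast
  qed
  moreover have "V = (V - (ends l t \<union> nbhd (ends l t))) \<union> (ends l t \<union> (nbhd (ends l t) - ends l t))"
    using sub[of t] by (auto simp: nbhd_def)
  then have "card V = card ((V - (ends l t \<union> nbhd (ends l t))) \<union> (ends l t \<union> (nbhd (ends l t) - ends l t)))"
    by (rule arg_cong)
  then have "card V \<le> card (V - (ends l t \<union> nbhd (ends l t))) + (card (ends l t) + card (nbhd (ends l t) - ends l t))"
    using card_Un_le[of "V - (ends l t \<union> nbhd (ends l t))" "ends l t \<union> (nbhd (ends l t) - ends l t)"]
      card_Un_le[of "ends l t" "nbhd (ends l t) - ends l t"] by linarith
  moreover have "card (ends l t) \<le> card (ends l (Suc t))" using ends_mono fin by (intro card_mono) auto
  ultimately show ?thesis using card_nbhd_ends[OF l, of t] by linarith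
qed

text \<open>If \<open>q\<close> vertices were missed, one of them would be adjacent to a reachable
  endpoint and extend a longest path.\<close>

lemma longest_covers:
  assumes l: "longest l"
  shows "l \<noteq> []" "card (V - set l) < q"
proof -
  have "V \<noteq> {}" using large q_pos by auto
  then obtain v where "v \<in> V" by auto
  then have "is_path E [v]" "set [v] \<subseteq> V" by (auto simp: is_path_def)
  then have "length [v] \<le> length l" using l unfolding longest_def by blast
  then show ne: "l \<noteq> []" by auto
  have p: "is_path E l" "set l \<subseteq> V" using l by (auto simp: longest_def)
  have sub: "ends l (Suc t) \<subseteq> set l" using ends_subset[OF p(1) ne] .
  have "(13 * q + 2) * 4 \<le> (13 * q + 2) * (2 * t + 4)" by (rule mult_le_mono2) simp
  then have "(13 * q + 2) * 4 + q \<le> card V" using large by (meson add_le_mono1 order_trans)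
  then have "q \<le> card (ends l (Suc t))" using ends_large[OF l ne] by simp
  show "card (V - set l) < q"
  proof (rule ccontr)
    assume "\<not> ?thesis"
    then obtain a b where ab: "a \<in> ends l (Suc t)" "b \<in> V - set l" "{a, b} \<in> E"
      using joined[of "ends l (Suc t)" "V - set l"] \<open>q \<le> card (ends l (Suc t))\<close> sub p(2) by auto
    obtain r m where r: "rots E UNIV l m r" "a = hd r" using ab(1) unfolding ends_def by blast
    have inv: "is_path E r \<and> set r = set l" using rots_inv[OF r(1) p(1)] by blast
    then have "b \<in> set r"
      using longest_nbr[OF longest_transfer[OF l], of r b] inv ab r(2) ne by fastforce
    then show False using inv ab(2) by auto
  qed
qed

theorem hamiltonian_cycle_exists: "\<exists>c. is_path E c \<and> set c = V \<and> {hd c, last c} \<in> E"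
proof -
  obtain P where P: "longest P" using longest_exists by blast
  have Pp: "is_path E P" "set P \<subseteq> V" "distinct P" using P by (auto simp: longest_def is_path_def)
  define B where "B = 13 * q + 2"
  define K where "K = 2 * t + 4"
  have KB: "B * K + q \<le> card V" using large by (simp add: B_def K_def)
  have lenP: "B * K \<le> length P"
  proof -
    have "card V = card (set P) + card (V - set P)"
      using card_mono[OF finite_V Pp(2)] finite_subset[OF Pp(2) finite_V]
      by (subst card_Diff_subset) (use Pp(2) in auto)
    then show ?thesis using longest_covers(2)[OF P] KB distinct_card[OF Pp(3)] by linarith
  qed
  define b where "b i = take B (drop (i * B) P)" for i
  have iB: "i * B + B \<le> length P" if "i < K" for i
  proof -
    have "i * B + B = B * Suc i" by simp
    also have "\<dots> \<le> B * K" using that by (intro mult_le_mono2) simp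
    finally show ?thesis using lenP by simp
  qed
  have lenb: "length (b i) = B" if "i < K" for i using iB[OF that] by (simp add: b_def)
  have nthb: "b i ! x = P ! (i * B + x)" if "i < K" "x < B" for i x
    using iB[OF that(1)] that(2) by (simp add: b_def)
  have bP: "P = take (i * B) P @ b i @ drop B (drop (i * B) P)" for i
    unfolding b_def by (metis append_take_drop_id)
  have sb: "set (b i) \<subseteq> V" for i
    using Pp(2) set_take_subset set_drop_subset unfolding b_def by (metis order_trans)
  have db: "distinct (b i)" for i using Pp(3) by (simp add: b_def)
  have disj: "set (b i) \<inter> set (b j) = {}" if "i < K" "j < K" "i \<noteq> j" for i j
  proof (rule ccontr)
    assume "\<not> ?thesis"
    then obtain z where "z \<in> set (b i)" "z \<in> set (b j)" by blast
    moreover have "length (b i) = B" "length (b j) = B" using lenb that by auto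
    ultimately obtain x y where xy: "x < B" "y < B" "b i ! x = b j ! y"
      by (metis in_set_conv_nth)
    then have "P ! (i * B + x) = P ! (j * B + y)" using nthb that by metis
    moreover have "i * B + x < length P" "j * B + y < length P"
      using iB[OF that(1)] iB[OF that(2)] xy by linarith+
    ultimately have "i * B + x = j * B + y" using Pp(3) nth_eq_iff_index_eq by blast
    then have "(i * B + x) div B = (j * B + y) div B" by simp
    then show False using xy that(3) by simp
  qed
  have "\<exists>T. T \<subseteq> set I \<and> 2 * q \<le> card T \<and>
      (\<forall>L. is_path E (L @ I) \<longrightarrow> (\<exists>y\<in>T. {hd (L @ I), y} \<in> E) \<longrightarrow> q < card (endpoints (set I) L I))"
    if "distinct I" "set I \<subseteq> V" "B \<le> length I" for I
    using segment_rotation[OF that(1,2) that(3)[unfolded B_def]] by metis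
  then obtain T where T: "\<And>I. distinct I \<Longrightarrow> set I \<subseteq> V \<Longrightarrow> B \<le> length I \<Longrightarrow> T I \<subseteq> set I \<and> 2 * q \<le> card (T I) \<and>
      (\<forall>L. is_path E (L @ I) \<longrightarrow> (\<exists>y\<in>T I. {hd (L @ I), y} \<in> E) \<longrightarrow> q < card (endpoints (set I) L I))"
    by metis
  \<comment> \<open>Both orientations are required: rotations may reverse a surviving block, and the
    far end of the path reads its block backwards.\<close>
  define good where "good v \<longleftrightarrow> (\<forall>i<K. (\<exists>y\<in>T (b i). {v, y} \<in> E) \<and> (\<exists>y\<in>T (rev (b i)). {v, y} \<in> E))" for v
  define Z where "Z I = {v\<in>V. \<not> (\<exists>y\<in>T I. {v, y} \<in> E)}" for I
  have cZ: "card (Z (b i)) < q" "card (Z (rev (b i))) < q" if "i < K" for i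
  proof -
    have "T (b i) \<subseteq> V" "2 * q \<le> card (T (b i))" "T (rev (b i)) \<subseteq> V" "2 * q \<le> card (T (rev (b i)))"
      using T[of "b i"] T[of "rev (b i)"] db sb[of i] lenb[OF that] by auto
    then show "card (Z (b i)) < q" "card (Z (rev (b i))) < q"
      unfolding Z_def using card_not_joined by auto
  qed
  have bad: "card {v\<in>V. \<not> good v} < 2 * K * q"
  proof -
    have "{v\<in>V. \<not> good v} = (\<Union>i<K. Z (b i) \<union> Z (rev (b i)))" by (auto simp: good_def Z_def)
    then have "card {v\<in>V. \<not> good v} \<le> (\<Sum>i<K. card (Z (b i) \<union> Z (rev (b i))))"
      using card_UN_le[of "{..<K}" "\<lambda>i. Z (b i) \<union> Z (rev (b i))"] by simp
    also have "\<dots> < (\<Sum>i<K. 2 * q)"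
    proof (rule sum_strict_mono)
      show "{..<K} \<noteq> {}" by (auto simp: K_def lessThan_empty_iff)
      fix i assume "i \<in> {..<K}"
      then have "i < K" by simp
      from cZ[OF this] show "card (Z (b i) \<union> Z (rev (b i))) < 2 * q"
        using card_Un_le[of "Z (b i)" "Z (rev (b i))"] by linarith
    qed simp
    finally show ?thesis by (simp add: mult.commute mult.left_commute)
  qed
  have good_end: "\<exists>n r. n \<le> Suc t \<and> rots E UNIV l n r \<and> good (hd r)" if l: "longest l" for l
  proof -
    have ne: "l \<noteq> []" using longest_covers(1)[OF l] .
    have sub: "ends l (Suc t) \<subseteq> V" using ends_subset[of l "Suc t"] l ne by (auto simp: longest_def)
    \<comment> \<open>With \<open>B * K + q \<le> card V\<close> and \<open>ends_large\<close> this
      gives at least \<open>2 * K * q\<close> endpoints, more than there are bad vertices.\<close>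
    have "6 * (K * q) \<le> B * K" unfolding B_def by (simp add: algebra_simps)
    then have "2 * K * q \<le> card (ends l (Suc t))" using ends_large[OF l ne] KB by linarith
    then have "\<not> ends l (Suc t) \<subseteq> {v\<in>V. \<not> good v}"
      using bad card_mono[of "{v\<in>V. \<not> good v}" "ends l (Suc t)"] finite_V by auto
    then show ?thesis using sub unfolding ends_def by blast
  qed
  obtain n1 r1 where r1: "n1 \<le> Suc t" "rots E UNIV P n1 r1" "good (hd r1)" using good_end[OF P] by blast
  have inv1: "is_path E r1" "set r1 = set P" using rots_inv[OF r1(2) Pp(1)] by auto
  then have l1: "longest (rev r1)" using longest_transfer[OF P, of "rev r1"] by (simp add: is_path_rev)
  \<comment> \<open>Rotating the reversed path fixes its last vertex, the good vertex
    \<open>hd r1\<close>; so both ends of \<open>r2\<close> are good.\<close>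
  obtain n2 r2 where r2: "n2 \<le> Suc t" "rots E UNIV (rev r1) n2 r2" "good (hd r2)" using good_end[OF l1] by blast
  have inv2: "is_path E r2" "set r2 = set P" "last r2 = hd r1"
    using rots_inv[OF r2(2)] inv1 longest_covers(1)[OF l1] by (auto simp: is_path_rev last_rev)
  then have l2: "longest r2" using longest_transfer[OF P] by blast
  have "card {i\<in>{..<K}. \<not> unbroken r1 (b i)} \<le> card {i\<in>{..<K}. \<not> unbroken P (b i)} + n1"
    by (rule rots_unbroken[OF r1(2)]) (use disj in auto)
  moreover have "unbroken P (b i)" for i using bP[of i] unfolding unbroken_def by blast
  moreover have "card {i\<in>{..<K}. \<not> unbroken r2 (b i)} \<le> card {i\<in>{..<K}. \<not> unbroken (rev r1) (b i)} + n2"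
    by (rule rots_unbroken[OF r2(2)]) (use disj in auto)
  ultimately have "card {i\<in>{..<K}. \<not> unbroken r2 (b i)} \<le> 2 * t + 2"
    using r1(1) r2(1) by (simp add: unbroken_rev)
  moreover have "card {..<K} \<le> card {i\<in>{..<K}. \<not> unbroken r2 (b i)} + card {i\<in>{..<K}. unbroken r2 (b i)}"
    by (rule order_trans[OF card_mono card_Un_le]) auto
  \<comment> \<open>\<open>K = 2 * t + 4\<close> blocks minus at most \<open>2 * t + 2\<close>
    broken ones leaves two.\<close>
  ultimately have "\<not> card {i\<in>{..<K}. unbroken r2 (b i)} \<le> Suc 0" by (simp add: K_def)
  then obtain i j where ij: "i < K" "j < K" "i \<noteq> j" "unbroken r2 (b i)" "unbroken r2 (b j)"
    by (subst (asm) card_le_Suc0_iff_eq) auto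
  obtain I us vs where I: "I \<in> {b i, rev (b i)}" "r2 = us @ I @ vs" using ij(4) unfolding unbroken_def by blast
  obtain J us' vs' where J: "J \<in> {b j, rev (b j)}" "r2 = us' @ J @ vs'" using ij(5) unfolding unbroken_def by blast
  have B0: "B > 0" by (simp add: B_def)
  have ne: "I \<noteq> []" "J \<noteq> []" using I(1) J(1) lenb[OF ij(1)] lenb[OF ij(2)] B0 by auto
  have many: "q < card (endpoints (set X) L X)"
    if "is_path E (L @ X)" "good (hd (L @ X))" "i < K" "X \<in> {b i, rev (b i)}" for L X i
  proof -
    have "\<exists>y\<in>T X. {hd (L @ X), y} \<in> E" using that unfolding good_def by auto
    moreover have "distinct X" "set X \<subseteq> V" "B \<le> length X" using that db[of i] sb[of i] lenb[of i] by auto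
    ultimately show ?thesis using T[of X] that(1) by blast
  qed
  \<comment> \<open>Generic in both blocks, because rotations may have changed their order along the
    path.\<close>
  have fin: "\<exists>c. longest c \<and> {hd c, last c} \<in> E \<and> c \<noteq> []"
    if eq: "r2 = A @ I @ C @ J @ D" and I: "I \<in> {b i, rev (b i)}" and J: "J \<in> {b j, rev (b j)}"
      and ij: "i < K" "j < K" for A I C J D i j
  proof -
    have ne: "I \<noteq> []" "J \<noteq> []" using I J lenb[OF ij(1)] lenb[OF ij(2)] B0 by auto
    have p: "is_path E (A @ I)" "is_path E (J @ D)"
      using inv2(1) unfolding eq is_path_append_iff by auto
    have "is_path E (rev D @ rev J)" using p(2) is_path_rev[of E "J @ D"] by simp
    moreover have "hd (rev D @ rev J) = last r2" unfolding eq using ne by (simp add: hd_append hd_rev)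
    moreover have "rev J \<in> {b j, rev (b j)}" using J by auto
    ultimately have J': "q < card (endpoints (set J) (rev D) (rev J))"
      using many[of "rev D" "rev J" j] r1(3) inv2(3) ij(2) by simp
    have "hd (A @ I) = hd r2" unfolding eq using ne by (simp add: hd_append)
    then have "q < card (endpoints (set I) A I)" using many[OF p(1) _ ij(1) I] r2(3) by simp
    then show ?thesis using closing[of A I C J D] l2 eq ne J' by metis
  qed
  have "set I \<inter> set J = {}" using I(1) J(1) disj[OF ij(1-3)] by auto
  from disjoint_sublists_order[OF _ this ne, of us vs us' vs'] I(2) J(2)
  have "(\<exists>A C D. r2 = A @ I @ C @ J @ D) \<or> (\<exists>A C D. r2 = A @ J @ C @ I @ D)" by metis
  then obtain c where c: "longest c" "{hd c, last c} \<in> E" "c \<noteq> []"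
    using fin[OF _ I(1) J(1) ij(1,2)] fin[OF _ J(1) I(1) ij(2,1)] by blast
  have "set c = V"
  proof (rule closed_longest_spans[OF c])
    fix W assume W: "W \<noteq> {}" "W = V - set c"
    have "card W > 0" using W finite_V by (simp add: card_gt_0_iff)
    then have "0 < 2 * g * card W" using g_pos by simp
    also have "\<dots> \<le> card (nbhd W - W)"
      using expand[of W] W longest_covers(2)[OF c(1)] by auto
    finally show "nbhd W - W \<noteq> {}" by (metis card.empty less_irrefl)
  qed
  moreover have "is_path E c" using c(1) by (simp add: longest_def)
  ultimately show ?thesis using c(2) by (intro exI[of _ c] conjI)
qed

end

section \<open>From a spanning cycle to the notions of the theorem\<close>

lemma hamiltonian_of_path:
  assumes "is_path E c" "set c = {1..N}" "{hd c, last c} \<in> E" "3 \<le> N"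
  shows "hamiltonian N E"
proof -
  have d: "distinct c" "successively (\<lambda>x y. {x, y} \<in> E) c" using assms by (auto simp: is_path_def)
  have len: "length c = N" using distinct_card[OF d(1)] assms(2) by simp
  have "{c ! i, c ! (Suc i mod N)} \<in> E" if "i < N" for i
  proof (cases "Suc i < N")
    case True
    then show ?thesis using d(2) len by (simp add: successively_conv_nth)
  next
    case False
    then have "Suc i = N" using that by simp
    moreover have "c \<noteq> []" using len assms(4) by auto
    ultimately have "c ! i = last c" "c ! (Suc i mod N) = hd c"
      using len by (auto simp: last_conv_nth hd_conv_nth)
    then show ?thesis using assms(3) by (simp add: insert_commute)
  qed
  then show ?thesis unfolding hamiltonian_def hamiltonian_cycle_def
    using assms(2,4) d(1) len by (intro exI[of _ c] conjI allI impI)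
qed


text \<open>Every second edge of the cycle is taken; the vertex at position \<open>j\<close> belongs
  only to the edge with index \<open>j div 2\<close>.\<close>

lemma hamiltonian_imp_perfect_matching:
  assumes "hamiltonian N E" "even N"
  shows "\<exists>M. perfect_matching N E M"
proof -
  obtain vs where vs: "3 \<le> N" "length vs = N" "distinct vs" "set vs = {1..N}"
    and e: "\<And>i. i < N \<Longrightarrow> {vs ! i, vs ! (Suc i mod N)} \<in> E"
    using assms(1) unfolding hamiltonian_def hamiltonian_cycle_def by blast
  define M where "M = (\<lambda>i. {vs ! (2 * i), vs ! (2 * i + 1)}) ` {..<N div 2}"
  have "M \<subseteq> E"
  proof
    fix x assume "x \<in> M"
    then obtain i where i: "i < N div 2" "x = {vs ! (2 * i), vs ! (2 * i + 1)}" unfolding M_def by auto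
    then have "2 * i + 1 < N" using assms(2) by auto
    then show "x \<in> E" using e[of "2 * i"] i by simp
  qed
  moreover have "\<exists>!e. e \<in> M \<and> v \<in> e" if "v \<in> {1..N}" for v
  proof -
    have "v \<in> set vs" using that vs(4) by simp
    then obtain j where j: "j < N" "v = vs ! j" using vs(2) by (metis in_set_conv_nth)
    have mem: "vs ! j \<in> {vs ! (2 * i), vs ! (2 * i + 1)} \<longleftrightarrow> i = j div 2" if "i < N div 2" for i
    proof -
      have "2 * i < N" "2 * i + 1 < N" using that assms(2) by auto
      then have "vs ! j \<in> {vs ! (2 * i), vs ! (2 * i + 1)} \<longleftrightarrow> j = 2 * i \<or> j = 2 * i + 1"
        using vs j by (simp add: nth_eq_iff_index_eq)
      also have "\<dots> \<longleftrightarrow> i = j div 2" by presburger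
      finally show ?thesis .
    qed
    have jd: "j div 2 < N div 2" using j(1) assms(2) by auto
    show ?thesis
    proof (rule ex1I[of _ "{vs ! (2 * (j div 2)), vs ! (2 * (j div 2) + 1)}"])
      show "{vs ! (2 * (j div 2)), vs ! (2 * (j div 2) + 1)} \<in> M \<and>
          v \<in> {vs ! (2 * (j div 2)), vs ! (2 * (j div 2) + 1)}"
        using mem[OF jd] jd j(2) unfolding M_def by blast
    next
      fix e assume "e \<in> M \<and> v \<in> e"
      then obtain i where i: "i < N div 2" "e = {vs ! (2 * i), vs ! (2 * i + 1)}" "v \<in> e"
        unfolding M_def by blast
      then have "vs ! j \<in> {vs ! (2 * i), vs ! (2 * i + 1)}" using j(2) by metis
      then have "i = j div 2" using mem[OF i(1)] by metis
      then show "e = {vs ! (2 * (j div 2)), vs ! (2 * (j div 2) + 1)}" using i(2) by blast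
    qed
  qed
  ultimately show ?thesis unfolding perfect_matching_def by (intro exI[of _ M] conjI ballI)
qed

section \<open>Averages over independent two-valued variables\<close>

text \<open>For a centred variable the linear term averages out, which leaves a sub-Gaussian
  bound.\<close>

lemma exp_le_self_plus_exp_square: "exp x \<le> x + exp (x\<^sup>2)" for x :: real
proof -
  have sq: "1 + x\<^sup>2 \<le> exp (x\<^sup>2)" by simp
  consider "x \<ge> 1" | "0 \<le> x" "x \<le> 1" | "x < 0" by linarith
  then show ?thesis
  proof cases
    case 1
    then have "x \<le> x\<^sup>2" by (simp add: self_le_power)
    then have "exp x \<le> exp (x\<^sup>2)" by simp
    then show ?thesis using 1 by linarith
  next
    case 2
    then show ?thesis using exp_bound[of x] sq by linarith
  next
    case 3
    define y where "y = - x"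
    have y: "y > 0" using 3 by (simp add: y_def)
    \<comment> \<open>The product equals \<open>1 + y^3\<close>.\<close>
    have "1 \<le> (1 + y) * (1 - y + y\<^sup>2)"
      using y by (simp add: algebra_simps power2_eq_square)
    then have "inverse (1 + y) \<le> 1 - y + y\<^sup>2"
      using y by (simp add: field_simps)
    moreover have "exp x \<le> inverse (1 + y)"
      unfolding y_def using exp_ge_add_one_self[of "- x"] y
      by (metis add_pos_pos exp_minus inverse_inverse_eq le_imp_inverse_le y_def zero_less_one)
    ultimately have "exp x \<le> 1 - y + y\<^sup>2" by linarith
    then show ?thesis using sq unfolding y_def power2_minus by linarith
  qed
qed

text \<open>\<open>x^(2r) / (2r)!\<close> is a single term of the exponential series at
  \<open>\<bar>x\<bar>\<close>.\<close>

lemma power_le_fact_mult_exp: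
  fixes x :: real
  shows "x ^ (2 * r) \<le> fact (2 * r) * (exp x + exp (- x))"
proof -
  have "\<bar>x\<bar> ^ (2 * r) / fact (2 * r) \<le> exp \<bar>x\<bar>"
  proof -
    have "(\<lambda>n. \<bar>x\<bar> ^ n /\<^sub>R fact n) sums exp \<bar>x\<bar>" by (rule exp_converges)
    then have "(\<Sum>n\<in>{2 * r}. \<bar>x\<bar> ^ n /\<^sub>R fact n) \<le> exp \<bar>x\<bar>"
      by (metis (no_types, lifting) sums_unique sums_summable sum_le_suminf finite.emptyI
          finite_insert abs_ge_zero divideR_right fact_ge_zero scaleR_nonneg_nonneg
          zero_le_power inverse_nonnegative_iff_nonnegative)
    then show ?thesis by (simp add: divide_inverse mult.commute)
  qed
  moreover have "exp \<bar>x\<bar> \<le> exp x + exp (- x)" by (cases "x \<ge> 0") auto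
  moreover have "\<bar>x\<bar> ^ (2 * r) = x ^ (2 * r)" by (simp add: power_even_abs)
  ultimately have "x ^ (2 * r) / fact (2 * r) \<le> exp x + exp (- x)" by (metis order_trans)
  then show ?thesis by (simp add: pos_divide_le_eq mult.commute)
qed

text \<open>The average over independent centred variables taking the value 2 with probability 1/3 and
  -1 with probability 2/3: all their moments of order at least 2 are at least 1.\<close>

definition tav :: "'e set \<Rightarrow> (('e \<Rightarrow> real) \<Rightarrow> real) \<Rightarrow> real" where
  "tav F \<Phi> = (\<Sum>y\<in>PiE F (\<lambda>_. {2, -1}). (\<Prod>e\<in>F. if y e = 2 then 1/3 else 2/3) * \<Phi> y)"

lemma tav_sum: "tav F (\<lambda>y. \<Sum>i\<in>I. \<Phi> i y) = (\<Sum>i\<in>I. tav F (\<Phi> i))"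
  unfolding tav_def by (subst sum.swap) (simp add: sum_distrib_left)

lemma tav_cmult: "tav F (\<lambda>y. c * \<Phi> y) = c * tav F \<Phi>"
  unfolding tav_def by (simp add: sum_distrib_left mult_ac)

lemma tav_add: "tav F (\<lambda>y. \<Phi> y + \<Psi> y) = tav F \<Phi> + tav F \<Psi>"
  unfolding tav_def by (simp add: distrib_left sum.distrib)

lemma tav_mono:
  assumes "\<And>y. \<Phi> y \<le> \<Psi> y"
  shows "tav F \<Phi> \<le> tav F \<Psi>"
  unfolding tav_def
  by (intro sum_mono mult_left_mono assms prod_nonneg) auto

lemma tav_prod:
  assumes "finite F"
  shows "tav F (\<lambda>y. \<Prod>e\<in>F. f e (y e)) = (\<Prod>e\<in>F. (f e 2 + 2 * f e (-1)) / 3)"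
proof -
  have "tav F (\<lambda>y. \<Prod>e\<in>F. f e (y e)) =
      (\<Sum>y\<in>PiE F (\<lambda>_. {2, -1}). \<Prod>e\<in>F. (if y e = 2 then 1/3 else 2/3) * f e (y e))"
    unfolding tav_def by (simp add: prod.distrib)
  also have "\<dots> = (\<Prod>e\<in>F. \<Sum>a\<in>{2, -1}. (if a = 2 then 1/3 else 2/3) * f e a)"
    using assms by (subst prod_sum_PiE) auto
  also have "\<dots> = (\<Prod>e\<in>F. (f e 2 + 2 * f e (-1)) / 3)"
    by (intro prod.cong) (auto simp: field_simps)
  finally show ?thesis .
qed

lemma tav_const: "finite F \<Longrightarrow> tav F (\<lambda>_. c) = c"
  using tav_prod[of F "\<lambda>_ _. 1"] tav_cmult[of F c "\<lambda>_. 1"] by simp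

lemma prod_list_eq_prod_power:
  fixes f :: "'a \<Rightarrow> 'b :: comm_monoid_mult"
  assumes "finite S" "set es \<subseteq> S"
  shows "prod_list (map f es) = (\<Prod>e\<in>S. f e ^ count_list es e)"
  using assms(2)
proof (induction es)
  case (Cons a es)
  have "(\<Prod>e\<in>S. f e ^ count_list (a # es) e) = (\<Prod>e\<in>S. (if e = a then f e else 1) * f e ^ count_list es e)"
    by (intro prod.cong) auto
  also have "\<dots> = f a * (\<Prod>e\<in>S. f e ^ count_list es e)"
    using Cons.prems assms(1) by (simp add: prod.distrib)
  finally show ?case using Cons by simp
qed simp

text \<open>This is why the law is skew: symmetric signs would average to 0 as soon as one letter
  has odd multiplicity, whereas here every multiplicity from 2 on contributes a factor of at least
  1.\<close>

lemma tav_prod_list: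
  assumes "finite F" "set es \<subseteq> F"
  shows "0 \<le> tav F (\<lambda>y. prod_list (map y es))"
    and "(\<And>e. e \<in> set es \<Longrightarrow> 2 \<le> count_list es e) \<Longrightarrow> 1 \<le> tav F (\<lambda>y. prod_list (map y es))"
proof -
  define mom :: "nat \<Rightarrow> real" where "mom a = (2 ^ a + 2 * (-1) ^ a) / 3" for a
  have eq: "tav F (\<lambda>y. prod_list (map y es)) = (\<Prod>e\<in>F. mom (count_list es e))"
    using tav_prod[OF assms(1), of "\<lambda>e t. t ^ count_list es e"]
    by (simp add: prod_list_eq_prod_power[OF assms] mom_def)
  have m2: "1 \<le> mom a" if "2 \<le> a" for a
  proof -
    obtain b where a: "a = b + 2" using \<open>2 \<le> a\<close> by (metis add.commute le_Suc_ex)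
    have b: "(1::real) \<le> 2 ^ b" by simp
    have "\<bar>(-1::real) ^ a\<bar> = 1" by (simp add: power_abs)
    then consider "(-1::real) ^ a = 1" | "(-1::real) ^ a = -1" by linarith
    then show ?thesis
    proof cases
      case 1
      then have "mom a = 4 / 3 * 2 ^ b + 2 / 3" by (simp add: mom_def a power_add)
      then show ?thesis using mult_left_mono[OF b, of "4 / 3"] by linarith
    next
      case 2
      then have "odd b" using a by (metis even_add even_numeral neg_one_even_power one_neq_neg_one)
      then obtain c where "b = Suc c" by (metis odd_pos Suc_pred)
      then have "(2::real) \<le> 2 ^ b" by simp
      then show ?thesis using 2 by (simp add: mom_def a power_add)
    qed
  qed
  have m0: "0 \<le> mom a" for a
  proof -
    consider "a = 0" | "a = 1" | "2 \<le> a" by linarith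
    then show ?thesis using m2[of a] by cases (auto simp: mom_def)
  qed
  show "0 \<le> tav F (\<lambda>y. prod_list (map y es))" unfolding eq by (intro prod_nonneg m0)
  assume h: "\<And>e. e \<in> set es \<Longrightarrow> 2 \<le> count_list es e"
  have "1 \<le> mom (count_list es e)" for e
    by (cases "e \<in> set es") (use m2[OF h, of e] in \<open>auto simp: mom_def\<close>)
  then show "1 \<le> tav F (\<lambda>y. prod_list (map y es))" unfolding eq by (intro prod_ge_1)
qed

text \<open>In each factor the linear terms \<open>2 u\<close> and twice \<open>- u\<close> cancel,
  since the variable has mean zero.\<close>

lemma tav_exp_linear:
  assumes "finite F"
  shows "tav F (\<lambda>y. exp (\<Sum>e\<in>F. c e * y e)) \<le> exp (4 * (\<Sum>e\<in>F. (c e)\<^sup>2))"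
proof -
  have one: "(exp (2 * u) + 2 * exp (- u)) / 3 \<le> exp (4 * u\<^sup>2)" for u :: real
  proof -
    have "exp (2 * u) \<le> 2 * u + exp (4 * u\<^sup>2)"
      using exp_le_self_plus_exp_square[of "2 * u"] by (simp add: power_mult_distrib)
    moreover have "exp (- u) \<le> - u + exp (4 * u\<^sup>2)"
    proof -
      have "exp (u\<^sup>2) \<le> exp (4 * u\<^sup>2)" by simp
      moreover have "exp (- u) \<le> - u + exp (u\<^sup>2)"
        using exp_le_self_plus_exp_square[of "- u"] unfolding power2_minus .
      ultimately show ?thesis by linarith
    qed
    ultimately show ?thesis by simp
  qed
  have "tav F (\<lambda>y. exp (\<Sum>e\<in>F. c e * y e)) = tav F (\<lambda>y. \<Prod>e\<in>F. exp (c e * y e))"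
    using assms by (simp add: exp_sum)
  also have "\<dots> = (\<Prod>e\<in>F. (exp (c e * 2) + 2 * exp (c e * -1)) / 3)"
    by (rule tav_prod[OF assms, of "\<lambda>e t. exp (c e * t)"])
  also have "\<dots> \<le> (\<Prod>e\<in>F. exp (4 * (c e)\<^sup>2))"
  proof (rule prod_mono)
    fix e assume "e \<in> F"
    show "0 \<le> (exp (c e * 2) + 2 * exp (c e * - 1)) / 3 \<and>
         (exp (c e * 2) + 2 * exp (c e * - 1)) / 3 \<le> exp (4 * (c e)\<^sup>2)"
      using one[of "c e"] by (simp add: mult.commute)
  qed
  also have "\<dots> = exp (4 * (\<Sum>e\<in>F. (c e)\<^sup>2))"
    using assms by (simp add: exp_sum sum_distrib_left)
  finally show ?thesis .
qed

text \<open>The scale \<open>s\<close> is free. Each use picks it so that the exponent becomes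
  linear in the order of the moment.\<close>

lemma tav_even_moment:
  assumes "finite F" "0 < s"
  shows "tav F (\<lambda>y. (\<Sum>e\<in>F. c e * y e) ^ (2 * r))
     \<le> 2 * fact (2 * r) / s ^ (2 * r) * exp (4 * s\<^sup>2 * (\<Sum>e\<in>F. (c e)\<^sup>2))"
proof -
  have "(\<Sum>e\<in>F. c e * y e) ^ (2 * r) \<le> fact (2 * r) / s ^ (2 * r) *
      (exp (\<Sum>e\<in>F. (s * c e) * y e) + exp (\<Sum>e\<in>F. (- s * c e) * y e))" for y
  proof -
    have eq: "(\<Sum>e\<in>F. (s * c e) * y e) = s * (\<Sum>e\<in>F. c e * y e)"
      "(\<Sum>e\<in>F. (- s * c e) * y e) = - (s * (\<Sum>e\<in>F. c e * y e))"
      by (simp_all add: sum_distrib_left mult.assoc sum_negf)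
    have "(s * (\<Sum>e\<in>F. c e * y e)) ^ (2 * r) \<le> fact (2 * r) *
        (exp (s * (\<Sum>e\<in>F. c e * y e)) + exp (- (s * (\<Sum>e\<in>F. c e * y e))))"
      by (rule power_le_fact_mult_exp)
    then show ?thesis using assms(2) unfolding eq
      by (simp add: power_mult_distrib field_simps)
  qed
  then have "tav F (\<lambda>y. (\<Sum>e\<in>F. c e * y e) ^ (2 * r)) \<le>
     tav F (\<lambda>y. fact (2 * r) / s ^ (2 * r) *
      (exp (\<Sum>e\<in>F. (s * c e) * y e) + exp (\<Sum>e\<in>F. (- s * c e) * y e)))"
    by (rule tav_mono)
  also have "\<dots> = fact (2 * r) / s ^ (2 * r) * (tav F (\<lambda>y. exp (\<Sum>e\<in>F. (s * c e) * y e))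
      + tav F (\<lambda>y. exp (\<Sum>e\<in>F. (- s * c e) * y e)))"
    by (simp only: tav_cmult tav_add)
  also have "\<dots> \<le> fact (2 * r) / s ^ (2 * r) * (exp (4 * (\<Sum>e\<in>F. (s * c e)\<^sup>2))
      + exp (4 * (\<Sum>e\<in>F. (- s * c e)\<^sup>2)))"
    using assms(2) by (intro mult_left_mono add_mono tav_exp_linear assms(1)) auto
  also have "\<dots> = 2 * fact (2 * r) / s ^ (2 * r) * exp (4 * s\<^sup>2 * (\<Sum>e\<in>F. (c e)\<^sup>2))"
    by (simp add: power_mult_distrib sum_distrib_left mult_ac)
  finally show ?thesis .
qed

section \<open>Norms and traces of symmetric matrices\<close>

definition ip :: "'i set \<Rightarrow> ('i \<Rightarrow> real) \<Rightarrow> ('i \<Rightarrow> real) \<Rightarrow> real" where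
  "ip I x y = (\<Sum>i\<in>I. x i * y i)"

definition mv :: "'i set \<Rightarrow> ('i \<Rightarrow> 'i \<Rightarrow> real) \<Rightarrow> ('i \<Rightarrow> real) \<Rightarrow> 'i \<Rightarrow> real" where
  "mv I A x = (\<lambda>i. \<Sum>j\<in>I. A i j * x j)"

text \<open>The trace of \<open>A^L\<close>, read off from the iterates of \<open>mv\<close> on the
  unit vectors.\<close>

definition trace_power :: "'i set \<Rightarrow> ('i \<Rightarrow> 'i \<Rightarrow> real) \<Rightarrow> nat \<Rightarrow> real" where
  "trace_power I A L = (\<Sum>i\<in>I. (mv I A ^^ L) (\<lambda>j. of_bool (j = i)) i)"

definition words :: "'i set \<Rightarrow> nat \<Rightarrow> 'i list set" where
  "words I L = {w. set w \<subseteq> I \<and> length w = L}"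

lemma finite_words: "finite I \<Longrightarrow> finite (words I L)"
  unfolding words_def by (rule finite_lists_length_eq)

lemma sum_words_Suc:
  assumes "finite I"
  shows "(\<Sum>w\<in>words I (Suc L). f w) = (\<Sum>i\<in>I. \<Sum>w\<in>words I L. f (i # w))"
proof -
  have "words I (Suc L) = (\<lambda>(i, w). i # w) ` (I \<times> words I L)"
    by (auto simp: words_def length_Suc_conv image_iff)
  moreover have "inj_on (\<lambda>(i, w). i # w) (I \<times> words I L)" by (auto simp: inj_on_def)
  ultimately show ?thesis
    by (simp add: sum.reindex sum.cartesian_product case_prod_unfold)
qed

lemma ip_self: "ip I x x = (L2_set x I)\<^sup>2"
  by (simp add: ip_def L2_set_def sum_nonneg power2_eq_square)

lemma ip_self_nonneg: "0 \<le> ip I x x"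
  by (simp add: ip_self)

lemma ip_Cauchy_Schwarz: "(ip I x y)\<^sup>2 \<le> ip I x x * ip I y y"
  using Cauchy_Schwarz_ineq_sum[of x y I] by (simp add: ip_def power2_eq_square)

lemma ip_indicator: "finite I \<Longrightarrow> i \<in> I \<Longrightarrow> ip I (\<lambda>j. of_bool (j = i)) x = x i"
  by (simp add: ip_def of_bool_def if_distrib[of "\<lambda>a. a * _"] cong: if_cong)

lemma ip_mv:
  assumes "\<And>i j. A i j = A j i"
  shows "ip I x (mv I A y) = ip I (mv I A x) y"
proof -
  have "ip I x (mv I A y) = (\<Sum>i\<in>I. \<Sum>j\<in>I. x i * A i j * y j)"
    by (simp add: ip_def mv_def sum_distrib_left mult.assoc)
  also have "\<dots> = (\<Sum>j\<in>I. \<Sum>i\<in>I. A j i * x i * y j)"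
    by (subst sum.swap) (simp add: assms mult.commute)
  finally show ?thesis by (simp add: ip_def mv_def sum_distrib_right)
qed

lemma ip_mv_power:
  assumes "\<And>i j. A i j = A j i"
  shows "ip I x ((mv I A ^^ n) y) = ip I ((mv I A ^^ n) x) y"
proof (induction n arbitrary: x)
  case (Suc n)
  have "ip I x ((mv I A ^^ Suc n) y) = ip I (mv I A x) ((mv I A ^^ n) y)"
    using ip_mv[of A I x] assms by simp
  then show ?case using Suc by (simp add: funpow_swap1)
qed simp

lemma trace_power_even:
  assumes "finite I" "\<And>i j. A i j = A j i"
  shows "trace_power I A (2 * m) =
    (\<Sum>i\<in>I. ip I ((mv I A ^^ m) (\<lambda>j. of_bool (j = i))) ((mv I A ^^ m) (\<lambda>j. of_bool (j = i))))"
  unfolding trace_power_def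
proof (rule sum.cong[OF refl])
  fix i assume i: "i \<in> I"
  let ?d = "\<lambda>j. of_bool (j = i) :: real"
  have "(mv I A ^^ (2 * m)) ?d i = ip I ?d ((mv I A ^^ (m + m)) ?d)"
    using ip_indicator[OF assms(1) i] by (simp add: mult_2)
  also have "\<dots> = ip I ?d ((mv I A ^^ m) ((mv I A ^^ m) ?d))" by (simp add: funpow_add)
  also have "\<dots> = ip I ((mv I A ^^ m) ?d) ((mv I A ^^ m) ?d)"
    using ip_mv_power[of A] assms(2) by blast
  finally show "(mv I A ^^ (2 * m)) ?d i = ip I ((mv I A ^^ m) ?d) ((mv I A ^^ m) ?d)" .
qed

lemma mv_power_walks:
  assumes "finite I"
  shows "(mv I A ^^ L) x i = (\<Sum>w\<in>words I L. prod_list (map2 A (i # w) w) * x (last (i # w)))"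
proof (induction L arbitrary: i)
  case 0
  have "words I 0 = {[]}" by (auto simp: words_def)
  then show ?case by simp
next
  case (Suc L)
  have "(mv I A ^^ Suc L) x i = (\<Sum>j\<in>I. A i j * (mv I A ^^ L) x j)" by (simp add: mv_def)
  also have "\<dots> = (\<Sum>j\<in>I. \<Sum>w\<in>words I L. prod_list (map2 A (i # j # w) (j # w)) * x (last (i # j # w)))"
    unfolding Suc by (simp add: sum_distrib_left mult.assoc)
  finally show ?case by (simp only: sum_words_Suc[OF assms])
qed

text \<open>A closed walk is encoded by the vertices it enters; it starts where it ends, so its
  steps lead from \<open>last w # w\<close> to \<open>w\<close>.\<close>

lemma trace_power_walks:
  assumes "finite I" "0 < L"
  shows "trace_power I A L = (\<Sum>w\<in>words I L. prod_list (map2 A (last w # w) w))"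
proof -
  have "trace_power I A L = (\<Sum>i\<in>I. \<Sum>w\<in>words I L. prod_list (map2 A (i # w) w) * of_bool (last w = i))"
    unfolding trace_power_def mv_power_walks[OF assms(1)]
    using assms(2) by (intro sum.cong refl) (auto simp: words_def)
  also have "\<dots> = (\<Sum>w\<in>words I L. \<Sum>i\<in>I. if i = last w then prod_list (map2 A (last w # w) w) else 0)"
    by (subst sum.swap) (intro sum.cong refl, auto)
  also have "\<dots> = (\<Sum>w\<in>words I L. prod_list (map2 A (last w # w) w))"
  proof (intro sum.cong refl)
    fix w assume "w \<in> words I L"
    then have "last w \<in> I" using assms(2) last_in_set[of w] by (auto simp: words_def)
    then show "(\<Sum>i\<in>I. if i = last w then prod_list (map2 A (last w # w) w) else 0)
        = prod_list (map2 A (last w # w) w)"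
      using assms(1) by simp
  qed
  finally show ?thesis .
qed

text \<open>The Hilbert-Schmidt bound for \<open>A^m\<close>: by symmetry each coordinate of
  \<open>A^m x\<close> is the inner product of \<open>x\<close> with \<open>A^m\<close> applied to a
  unit vector.\<close>

lemma norm_mv_power_le_trace:
  assumes "finite I" "\<And>i j. A i j = A j i"
  shows "ip I ((mv I A ^^ m) x) ((mv I A ^^ m) x) \<le> ip I x x * trace_power I A (2 * m)"
proof -
  let ?d = "\<lambda>i j. of_bool (j = i) :: real"
  have "ip I ((mv I A ^^ m) x) ((mv I A ^^ m) x) = (\<Sum>i\<in>I. ((mv I A ^^ m) x i)\<^sup>2)"
    by (simp add: ip_def power2_eq_square)
  also have "\<dots> = (\<Sum>i\<in>I. (ip I ((mv I A ^^ m) (?d i)) x)\<^sup>2)"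
  proof (intro sum.cong refl)
    fix i assume "i \<in> I"
    then have "(mv I A ^^ m) x i = ip I (?d i) ((mv I A ^^ m) x)" using ip_indicator[OF assms(1)] by simp
    then show "((mv I A ^^ m) x i)\<^sup>2 = (ip I ((mv I A ^^ m) (?d i)) x)\<^sup>2"
      using ip_mv_power[of A] assms(2) by metis
  qed
  also have "\<dots> \<le> (\<Sum>i\<in>I. ip I ((mv I A ^^ m) (?d i)) ((mv I A ^^ m) (?d i)) * ip I x x)"
    by (intro sum_mono ip_Cauchy_Schwarz)
  also have "\<dots> = ip I x x * trace_power I A (2 * m)"
    unfolding trace_power_even[OF assms] by (simp add: sum_distrib_left mult.commute)
  finally show ?thesis .
qed

text \<open>Log-convexity of \<open>l \<mapsto> \<parallel>A\<^sup>l x\<parallel>\<^sup>2\<close>, used along powers of two only.\<close>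

lemma norm_mv_power_two:
  assumes "\<And>i j. A i j = A j i"
  shows "ip I (mv I A x) (mv I A x) ^ (2 ^ j) * ip I x x \<le>
    ip I x x ^ (2 ^ j) * ip I ((mv I A ^^ (2 ^ j)) x) ((mv I A ^^ (2 ^ j)) x)"
proof (induction j)
  case (Suc j)
  define a where "a l = ip I ((mv I A ^^ l) x) ((mv I A ^^ l) x)" for l
  have a0: "0 \<le> a l" for l by (simp add: a_def ip_self_nonneg)
  \<comment> \<open>By symmetry \<open>a l\<close> is the inner product of \<open>x\<close> and
    \<open>A^(2l) x\<close>, so Cauchy-Schwarz applies.\<close>
  have log: "a l ^ 2 \<le> a 0 * a (2 * l)" for l
  proof -
    have "a l = ip I x ((mv I A ^^ l) ((mv I A ^^ l) x))"
      unfolding a_def using ip_mv_power[of A] assms by metis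
    also have "\<dots> = ip I x ((mv I A ^^ (2 * l)) x)" by (simp add: funpow_add mult_2)
    finally show ?thesis using ip_Cauchy_Schwarz[of I x "(mv I A ^^ (2 * l)) x"] by (simp add: a_def)
  qed
  have IH: "a 1 ^ (2 ^ j) * a 0 \<le> a 0 ^ (2 ^ j) * a (2 ^ j)" using Suc by (simp add: a_def)
  have "a 1 ^ (2 ^ Suc j) * a 0 \<le> a 0 ^ (2 ^ Suc j) * a (2 ^ Suc j)"
  proof (cases "a 0 = 0")
    case True
    then show ?thesis using a0 by simp
  next
    case False
    then have pos: "0 < a 0" using a0[of 0] by simp
    have "(a 1 ^ (2 ^ j) * a 0)\<^sup>2 \<le> (a 0 ^ (2 ^ j) * a (2 ^ j))\<^sup>2"
      by (rule power_mono[OF IH]) (simp add: a0)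
    also have "\<dots> = a 0 ^ (2 ^ Suc j) * (a (2 ^ j))\<^sup>2"
      by (simp add: power_mult_distrib power_even_eq)
    also have "\<dots> \<le> a 0 ^ (2 ^ Suc j) * (a 0 * a (2 * 2 ^ j))"
      by (intro mult_left_mono log) (simp add: a0)
    finally have "(a 1 ^ (2 ^ Suc j) * a 0) * a 0 \<le> (a 0 ^ (2 ^ Suc j) * a (2 ^ Suc j)) * a 0"
      by (simp add: power_mult_distrib power_even_eq power2_eq_square mult_ac)
    then show ?thesis using pos by simp
  qed
  then show ?case by (simp add: a_def)
qed (simp add: mult.commute)

text \<open>The bound of the operator norm by an even trace, obtained without eigenvalues by
  repeated doubling; hence exponents that are powers of two.\<close>

lemma norm_mv_le_of_trace:
  assumes "finite I" "\<And>i j. A i j = A j i" "trace_power I A (2 * 2 ^ j) \<le> b ^ (2 ^ j)" "0 \<le> b"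
  shows "ip I (mv I A x) (mv I A x) \<le> b * ip I x x"
proof -
  let ?m = "2 ^ j :: nat"
  let ?a = "ip I (mv I A x) (mv I A x)"
  let ?n = "ip I x x"
  have n0: "0 \<le> ?n" by (rule ip_self_nonneg)
  show ?thesis
  proof (cases "?n = 0")
    case True
    have "ip I ((mv I A ^^ 1) x) ((mv I A ^^ 1) x) \<le> ?n * trace_power I A (2 * 1)"
      by (rule norm_mv_power_le_trace[OF assms(1,2)])
    then show ?thesis using True by simp
  next
    case False
    have "?a ^ ?m * ?n \<le> ?n ^ ?m * (?n * trace_power I A (2 * ?m))"
      by (rule order_trans[OF norm_mv_power_two[OF assms(2)]])
         (intro mult_left_mono norm_mv_power_le_trace assms(1,2) zero_le_power n0)
    also have "\<dots> \<le> ?n ^ ?m * (?n * b ^ ?m)"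
      using assms(3) n0 by (intro mult_left_mono) auto
    finally have "?a ^ ?m * ?n \<le> (b * ?n) ^ ?m * ?n" by (simp add: power_mult_distrib mult_ac)
    then have "?a ^ ?m \<le> (b * ?n) ^ ?m" using False n0 by simp
    then show ?thesis using power_mono_iff[of ?a "b * ?n" ?m] ip_self_nonneg[of I "mv I A x"] n0 assms(4)
      by simp
  qed
qed

lemma trace_power_le_of_norm:
  fixes b :: real
  assumes "finite I" "\<And>i j. A i j = A j i" "0 \<le> b"
    and "\<And>x. ip I (mv I A x) (mv I A x) \<le> b * ip I x x"
  shows "trace_power I A (2 * m) \<le> card I * b ^ m"
proof -
  have it: "ip I ((mv I A ^^ m) x) ((mv I A ^^ m) x) \<le> b ^ m * ip I x x" for x m
  proof (induction m)
    case (Suc m)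
    have "ip I ((mv I A ^^ Suc m) x) ((mv I A ^^ Suc m) x) \<le> b * ip I ((mv I A ^^ m) x) ((mv I A ^^ m) x)"
      using assms(4) by simp
    also have "\<dots> \<le> b * (b ^ m * ip I x x)" using Suc assms(3) by (rule mult_left_mono)
    finally show ?case by (simp add: mult.assoc)
  qed simp
  have "trace_power I A (2 * m) \<le> (\<Sum>i\<in>I. b ^ m * ip I (\<lambda>j. of_bool (j = i)) (\<lambda>j. of_bool (j = i)))"
    unfolding trace_power_even[OF assms(1,2)] by (intro sum_mono it)
  also have "\<dots> = card I * b ^ m"
    using ip_indicator[OF assms(1)] by simp
  finally show ?thesis .
qed

section \<open>The norm of a random symmetric matrix\<close>

text \<open>\<open>25 n = (5/4 * 4 sqrt n)^2\<close>: a rounded unit vector has norm at most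
  \<open>5/4\<close>, and multiplication by \<open>4 sqrt n\<close> makes its entries
  integers.\<close>

definition grid :: "nat \<Rightarrow> (nat \<Rightarrow> int) set" where
  "grid n = {g \<in> PiE {..<n} (\<lambda>_. UNIV). (\<Sum>i<n. (g i)\<^sup>2) \<le> 25 * int n}"

lemma sum_half_powers_le: "(\<Sum>a\<in>{- int B..int B}. (1/2) ^ nat \<bar>a\<bar>) \<le> (4::real)"
proof -
  have "(\<Sum>k\<le>B. (1/2::real) ^ k) = 2 - (1/2) ^ B" by (induction B) auto
  then have geo: "(\<Sum>k\<le>B. (1/2::real) ^ k) \<le> 2" by simp
  have "{- int B..int B} = int ` {..B} \<union> (\<lambda>k. - int k) ` {..B}"
  proof
    show "{- int B..int B} \<subseteq> int ` {..B} \<union> (\<lambda>k. - int k) ` {..B}"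
    proof
      fix a assume "a \<in> {- int B..int B}"
      then have "a = int (nat a) \<and> nat a \<le> B \<or> a = - int (nat (- a)) \<and> nat (- a) \<le> B" by auto
      then show "a \<in> int ` {..B} \<union> (\<lambda>k. - int k) ` {..B}" by blast
    qed
  qed auto
  then have "(\<Sum>a\<in>{- int B..int B}. (1/2::real) ^ nat \<bar>a\<bar>) \<le>
      (\<Sum>a\<in>int ` {..B}. (1/2) ^ nat \<bar>a\<bar>) + (\<Sum>a\<in>(\<lambda>k. - int k) ` {..B}. (1/2) ^ nat \<bar>a\<bar>)"
    by (simp add: sum_Un sum_nonneg)
  also have "\<dots> = (\<Sum>k\<le>B. (1/2) ^ k) + (\<Sum>k\<le>B. (1/2) ^ k)"
    by (subst (1 2) sum.reindex) (auto simp: inj_on_def)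
  finally show ?thesis using geo by linarith
qed

lemma int_abs_le_square: "\<bar>a\<bar> \<le> a\<^sup>2" for a :: int
proof (cases "a = 0")
  case False
  then have "\<bar>a\<bar> * 1 \<le> \<bar>a\<bar> * \<bar>a\<bar>" by (intro mult_left_mono) auto
  then show ?thesis by (simp add: power2_eq_square)
qed simp

text \<open>Give \<open>g\<close> the weight \<open>2^(- sum of |g i|)\<close>. On the grid it is at
  least \<open>2^(- 25 n)\<close>, as integers satisfy \<open>|a| \<le> a^2\<close>, while the total
  weight over a box factorises and is at most \<open>4^n\<close>.\<close>

lemma card_grid: "finite (grid n)" "real (card (grid n)) \<le> (2 ^ 27) ^ n"
proof -
  define B where "B = 25 * n"
  define Q where "Q = PiE {..<n} (\<lambda>_. {- int B..int B})"
  have sub: "grid n \<subseteq> Q"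
  proof
    fix g assume g: "g \<in> grid n"
    have "\<bar>g i\<bar> \<le> int B" if "i < n" for i
    proof -
      have "\<bar>g i\<bar> \<le> (g i)\<^sup>2" by (rule int_abs_le_square)
      also have "\<dots> \<le> (\<Sum>i<n. (g i)\<^sup>2)" using that by (intro member_le_sum) auto
      finally show ?thesis using g by (simp add: grid_def B_def)
    qed
    then have "\<forall>i<n. g i \<in> {- int B..int B}" by (simp add: abs_le_iff minus_le_iff)
    then show "g \<in> Q" using g by (auto simp: grid_def Q_def PiE_iff)
  qed
  have finQ: "finite Q" unfolding Q_def by (intro finite_PiE) auto
  then show fin: "finite (grid n)" using sub finite_subset by blast
  have "1 \<le> 2 ^ B * (\<Prod>i<n. (1/2::real) ^ nat \<bar>g i\<bar>)" if "g \<in> grid n" for g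
  proof -
    have "(\<Sum>i<n. nat \<bar>g i\<bar>) \<le> B"
    proof -
      have "(\<Sum>i<n. \<bar>g i\<bar>) \<le> (\<Sum>i<n. (g i)\<^sup>2)" by (intro sum_mono int_abs_le_square)
      then have "int (\<Sum>i<n. nat \<bar>g i\<bar>) \<le> int B" using that by (simp add: grid_def B_def)
      then show ?thesis by (simp only: of_nat_le_iff)
    qed
    then have "(1/2::real) ^ B \<le> (1/2) ^ (\<Sum>i<n. nat \<bar>g i\<bar>)" by (intro power_decreasing) auto
    then have "2 ^ B * (1/2::real) ^ B \<le> 2 ^ B * (\<Prod>i<n. (1/2::real) ^ nat \<bar>g i\<bar>)"
      by (simp add: power_sum)
    then show ?thesis by (simp flip: power_mult_distrib)
  qed
  then have "(\<Sum>g\<in>grid n. 1) \<le> (\<Sum>g\<in>grid n. 2 ^ B * (\<Prod>i<n. (1/2::real) ^ nat \<bar>g i\<bar>))"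
    by (rule sum_mono)
  also have "\<dots> \<le> (\<Sum>g\<in>Q. 2 ^ B * (\<Prod>i<n. (1/2::real) ^ nat \<bar>g i\<bar>))"
    by (intro sum_mono2 finQ sub mult_nonneg_nonneg prod_nonneg) auto
  also have "\<dots> = 2 ^ B * (\<Prod>i<n. \<Sum>a\<in>{- int B..int B}. (1/2::real) ^ nat \<bar>a\<bar>)"
    unfolding Q_def by (subst prod_sum_PiE) (auto simp: sum_distrib_left)
  also have "\<dots> \<le> 2 ^ B * (\<Prod>i<n. 4)"
    by (intro mult_left_mono prod_mono) (auto intro: sum_half_powers_le sum_nonneg)
  also have "\<dots> = (2 ^ 27) ^ n"
    by (simp add: B_def power_mult flip: power_mult_distrib)
  finally show "real (card (grid n)) \<le> (2 ^ 27) ^ n" by simp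
qed

lemma ip_add_left: "ip I (\<lambda>i. x i + y i) z = ip I x z + ip I y z"
  by (simp add: ip_def distrib_right sum.distrib)

lemma ip_add_right: "ip I z (\<lambda>i. x i + y i) = ip I z x + ip I z y"
  by (simp add: ip_def distrib_left sum.distrib)

lemma ip_scale: "ip I (\<lambda>i. c * x i) y = c * ip I x y" "ip I x (\<lambda>i. c * y i) = c * ip I x y"
  by (simp_all add: ip_def sum_distrib_left mult_ac)

lemma mv_add: "mv I A (\<lambda>i. x i + y i) = (\<lambda>i. mv I A x i + mv I A y i)"
  by (simp add: mv_def distrib_left sum.distrib)

lemma mv_scale: "mv I A (\<lambda>i. c * x i) = (\<lambda>i. c * mv I A x i)"
  by (simp add: mv_def sum_distrib_left mult_ac)

text \<open>Rounding down to multiples of \<open>1 / (4 sqrt n)\<close> moves a unit vector by at most 1/4, so the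
  operator norm is determined up to a constant by the bilinear form on integer vectors.\<close>

lemma norm_mv_le_of_grid:
  fixes A :: "nat \<Rightarrow> nat \<Rightarrow> real"
  assumes n: "0 < n"
    and grid: "\<And>g h. g \<in> grid n \<Longrightarrow> h \<in> grid n \<Longrightarrow>
      \<bar>ip {..<n} (\<lambda>i. of_int (g i)) (mv {..<n} A (\<lambda>i. of_int (h i)))\<bar> \<le> \<mu>"
  shows "ip {..<n} (mv {..<n} A x) (mv {..<n} A x) \<le> (\<mu> / n)\<^sup>2 * ip {..<n} x x"
proof -
  define I where "I = {..<n}"
  define S where "S = {ip I x (mv I A y) |x y. L2_set x I \<le> 1 \<and> L2_set y I \<le> 1}"
  define L where "L = Sup S"
  have finI: "finite I" by (simp add: I_def)
  have bdd: "bdd_above S"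
  proof (rule bdd_aboveI)
    fix s assume "s \<in> S"
    then obtain x y where s: "s = ip I x (mv I A y)" "L2_set x I \<le> 1" "L2_set y I \<le> 1"
      unfolding S_def by blast
    have le1: "\<bar>z i\<bar> \<le> 1" if "L2_set z I \<le> 1" "i \<in> I" for z i
    proof -
      have "\<bar>z i\<bar> \<le> L2_set (\<lambda>i. \<bar>z i\<bar>) I" using finI that(2) by (rule member_le_L2_set)
      also have "\<dots> = L2_set z I" by (simp add: L2_set_def)
      finally show ?thesis using that(1) by linarith
    qed
    have "s = (\<Sum>i\<in>I. \<Sum>j\<in>I. x i * (A i j * y j))"
      unfolding s(1) by (simp add: ip_def mv_def sum_distrib_left)
    also have "\<dots> \<le> (\<Sum>i\<in>I. \<Sum>j\<in>I. \<bar>A i j\<bar>)"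
    proof (intro sum_mono)
      fix i j assume ij: "i \<in> I" "j \<in> I"
      have "\<bar>x i\<bar> * (\<bar>A i j\<bar> * \<bar>y j\<bar>) \<le> 1 * (\<bar>A i j\<bar> * 1)"
        using le1 s ij by (intro mult_mono) auto
      then show "x i * (A i j * y j) \<le> \<bar>A i j\<bar>" by (simp flip: abs_mult)
    qed
    finally show "s \<le> (\<Sum>i\<in>I. \<Sum>j\<in>I. \<bar>A i j\<bar>)" .
  qed
  have zero: "0 \<in> S" unfolding S_def by (rule CollectI, rule exI[of _ "\<lambda>_. 0"], rule exI[of _ "\<lambda>_. 0"])
      (simp add: ip_def L2_set_def)
  have L0: "0 \<le> L" unfolding L_def using zero bdd by (rule cSup_upper)
  have bil: "ip I u (mv I A v) \<le> a * b * L" if "L2_set u I \<le> a" "L2_set v I \<le> b" "0 < a" "0 < b" for u v a b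
  proof -
    have "L2_set (\<lambda>i. (1 / a) * u i) I \<le> 1" "L2_set (\<lambda>i. (1 / b) * v i) I \<le> 1"
    proof -
      have "L2_set (\<lambda>i. (1 / c) * w i) I \<le> 1" if "L2_set w I \<le> c" "0 < c" for c w
      proof -
        have "L2_set (\<lambda>i. (1 / c) * w i) I = (1 / c) * L2_set w I"
          using that(2) by (intro L2_set_right_distrib[symmetric]) simp
        then show ?thesis using that by simp
      qed
      then show "L2_set (\<lambda>i. (1 / a) * u i) I \<le> 1" "L2_set (\<lambda>i. (1 / b) * v i) I \<le> 1"
        using that by blast+
    qed
    then have "ip I (\<lambda>i. (1 / a) * u i) (mv I A (\<lambda>i. (1 / b) * v i)) \<in> S" unfolding S_def by blast
    then have "ip I (\<lambda>i. (1 / a) * u i) (mv I A (\<lambda>i. (1 / b) * v i)) \<le> L"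
      unfolding L_def using bdd by (rule cSup_upper)
    then show ?thesis using that(3,4) by (simp only: mv_scale ip_scale) (simp add: field_simps)
  qed
  define q where "q = 4 * sqrt (real n)"
  have q0: "0 < q" and q2: "q\<^sup>2 = 16 * real n" using n by (simp_all add: q_def power_mult_distrib)
  define rd where "rd x = (\<lambda>i. of_int \<lfloor>q * x i\<rfloor> / q)" for x :: "nat \<Rightarrow> real"
  have rd_err: "L2_set (\<lambda>i. x i - rd x i) I \<le> 1/4" for x
  proof -
    have "L2_set (\<lambda>i. x i - rd x i) I \<le> L2_set (\<lambda>i. 1 / q) I"
    proof (rule L2_set_mono)
      fix i assume "i \<in> I"
      have "x i - rd x i = (q * x i - of_int \<lfloor>q * x i\<rfloor>) / q" using q0 by (simp add: rd_def field_simps)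
      moreover have "0 \<le> q * x i - of_int \<lfloor>q * x i\<rfloor>" "q * x i - of_int \<lfloor>q * x i\<rfloor> \<le> 1" by linarith+
      ultimately show "x i - rd x i \<le> 1 / q" "0 \<le> x i - rd x i" using q0 by (auto simp: divide_right_mono)
    qed
    also have "\<dots> = 1 / 4" using n by (simp add: L2_set_constant I_def q_def)
    finally show ?thesis .
  qed
  have rd_norm: "L2_set (rd x) I \<le> 5/4" if "L2_set x I \<le> 1" for x
  proof -
    have "L2_set (rd x) I = L2_set (\<lambda>i. x i + - (x i - rd x i)) I" by simp
    also have "\<dots> \<le> L2_set x I + L2_set (\<lambda>i. - (x i - rd x i)) I" by (rule L2_set_triangle_ineq)
    also have "L2_set (\<lambda>i. - (x i - rd x i)) I = L2_set (\<lambda>i. x i - rd x i) I"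
      by (simp add: L2_set_def power2_commute)
    finally show ?thesis using that rd_err[of x] by linarith
  qed
  have rd_grid: "restrict (\<lambda>i. \<lfloor>q * x i\<rfloor>) I \<in> grid n" if "L2_set x I \<le> 1" for x
  proof -
    have "(\<Sum>i\<in>I. (rd x i)\<^sup>2) \<le> (5/4)\<^sup>2"
      using power_mono[OF rd_norm[OF that] L2_set_nonneg, of 2] by (simp add: L2_set_def sum_nonneg)
    then have "q\<^sup>2 * (\<Sum>i\<in>I. (rd x i)\<^sup>2) \<le> q\<^sup>2 * (5/4)\<^sup>2" by (rule mult_left_mono) simp
    also have "q\<^sup>2 * (\<Sum>i\<in>I. (rd x i)\<^sup>2) = (\<Sum>i\<in>I. (of_int \<lfloor>q * x i\<rfloor>)\<^sup>2)"
      using q0 by (simp add: rd_def sum_distrib_left power_divide)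
    also have "q\<^sup>2 * (5/4)\<^sup>2 = 25 * real n" unfolding q2 by (simp add: power2_eq_square)
    finally have "real_of_int (\<Sum>i\<in>I. \<lfloor>q * x i\<rfloor>\<^sup>2) \<le> real_of_int (25 * int n)" by simp
    then have "(\<Sum>i\<in>I. \<lfloor>q * x i\<rfloor>\<^sup>2) \<le> 25 * int n" by (rule of_int_le_iff[THEN iffD1])
    moreover have "(\<Sum>i<n. (restrict (\<lambda>i. \<lfloor>q * x i\<rfloor>) I i)\<^sup>2) = (\<Sum>i\<in>I. \<lfloor>q * x i\<rfloor>\<^sup>2)"
      by (intro sum.cong) (auto simp: I_def)
    ultimately show ?thesis by (simp add: grid_def I_def)
  qed
  have rd_ip: "ip I (rd x) (mv I A (rd y)) \<le> \<mu> / (16 * real n)" if "L2_set x I \<le> 1" "L2_set y I \<le> 1" for x y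
  proof -
    define g where "g x = restrict (\<lambda>i. \<lfloor>q * x i\<rfloor>) I" for x :: "nat \<Rightarrow> real"
    have "ip I (rd x) (mv I A (rd y)) = ip I (\<lambda>i. (1/q) * of_int (g x i)) (mv I A (\<lambda>i. (1/q) * of_int (g y i)))"
      by (simp add: ip_def mv_def rd_def g_def cong: sum.cong)
    also have "\<dots> = (1/q) * ((1/q) * ip I (\<lambda>i. of_int (g x i)) (mv I A (\<lambda>i. of_int (g y i))))"
      by (simp only: mv_scale ip_scale)
    also have "\<dots> = ip I (\<lambda>i. of_int (g x i)) (mv I A (\<lambda>i. of_int (g y i))) / q\<^sup>2"
      by (simp add: power2_eq_square)
    also have "\<dots> \<le> \<mu> / q\<^sup>2"
      using grid[of "g x" "g y"] rd_grid that unfolding g_def I_def by (intro divide_right_mono) auto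
    finally show ?thesis by (simp add: q2)
  qed
  \<comment> \<open>Rounding costs \<open>5/4 * 1/4 + 1/4 * 1 = 9/16\<close> of the supremum
    \<open>L\<close> itself; being below 1, this is absorbed on the left.\<close>
  have "s \<le> \<mu> / (16 * real n) + 9/16 * L" if "s \<in> S" for s
  proof -
    obtain x y where s: "s = ip I x (mv I A y)" "L2_set x I \<le> 1" "L2_set y I \<le> 1"
      using \<open>s \<in> S\<close> unfolding S_def by blast
    let ?ex = "\<lambda>i. x i - rd x i" and ?ey = "\<lambda>i. y i - rd y i"
    have "s = ip I (\<lambda>i. rd x i + ?ex i) (mv I A y)" by (simp add: s)
    also have "\<dots> = ip I (rd x) (mv I A y) + ip I ?ex (mv I A y)" by (rule ip_add_left)
    also have "mv I A y = mv I A (\<lambda>i. rd y i + ?ey i)" by simp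
    then have "ip I (rd x) (mv I A y) = ip I (rd x) (mv I A (rd y)) + ip I (rd x) (mv I A ?ey)"
      by (simp only: mv_add ip_add_right)
    also have "\<dots> \<le> \<mu> / (16 * real n) + 5/4 * (1/4) * L"
      using rd_ip[OF s(2,3)] bil[OF rd_norm[OF s(2)] rd_err[of y]] by simp
    also have "ip I ?ex (mv I A y) \<le> 1/4 * 1 * L" using bil[OF rd_err[of x] s(3)] by simp
    finally show ?thesis by simp
  qed
  then have "L \<le> \<mu> / (16 * real n) + 9/16 * L" unfolding L_def using zero by (intro cSup_least) auto
  then have "7 * L \<le> \<mu> / n" by simp
  then have Lmu: "L \<le> \<mu> / n" using L0 by linarith
  have "ip I (mv I A x) (mv I A x) \<le> (\<mu> / n)\<^sup>2 * ip I x x"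
  proof -
    define a b where "a = L2_set (mv I A x) I" and "b = L2_set x I"
    have ab0: "0 \<le> a" "0 \<le> b" by (simp_all add: a_def b_def)
    have "a \<le> b * L"
    proof (cases "a = 0 \<or> b = 0")
      case True
      moreover have "a = 0" if "b = 0"
      proof -
        have "\<forall>i\<in>I. x i = 0" using that finI by (simp add: b_def L2_set_eq_0_iff)
        then show ?thesis by (simp add: a_def mv_def L2_set_def)
      qed
      ultimately show ?thesis using ab0 L0 by auto
    next
      case False
      then have pos: "0 < a" "0 < b" using ab0 by auto
      have "a\<^sup>2 \<le> a * b * L"
        using bil[of "mv I A x" a x b] pos by (simp add: ip_self a_def b_def)
      then show ?thesis using pos by (simp add: power2_eq_square mult.assoc)
    qed
    also have "\<dots> \<le> b * (\<mu> / n)" using Lmu ab0(2) by (rule mult_left_mono)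
    finally have "a\<^sup>2 \<le> (b * (\<mu> / n))\<^sup>2" using ab0(1) by (rule power_mono)
    then show ?thesis unfolding ip_self a_def b_def by (simp only: power_mult_distrib mult.commute)
  qed
  then show ?thesis by (simp add: I_def)
qed

section \<open>Moments of the comparison matrix\<close>

definition sym_entries :: "(nat set \<Rightarrow> real) \<Rightarrow> nat \<Rightarrow> nat \<Rightarrow> real" where
  "sym_entries f i j = (if i = j then 0 else f {i, j})"

lemma sym_entries_commute: "sym_entries f i j = sym_entries f j i"
  by (simp add: sym_entries_def insert_commute)

definition pairs :: "nat \<Rightarrow> nat set set" where
  "pairs n = {e. e \<subseteq> {..<n} \<and> card e = 2}"

lemma finite_pairs: "finite (pairs n)"
  by (rule finite_subset[of _ "Pow {..<n}"]) (auto simp: pairs_def)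

text \<open>\<open>2^27\<close> for each of the two grid vectors, times \<open>8 * exp 5000\<close>
  from the moment of one bilinear form.\<close>

definition norm_const :: real where
  "norm_const = 2 ^ 57 * exp 5000"

lemma fact_double_le: "fact (2 * n) \<le> (4 * real n ^ 2) ^ n"
proof -
  have "fact (2 * n) \<le> real (2 * n) ^ (2 * n)"
    using fact_le_power[of "2 * n"] by (simp only: of_nat_power)
  also have "\<dots> = (4 * real n ^ 2) ^ n" by (simp add: power_mult power_mult_distrib)
  finally show ?thesis .
qed

text \<open>An edge collects two ordered pairs, for which Cauchy-Schwarz costs the factor 2.\<close>

lemma bilinear_as_pairs_sum:
  obtains c where
    "\<And>y. ip {..<n} g (mv {..<n} (sym_entries y) h) = (\<Sum>e\<in>pairs n. c e * y e)"
    "(\<Sum>e\<in>pairs n. (c e)\<^sup>2) \<le> 2 * ((\<Sum>i<n. (g i)\<^sup>2) * (\<Sum>i<n. (h i)\<^sup>2))"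
proof -
  define P where "P = {p \<in> {..<n} \<times> {..<n}. fst p \<noteq> snd p}"
  define Pe where "Pe e = {p \<in> P. {fst p, snd p} = e}" for e
  define c where "c e = (\<Sum>p\<in>Pe e. g (fst p) * h (snd p))" for e
  have finP: "finite P" by (simp add: P_def)
  have img: "(\<lambda>p. {fst p, snd p}) ` P \<subseteq> pairs n" by (auto simp: P_def pairs_def)
  note group = sum.group[OF finP finite_pairs[of n] img, folded Pe_def]
  have "ip {..<n} g (mv {..<n} (sym_entries y) h) = (\<Sum>e\<in>pairs n. c e * y e)" for y
  proof -
    have "ip {..<n} g (mv {..<n} (sym_entries y) h) =
        (\<Sum>p\<in>{..<n} \<times> {..<n}. g (fst p) * (sym_entries y (fst p) (snd p) * h (snd p)))"
      by (simp add: ip_def mv_def sum_distrib_left sum.cartesian_product case_prod_unfold)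
    also have "\<dots> = (\<Sum>p\<in>P. g (fst p) * h (snd p) * y {fst p, snd p})"
      by (rule sum.mono_neutral_cong_right) (auto simp: P_def sym_entries_def)
    also have "\<dots> = (\<Sum>e\<in>pairs n. \<Sum>p\<in>Pe e. g (fst p) * h (snd p) * y {fst p, snd p})"
      by (rule group[symmetric])
    also have "\<dots> = (\<Sum>e\<in>pairs n. c e * y e)"
      unfolding c_def sum_distrib_right by (intro sum.cong refl) (auto simp: Pe_def)
    finally show ?thesis .
  qed
  moreover have "(\<Sum>e\<in>pairs n. (c e)\<^sup>2) \<le> 2 * ((\<Sum>i<n. (g i)\<^sup>2) * (\<Sum>i<n. (h i)\<^sup>2))"
  proof -
    have "(c e)\<^sup>2 \<le> 2 * (\<Sum>p\<in>Pe e. (g (fst p) * h (snd p))\<^sup>2)" if "e \<in> pairs n" for e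
    proof -
      obtain a b where ab: "e = {a, b}" using \<open>e \<in> pairs n\<close> by (auto simp: pairs_def card_2_iff)
      have "Pe e \<subseteq> set [(a, b), (b, a)]"
        unfolding Pe_def ab by (auto simp: doubleton_eq_iff prod_eq_iff)
      then have "card (Pe e) \<le> card (set [(a, b), (b, a)])" by (intro card_mono) simp_all
      also have "\<dots> \<le> 2" using card_length[of "[(a, b), (b, a)]"] by simp
      finally have card2: "real (card (Pe e)) \<le> 2" by simp
      have "(c e)\<^sup>2 \<le> (\<Sum>p\<in>Pe e. (g (fst p) * h (snd p))\<^sup>2) * card (Pe e)"
        using Cauchy_Schwarz_ineq_sum[of "\<lambda>p. g (fst p) * h (snd p)" "\<lambda>_. 1" "Pe e"] by (simp add: c_def)
      also have "\<dots> \<le> (\<Sum>p\<in>Pe e. (g (fst p) * h (snd p))\<^sup>2) * 2"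
        using card2 by (intro mult_left_mono sum_nonneg) auto
      finally show ?thesis by simp
    qed
    then have "(\<Sum>e\<in>pairs n. (c e)\<^sup>2) \<le> (\<Sum>e\<in>pairs n. 2 * (\<Sum>p\<in>Pe e. (g (fst p) * h (snd p))\<^sup>2))"
      by (rule sum_mono)
    also have "\<dots> = 2 * (\<Sum>p\<in>P. (g (fst p) * h (snd p))\<^sup>2)"
      by (simp add: group flip: sum_distrib_left)
    also have "\<dots> \<le> 2 * (\<Sum>p\<in>{..<n} \<times> {..<n}. (g (fst p) * h (snd p))\<^sup>2)"
      by (intro mult_left_mono sum_mono2) (auto simp: P_def)
    also have "\<dots> = 2 * ((\<Sum>i<n. (g i)\<^sup>2) * (\<Sum>i<n. (h i)\<^sup>2))"
      by (simp add: sum_product sum.cartesian_product case_prod_unfold power_mult_distrib)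
    finally show ?thesis .
  qed
  ultimately show ?thesis using that by blast
qed

lemma tav_bilinear_moment:
  assumes n: "0 < n" and g: "g \<in> grid n" and h: "h \<in> grid n"
  shows "tav (pairs n) (\<lambda>y. ip {..<n} (\<lambda>i. of_int (g i)) (mv {..<n} (sym_entries y) (\<lambda>i. of_int (h i))) ^ (2 * n))
    \<le> (8 * exp 5000 * real n ^ 3) ^ n"
proof -
  obtain c where c: "\<And>y. ip {..<n} (\<lambda>i. real_of_int (g i)) (mv {..<n} (sym_entries y) (\<lambda>i. of_int (h i)))
      = (\<Sum>e\<in>pairs n. c e * y e)"
    "(\<Sum>e\<in>pairs n. (c e)\<^sup>2) \<le> 2 * ((\<Sum>i<n. (real_of_int (g i))\<^sup>2) * (\<Sum>i<n. (real_of_int (h i))\<^sup>2))"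
    using bilinear_as_pairs_sum[of n "\<lambda>i. of_int (g i)" "\<lambda>i. of_int (h i)"] by blast
  have le: "(\<Sum>i<n. (real_of_int (f i))\<^sup>2) \<le> 25 * real n" if "f \<in> grid n" for f
  proof -
    have "real_of_int (\<Sum>i<n. (f i)\<^sup>2) \<le> real_of_int (25 * int n)"
      using that unfolding grid_def by (simp only: of_int_le_iff mem_Collect_eq)
    then show ?thesis by simp
  qed
  have c2: "(\<Sum>e\<in>pairs n. (c e)\<^sup>2) \<le> 1250 * real n ^ 2"
  proof -
    have "(\<Sum>i<n. (real_of_int (g i))\<^sup>2) * (\<Sum>i<n. (real_of_int (h i))\<^sup>2) \<le> (25 * real n) * (25 * real n)"
      by (intro mult_mono le g h sum_nonneg) auto
    then show ?thesis using c(2) by (simp add: power2_eq_square)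
  qed
  \<comment> \<open>As the squared coefficients sum to at most \<open>1250 n^2\<close>, this makes
    the exponent \<open>5000 n\<close>.\<close>
  define s where "s = 1 / sqrt (real n)"
  have s: "0 < s" "s\<^sup>2 = 1 / real n" using n by (simp_all add: s_def power_divide)
  have "tav (pairs n) (\<lambda>y. (\<Sum>e\<in>pairs n. c e * y e) ^ (2 * n))
     \<le> 2 * fact (2 * n) / s ^ (2 * n) * exp (4 * s\<^sup>2 * (\<Sum>e\<in>pairs n. (c e)\<^sup>2))"
    by (rule tav_even_moment[OF finite_pairs s(1)])
  also have "\<dots> \<le> 2 * fact (2 * n) / s ^ (2 * n) * exp (4 * s\<^sup>2 * (1250 * real n ^ 2))"
    using s(1) c2 by (intro mult_left_mono) auto
  also have "4 * s\<^sup>2 * (1250 * real n ^ 2) = real n * 5000"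
    unfolding s(2) using n by (simp add: power2_eq_square)
  also have "exp (real n * 5000) = exp 5000 ^ n" by (rule exp_of_nat_mult)
  also have "2 * fact (2 * n) / s ^ (2 * n) = 2 * (fact (2 * n) * real n ^ n)"
    by (simp add: power_mult s(2) power_divide)
  also have "2 * (fact (2 * n) * real n ^ n) * exp 5000 ^ n \<le> 2 ^ n * ((4 * real n ^ 2) ^ n * real n ^ n) * exp 5000 ^ n"
    using n fact_double_le[of n] self_le_power[of "2::real" n]
    by (intro mult_right_mono mult_mono) auto
  also have "\<dots> = (8 * exp 5000 * real n ^ 3) ^ n"
    by (simp add: power_mult_distrib[symmetric] power2_eq_square power3_eq_cube mult_ac)
  finally show ?thesis by (simp only: c(1))
qed

text \<open>\<open>S\<close> dominates the maximum over all pairs of grid vectors. With powers as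
  high as \<open>2 n\<close>, the exponentially many pairs cost only a constant factor once the root
  is taken.\<close>

lemma tav_trace_power_le:
  assumes n: "0 < n" and m: "m \<le> n"
  shows "tav (pairs n) (\<lambda>y. trace_power {..<n} (sym_entries y) (2 * m))
    \<le> 2 * real n * (norm_const * real n) ^ m"
proof -
  define S where "S y = (\<Sum>g\<in>grid n. \<Sum>h\<in>grid n.
    ip {..<n} (\<lambda>i. of_int (g i)) (mv {..<n} (sym_entries y) (\<lambda>i. of_int (h i))) ^ (2 * n))" for y
  define c where "c = norm_const * real n"
  have c0: "0 < c" using n by (simp add: c_def norm_const_def)
  have S0: "0 \<le> S y" for y unfolding S_def by (intro sum_nonneg) simp
  have tavS: "tav (pairs n) S \<le> c ^ n * real n ^ (2 * n)"
  proof -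
    have "tav (pairs n) S \<le> (\<Sum>g\<in>grid n. \<Sum>h\<in>grid n. (8 * exp 5000 * real n ^ 3) ^ n)"
      unfolding S_def tav_sum by (intro sum_mono tav_bilinear_moment n)
    also have "\<dots> = real (card (grid n)) * (real (card (grid n)) * (8 * exp 5000 * real n ^ 3) ^ n)" by simp
    also have "\<dots> \<le> (2 ^ 27) ^ n * ((2 ^ 27) ^ n * (8 * exp 5000 * real n ^ 3) ^ n)"
      by (intro mult_mono card_grid(2)) auto
    also have "\<dots> = (norm_const * real n) ^ n * (real n ^ 2) ^ n"
      unfolding norm_const_def power_mult_distrib[symmetric]
      by (rule arg_cong[of _ _ "\<lambda>a. a ^ n"]) (simp add: power2_eq_square power3_eq_cube)
    finally show ?thesis by (simp add: c_def power_mult)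
  qed
  have "trace_power {..<n} (sym_entries y) (2 * m) \<le>
      real n * c ^ m + (real n * c ^ m / (c ^ n * real n ^ (2 * n))) * S y" for y
  proof -
    define \<mu> where "\<mu> = root (2 * n) (S y)"
    have mu: "0 \<le> \<mu>" "\<mu> ^ (2 * n) = S y" using n S0[of y] by (simp_all add: \<mu>_def real_root_pow_pos2)
    define b where "b = (\<mu> / n)\<^sup>2"
    have b0: "0 \<le> b" by (simp add: b_def)
    have "\<bar>ip {..<n} (\<lambda>i. of_int (g i)) (mv {..<n} (sym_entries y) (\<lambda>i. of_int (h i)))\<bar> \<le> \<mu>"
      if "g \<in> grid n" "h \<in> grid n" for g h
    proof -
      let ?a = "ip {..<n} (\<lambda>i. of_int (g i)) (mv {..<n} (sym_entries y) (\<lambda>i. of_int (h i)))"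
      have "?a ^ (2 * n) \<le> (\<Sum>h\<in>grid n. ip {..<n} (\<lambda>i. of_int (g i)) (mv {..<n} (sym_entries y) (\<lambda>i. of_int (h i))) ^ (2 * n))"
        using that card_grid(1) by (intro member_le_sum) auto
      also have "\<dots> \<le> S y" unfolding S_def
        using that card_grid(1) by (intro member_le_sum) (auto intro: sum_nonneg)
      finally have "\<bar>?a\<bar> ^ (2 * n) \<le> \<mu> ^ (2 * n)" by (simp add: mu power_even_abs)
      then show ?thesis using mu(1) n by (subst (asm) power_mono_iff) auto
    qed
    then have "ip {..<n} (mv {..<n} (sym_entries y) x) (mv {..<n} (sym_entries y) x) \<le> b * ip {..<n} x x" for x
      unfolding b_def by (rule norm_mv_le_of_grid[OF n])
    then have tr: "trace_power {..<n} (sym_entries y) (2 * m) \<le> real n * b ^ m"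
      using trace_power_le_of_norm[of "{..<n}" "sym_entries y" b m] b0 sym_entries_commute by simp
    \<comment> \<open>The \<open>m\<close>-th power is traded for the \<open>n\<close>-th, whose
      average is controlled: \<open>(b / c)^n\<close> has mean at most 1.\<close>
    have "b ^ m \<le> c ^ m * (1 + (b / c) ^ n)"
    proof (cases "b \<le> c")
      case True
      have "b ^ m \<le> c ^ m * 1" using power_mono[OF True b0] by simp
      also have "\<dots> \<le> c ^ m * (1 + (b / c) ^ n)" using c0 b0 by (intro mult_left_mono) auto
      finally show ?thesis .
    next
      case False
      then have "1 \<le> b / c" using c0 by simp
      then have "(b / c) ^ m \<le> (b / c) ^ n" using m by (intro power_increasing)
      then have "b ^ m \<le> c ^ m * (b / c) ^ n" using c0 by (simp add: power_divide field_simps)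
      also have "\<dots> \<le> c ^ m * (1 + (b / c) ^ n)" using c0 by (intro mult_left_mono) auto
      finally show ?thesis .
    qed
    moreover have "b ^ n = S y / real n ^ (2 * n)"
      using mu(2) by (simp add: b_def power_divide flip: power_mult)
    ultimately have "real n * b ^ m \<le> real n * (c ^ m * (1 + S y / real n ^ (2 * n) / c ^ n))"
      by (intro mult_left_mono) (simp_all add: power_divide)
    also have "\<dots> = real n * c ^ m + (real n * c ^ m / (c ^ n * real n ^ (2 * n))) * S y"
      by (simp add: distrib_left mult_ac)
    finally show ?thesis using tr by linarith
  qed
  then have "tav (pairs n) (\<lambda>y. trace_power {..<n} (sym_entries y) (2 * m)) \<le>
     tav (pairs n) (\<lambda>y. real n * c ^ m + (real n * c ^ m / (c ^ n * real n ^ (2 * n))) * S y)"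
    by (rule tav_mono)
  also have "\<dots> = real n * c ^ m + (real n * c ^ m / (c ^ n * real n ^ (2 * n))) * tav (pairs n) S"
    by (simp only: tav_add tav_cmult tav_const[OF finite_pairs])
  also have "\<dots> \<le> real n * c ^ m + (real n * c ^ m / (c ^ n * real n ^ (2 * n))) * (c ^ n * real n ^ (2 * n))"
    using c0 by (intro add_left_mono mult_left_mono tavS) auto
  also have "\<dots> = 2 * real n * c ^ m" using c0 n by simp
  finally show ?thesis by (simp add: c_def)
qed

section \<open>Comparison of words\<close>

lemma card_words_image_eq:
  fixes Q :: "nat list \<Rightarrow> bool"
  assumes inv: "\<And>f w. inj_on f (set w) \<Longrightarrow> Q w \<Longrightarrow> Q (map f w)"
    and T: "finite T" "card T = v"
  shows "card {w. length w = L \<and> Q w \<and> set w = T} = card {w. length w = L \<and> Q w \<and> set w = {..<v}}"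
proof -
  have le: "card {w. length w = L \<and> Q w \<and> set w = S} \<le> card {w. length w = L \<and> Q w \<and> set w = T}"
    if ST: "finite S" "finite T" "card S = card T" for S T :: "nat set"
  proof -
    obtain f where f: "bij_betw f S T" using finite_same_card_bij[OF ST] by blast
    show ?thesis
    proof (rule card_inj_on_le[of "map f"])
      show "inj_on (map f) {w. length w = L \<and> Q w \<and> set w = S}"
      proof (rule inj_onI)
        fix w w' assume "w \<in> {w. length w = L \<and> Q w \<and> set w = S}"
          "w' \<in> {w. length w = L \<and> Q w \<and> set w = S}" "map f w = map f w'"
        then show "w = w'" using f by (intro map_inj_on[of f w w']) (auto simp: bij_betw_def)
      qed
      show "map f ` {w. length w = L \<and> Q w \<and> set w = S} \<subseteq> {w. length w = L \<and> Q w \<and> set w = T}"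
        using f inv by (auto simp: bij_betw_def)
      show "finite {w. length w = L \<and> Q w \<and> set w = T}"
        by (rule finite_subset[OF _ finite_lists_length_eq[OF ST(2), of L]]) auto
    qed
  qed
  show ?thesis using le[of T "{..<v}"] le[of "{..<v}" T] T by (simp add: le_antisym)
qed

text \<open>After the letter set is chosen, the number of words using exactly these letters depends
  only on its size, since \<open>Q\<close> is transported along bijections.\<close>

lemma card_words_choose:
  fixes Q :: "nat list \<Rightarrow> bool"
  assumes inv: "\<And>f w. inj_on f (set w) \<Longrightarrow> Q w \<Longrightarrow> Q (map f w)" and A: "finite A"
  shows "card {w \<in> words A L. Q w \<and> card (set w) = v} =
    (card A choose v) * card {w. length w = L \<and> Q w \<and> set w = {..<v}}"
proof -
  let ?T = "{T. T \<subseteq> A \<and> card T = v}"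
  let ?W = "\<lambda>T. {w. length w = L \<and> Q w \<and> set w = T}"
  have finT: "finite T" if "T \<in> ?T" for T using that A finite_subset by blast
  have "{w \<in> words A L. Q w \<and> card (set w) = v} = (\<Union>T\<in>?T. ?W T)" by (auto simp: words_def)
  also have "card \<dots> = (\<Sum>T\<in>?T. card (?W T))"
  proof (rule card_UN_disjoint)
    show "finite ?T" using A by simp
    show "\<forall>T\<in>?T. finite (?W T)"
    proof
      fix T assume "T \<in> ?T"
      then show "finite (?W T)"
        by (intro finite_subset[OF _ finite_lists_length_eq[OF finT, of T L]]) auto
    qed
  qed auto
  also have "\<dots> = (\<Sum>T\<in>?T. card (?W {..<v}))"
  proof (rule sum.cong[OF refl])
    fix T assume T: "T \<in> ?T"
    then have "card T = v" by blast
    then show "card (?W T) = card (?W {..<v})"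
      using card_words_image_eq[of Q T v L] inv finT[OF T] by blast
  qed
  finally show ?thesis using n_subsets[OF A] by simp
qed

text \<open>From \<open>v\<close> to \<open>v + 1\<close> the left side gains the factor
  \<open>(N - v) p / (v + 1)\<close> and the right side \<open>(n - v) / (v + 1)\<close>, and
  \<open>N p \<le> n - v\<close> for \<open>v \<le> m\<close>. At \<open>v = 1\<close> both sides
  are \<open>n N\<close>.\<close>

lemma choose_compare:
  fixes p :: real and m n N v :: nat
  assumes "0 \<le> p" "real N * p + m + 1 \<le> real n" "1 \<le> v" "v \<le> m + 1"
  shows "real n * (real (N choose v) * p ^ (v - 1)) \<le> real N * real (n choose v)"
  using assms(3,4)
proof (induction v rule: dec_induct)
  case (step v)
  have rec: "(real M - real v) * real (M choose v) = real (Suc v) * real (M choose Suc v)" for M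
    using gbinomial_mult_1[of "real M" v] by (simp add: binomial_gbinomial algebra_simps)
  obtain u where u: "v = Suc u" using step(1) by (cases v) auto
  have IH: "real n * (real (N choose v) * p ^ u) \<le> real N * real (n choose v)"
    using step by (simp add: u)
  have "real (Suc v) * (real n * (real (N choose Suc v) * p ^ v))
      = real n * p ^ u * p * ((real N - real v) * real (N choose v))"
    unfolding rec by (simp add: u)
  also have "\<dots> \<le> real n * p ^ u * p * (real N * real (N choose v))"
    using assms(1) by (intro mult_left_mono mult_right_mono) auto
  also have "\<dots> = (real n * (real (N choose v) * p ^ u)) * (real N * p)" by simp
  also have "\<dots> \<le> (real N * real (n choose v)) * (real n - real v)"
    using assms(1,2) step.prems by (intro mult_mono[OF IH]) auto
  also have "\<dots> = real N * ((real n - real v) * real (n choose v))" by (simp only: mult_ac)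
  also have "\<dots> = real (Suc v) * (real N * real (n choose Suc v))"
    unfolding rec by (simp only: mult_ac)
  finally have "real n * (real (N choose Suc v) * p ^ v) \<le> real N * real (n choose Suc v)"
    by (subst (asm) mult_le_cancel_left_pos) auto
  then show ?case by simp
qed simp

text \<open>Words over an alphabet of size \<open>N\<close> weighted by \<open>p\<close> per letter are compared, pattern by
  pattern, with unweighted words over an alphabet of size slightly more than \<open>N p\<close>.\<close>

lemma words_compare:
  fixes Q :: "nat list \<Rightarrow> bool" and p :: real
  assumes inv: "\<And>f w. inj_on f (set w) \<Longrightarrow> Q w \<Longrightarrow> Q (map f w)"
    and few: "\<And>w. length w = L \<Longrightarrow> Q w \<Longrightarrow> card (set w) \<le> m + 1"
    and fin: "finite A" "finite B" and L: "0 < L"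
    and p: "0 \<le> p" "real (card A) * p + m + 1 \<le> real (card B)"
  shows "real (card B) * (\<Sum>w | w \<in> words A L \<and> Q w. p ^ (card (set w) - 1))
    \<le> real (card A) * real (card {w \<in> words B L. Q w})"
proof -
  define s where "s v = card {w. length w = L \<and> Q w \<and> set w = {..<v}}" for v
  have cw: "card {w \<in> words S L. Q w \<and> card (set w) = v} = (card S choose v) * s v" if "finite S" for S v
    unfolding s_def using inv that by (rule card_words_choose)
  have grp: "(\<Sum>v\<in>{1..m+1}. \<Sum>w | (w \<in> words S L \<and> Q w) \<and> card (set w) = v. f w) = (\<Sum>w | w \<in> words S L \<and> Q w. f w)"
    if "finite S" for S and f :: "nat list \<Rightarrow> real"
  proof -
    have "(\<lambda>w. card (set w)) ` {w. w \<in> words S L \<and> Q w} \<subseteq> {1..m+1}"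
    proof
      fix v assume "v \<in> (\<lambda>w. card (set w)) ` {w. w \<in> words S L \<and> Q w}"
      then obtain w where w: "v = card (set w)" "length w = L" "Q w" by (auto simp: words_def)
      then have "card (set w) > 0" using L by (auto simp: card_gt_0_iff)
      then show "v \<in> {1..m+1}" using few[OF w(2,3)] w(1) by simp
    qed
    from sum.group[OF _ _ this] finite_words[OF that] show ?thesis by simp
  qed
  have "real (card B) * (\<Sum>w | w \<in> words A L \<and> Q w. p ^ (card (set w) - 1)) =
     (\<Sum>v\<in>{1..m+1}. real (card B) * (real (card A choose v) * p ^ (v - 1)) * real (s v))"
  proof -
    have "(\<Sum>w | (w \<in> words A L \<and> Q w) \<and> card (set w) = v. p ^ (card (set w) - 1)) =
        real (card A choose v) * p ^ (v - 1) * real (s v)" for v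
    proof -
      have "(\<Sum>w | (w \<in> words A L \<and> Q w) \<and> card (set w) = v. p ^ (card (set w) - 1)) =
          (\<Sum>w | (w \<in> words A L \<and> Q w) \<and> card (set w) = v. p ^ (v - 1))"
        by (intro sum.cong) auto
      also have "\<dots> = real (card {w \<in> words A L. Q w \<and> card (set w) = v}) * p ^ (v - 1)"
        by (simp add: conj_assoc)
      finally show ?thesis by (simp add: cw[OF fin(1)])
    qed
    then have "(\<Sum>w | w \<in> words A L \<and> Q w. p ^ (card (set w) - 1)) =
        (\<Sum>v\<in>{1..m+1}. real (card A choose v) * p ^ (v - 1) * real (s v))"
      unfolding grp[OF fin(1), symmetric] by (intro sum.cong refl)
    then show ?thesis by (simp only: sum_distrib_left mult.assoc)
  qed
  also have "\<dots> \<le> (\<Sum>v\<in>{1..m+1}. real (card A) * real (card B choose v) * real (s v))"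
    using p by (intro sum_mono mult_right_mono choose_compare) auto
  also have "\<dots> = real (card A) * (\<Sum>v\<in>{1..m+1}. \<Sum>w | (w \<in> words B L \<and> Q w) \<and> card (set w) = v. 1)"
  proof -
    have "(\<Sum>w | (w \<in> words B L \<and> Q w) \<and> card (set w) = v. 1) = real (card B choose v) * real (s v)" for v
      using cw[OF fin(2), of v] by (simp add: conj_assoc)
    then show ?thesis by (simp only: sum_distrib_left mult.assoc)
  qed
  also have "\<dots> = real (card A) * real (card {w \<in> words B L. Q w})"
    by (subst grp[OF fin(2)]) simp
  finally show ?thesis .
qed

section \<open>Words and closed walks in which nothing occurs only once\<close>

definition doubled :: "'a list \<Rightarrow> bool" where
  "doubled es \<longleftrightarrow> (\<forall>e\<in>set es. 2 \<le> count_list es e)"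

lemma doubled_map: "doubled es \<Longrightarrow> doubled (map f es)"
  unfolding doubled_def using count_list_map_ge[of es _ f] by (auto intro: order_trans)

lemma doubled_map_inj: "inj_on f (set es) \<Longrightarrow> doubled (map f es) \<longleftrightarrow> doubled es"
  by (auto simp: doubled_def count_list_inj_map)

lemma doubled_card_le:
  assumes "doubled es"
  shows "2 * card (set es) \<le> length es"
proof -
  have "2 * card (set es) = (\<Sum>e\<in>set es. 2)" by simp
  also have "\<dots> \<le> (\<Sum>e\<in>set es. count_list es e)" using assms by (intro sum_mono) (simp add: doubled_def)
  also have "\<dots> = length es" by (rule sum_count_set) auto
  finally show ?thesis .
qed

definition walk_edges :: "nat list \<Rightarrow> nat set list" where
  "walk_edges w = map2 (\<lambda>x y. {x, y}) (last w # w) w"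

text \<open>A step that stays put appears in \<open>walk_edges\<close> as a singleton;
  \<open>card e = 2\<close> excludes it, in accordance with the zero diagonal of the
  matrices.\<close>

definition double_walk :: "nat list \<Rightarrow> bool" where
  "double_walk w \<longleftrightarrow> (\<forall>e\<in>set (walk_edges w). card e = 2) \<and> doubled (walk_edges w)"

lemma length_walk_edges: "length (walk_edges w) = length w"
  by (simp add: walk_edges_def)

lemma path_edges_subset:
  assumes "e \<in> set (map2 (\<lambda>x y. {x, y}) (x # w) w)"
  shows "e \<subseteq> insert x (set w)"
proof -
  obtain a b where ab: "(a, b) \<in> set (zip (x # w) w)" "e = {a, b}"
    using assms by (auto simp only: set_map image_iff case_prod_unfold) force
  then have "a \<in> set (x # w)" "b \<in> set w" by (blast dest: set_zip_leftD set_zip_rightD)+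
  then show ?thesis using ab(2) by auto
qed

lemma walk_edges_subset:
  assumes "e \<in> set (walk_edges w)"
  shows "e \<subseteq> set w"
proof -
  have "w \<noteq> []" using assms by (auto simp: walk_edges_def)
  then show ?thesis using path_edges_subset[of e "last w" w] assms
    by (auto simp: walk_edges_def insert_absorb)
qed

text \<open>A walk is connected: read from the back, every new vertex comes with a new edge.\<close>

lemma card_vertices_le_edges:
  "card (insert x (set w)) \<le> card (set (map2 (\<lambda>x y. {x, y}) (x # w) w)) + 1"
proof (induction w arbitrary: x)
  case (Cons y w)
  let ?E = "set (map2 (\<lambda>x y. {x, y}) (y # w) w)"
  have E: "set (map2 (\<lambda>x y. {x, y}) (x # y # w) (y # w)) = insert {x, y} ?E" by simp
  show ?case
  proof (cases "x \<in> insert y (set w)")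
    case True
    then have "insert x (set (y # w)) = insert y (set w)" by auto
    moreover have "card ?E \<le> card (insert {x, y} ?E)" by (intro card_mono) auto
    ultimately show ?thesis unfolding E using Cons[of y] by simp
  next
    case False
    have "{x, y} \<notin> ?E"
    proof
      assume "{x, y} \<in> ?E"
      from path_edges_subset[OF this] False show False by blast
    qed
    then have "card (insert {x, y} ?E) = card ?E + 1" by simp
    moreover have "card (insert x (set (y # w))) = card (insert y (set w)) + 1"
      using False by simp
    ultimately show ?thesis unfolding E using Cons[of y] by simp
  qed
qed simp

lemma card_walk_vertices: "card (set w) \<le> card (set (walk_edges w)) + 1"
  using card_vertices_le_edges[of "last w" w]
  by (cases "w = []") (auto simp: walk_edges_def insert_absorb)

text \<open>At most \<open>m\<close> distinct edges, hence by connectedness at most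
  \<open>m + 1\<close> vertices.\<close>

lemma double_walk_card:
  assumes "double_walk w" "length w = 2 * m"
  shows "card (set w) \<le> m + 1"
  using doubled_card_le[of "walk_edges w"] card_walk_vertices[of w] assms
  by (simp add: double_walk_def length_walk_edges)

lemma double_walk_map:
  assumes "inj_on f (set w)" "double_walk w"
  shows "double_walk (map f w)"
proof -
  have "walk_edges (map f w) = map ((`) f) (walk_edges w)"
    by (cases "w = []") (auto simp: walk_edges_def last_map zip_map1 zip_map2 simp flip: list.map)
  moreover have "card (f ` e) = card e" if "e \<in> set (walk_edges w)" for e
    using walk_edges_subset[OF that] assms(1) by (meson card_image inj_on_subset)
  ultimately show ?thesis using assms(2) doubled_map[of "walk_edges w" "(`) f"]
    by (simp add: double_walk_def)
qed

lemma prod_list_walk: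
  "prod_list (map2 (sym_entries f) (last w # w) w) =
    prod_list (map (\<lambda>e. if card e = 2 then f e else 0) (walk_edges w))"
proof -
  have "sym_entries f x y = (if card {x, y} = 2 then f {x, y} else 0)" for x y
    by (auto simp: sym_entries_def card_insert_if)
  then show ?thesis
    unfolding walk_edges_def by (simp add: comp_def case_prod_unfold)
qed

text \<open>In the expanded trace moment each double walk contributes at least 1 and every other
  walk at least 0.\<close>

lemma card_double_walks_le:
  fixes n m :: nat
  assumes "0 < n" "m \<le> n" "0 < m"
  shows "real (card {w \<in> words {..<n} (2 * m). double_walk w}) \<le> 2 * real n * (norm_const * real n) ^ m"
proof -
  have "real (card {w \<in> words {..<n} (2 * m). double_walk w}) =
      (\<Sum>w\<in>words {..<n} (2 * m). if double_walk w then 1 else 0)"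
    by (simp add: sum.If_cases finite_words Int_def)
  also have "\<dots> \<le> (\<Sum>w\<in>words {..<n} (2 * m). tav (pairs n) (\<lambda>y. prod_list (map2 (sym_entries y) (last w # w) w)))"
  proof (rule sum_mono)
    fix w assume w: "w \<in> words {..<n} (2 * m)"
    show "(if double_walk w then 1 else 0) \<le> tav (pairs n) (\<lambda>y. prod_list (map2 (sym_entries y) (last w # w) w))"
    proof (cases "\<forall>e\<in>set (walk_edges w). card e = 2")
      case True
      then have "set (walk_edges w) \<subseteq> pairs n"
        using walk_edges_subset w by (fastforce simp: pairs_def words_def)
      note * = tav_prod_list[OF finite_pairs this]
      have "prod_list (map2 (sym_entries y) (last w # w) w) = prod_list (map y (walk_edges w))" for y
        unfolding prod_list_walk using True by (intro arg_cong[of _ _ prod_list] map_cong) auto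
      then show ?thesis using * True by (auto simp: double_walk_def doubled_def)
    next
      case False
      then have "prod_list (map2 (sym_entries y) (last w # w) w) = 0" for y
        unfolding prod_list_walk by (auto simp: prod_list_zero_iff image_iff)
      then show ?thesis using False by (simp add: double_walk_def tav_const[OF finite_pairs])
    qed
  qed
  also have "\<dots> = tav (pairs n) (\<lambda>y. trace_power {..<n} (sym_entries y) (2 * m))"
    using assms(3) by (simp add: trace_power_walks tav_sum)
  also have "\<dots> \<le> 2 * real n * (norm_const * real n) ^ m" by (rule tav_trace_power_le[OF assms(1,2)])
  finally show ?thesis .
qed

lemma sum_power_words:
  fixes x :: "'a \<Rightarrow> real"
  assumes "finite A"
  shows "(\<Sum>i\<in>A. x i) ^ L = (\<Sum>w\<in>words A L. prod_list (map x w))"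
proof (induction L)
  case 0
  have "words A 0 = {[]}" by (auto simp: words_def)
  then show ?case by simp
next
  case (Suc L)
  then show ?case by (simp add: sum_words_Suc[OF assms] sum_product)
qed

text \<open>The same counting device with a power of a sum of independent variables in place of the
  trace.\<close>

lemma card_doubled_words_le:
  fixes n m :: nat
  assumes "0 < n" "0 < m"
  shows "real (card {w \<in> words {..<n} (2 * m). doubled w}) \<le> 2 * (4 * exp 4 * real m * real n) ^ m"
proof -
  have "real (card {w \<in> words {..<n} (2 * m). doubled w}) =
      (\<Sum>w\<in>words {..<n} (2 * m). if doubled w then 1 else 0)"
    by (simp add: sum.If_cases finite_words Int_def)
  also have "\<dots> \<le> (\<Sum>w\<in>words {..<n} (2 * m). tav {..<n} (\<lambda>y. prod_list (map y w)))"
  proof (rule sum_mono)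
    fix w assume "w \<in> words {..<n} (2 * m)"
    then have "set w \<subseteq> {..<n}" by (simp add: words_def)
    then show "(if doubled w then 1 else 0) \<le> tav {..<n} (\<lambda>y. prod_list (map y w))"
      using tav_prod_list[of "{..<n}" w] by (auto simp: doubled_def)
  qed
  also have "\<dots> = tav {..<n} (\<lambda>y. (\<Sum>i<n. 1 * y i) ^ (2 * m))"
    by (simp add: sum_power_words tav_sum)
  \<comment> \<open>The scale \<open>sqrt (m / n)\<close> turns the exponent into
    \<open>4 m\<close>.\<close>
  also have "\<dots> \<le> 2 * fact (2 * m) / sqrt (m / n) ^ (2 * m) * exp (4 * (sqrt (m / n))\<^sup>2 * (\<Sum>i<n. 1\<^sup>2))"
    using assms by (intro tav_even_moment) auto
  also have "4 * (sqrt (m / n))\<^sup>2 * (\<Sum>i<n. 1\<^sup>2) = real m * 4" using assms by simp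
  also have "exp (real m * 4) = exp 4 ^ m" by (rule exp_of_nat_mult)
  also have "sqrt (m / n) ^ (2 * m) = (real m / n) ^ m" by (simp add: power_mult)
  also have "2 * fact (2 * m) / (real m / n) ^ m * exp 4 ^ m \<le> 2 * (4 * real m ^ 2) ^ m / (real m / n) ^ m * exp 4 ^ m"
    using fact_double_le[of m] assms by (intro mult_right_mono divide_right_mono mult_left_mono) auto
  also have "\<dots> = 2 * ((4 * real m ^ 2) / (real m / n) * exp 4) ^ m"
    by (simp only: power_mult_distrib power_divide)
  also have "(4 * real m ^ 2) / (real m / n) * exp 4 = 4 * exp 4 * real m * real n"
    using assms by (simp add: power2_eq_square)
  finally show ?thesis .
qed

section \<open>Moments of the random graph\<close>

text \<open>The first part has content only for \<open>c = 1\<close>, where the mean vanishes. The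
  bound \<open>p\<close> comes from \<open>p (1 - p) + (1 - p) p^2 = p (1 - p^2)\<close>.\<close>

lemma centred_bernoulli_moment:
  fixes p :: real
  assumes "0 \<le> p" "p \<le> 1"
  shows "p * (1 - p) ^ c + (1 - p) * (- p) ^ c = 0 \<or> 2 \<le> c \<or> c = 0"
    and "2 \<le> c \<Longrightarrow> \<bar>p * (1 - p) ^ c + (1 - p) * (- p) ^ c\<bar> \<le> p"
proof -
  show "p * (1 - p) ^ c + (1 - p) * (- p) ^ c = 0 \<or> 2 \<le> c \<or> c = 0"
  proof (cases "c = 1")
    case True
    then show ?thesis by (simp add: algebra_simps)
  qed linarith
  assume c: "2 \<le> c"
  have *: "\<bar>p * (1 - p) ^ c + (1 - p) * (- p) ^ c\<bar> \<le> p * (1 - p) ^ c + (1 - p) * p ^ c"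
    using assms by (intro order_trans[OF abs_triangle_ineq]) (simp add: abs_mult power_abs)
  have "p * (1 - p) ^ c + (1 - p) * p ^ c \<le> p * (1 - p) ^ 1 + (1 - p) * p ^ 2"
    using assms c by (intro add_mono mult_left_mono power_decreasing) auto
  also have "\<dots> = p * (1 - p\<^sup>2)" by (simp add: power2_eq_square algebra_simps)
  also have "\<dots> \<le> p * 1" using assms by (intro mult_left_mono) auto
  finally show "\<bar>p * (1 - p) ^ c + (1 - p) * (- p) ^ c\<bar> \<le> p" using * by linarith
qed

lemma finite_potential_edges: "finite (potential_edges N)"
  by (rule finite_subset[of _ "Pow {1..N}"]) (auto simp: potential_edges_def)

locale kwise_graph =
  fixes N k :: nat and p :: real and G :: "nat set set pmf"
  assumes p01: "0 < p" "p < 1"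
    and support: "set_pmf G \<subseteq> Pow (potential_edges N)"
    and edge_prob: "\<And>e. e \<in> potential_edges N \<Longrightarrow> measure_pmf.prob G {E. e \<in> E} = p"
    and indep: "\<And>S. S \<subseteq> potential_edges N \<Longrightarrow> card S \<le> k \<Longrightarrow>
      prob_space.indep_vars (measure_pmf G) (\<lambda>_. count_space UNIV) (\<lambda>e E. e \<in> E) S"
begin

lemma finite_support: "finite (set_pmf G)"
  using support finite_potential_edges finite_subset by blast

lemma integrable_G [simp]: "integrable (measure_pmf G) (f :: _ \<Rightarrow> real)"
  by (rule integrable_measure_pmf_finite[OF finite_support])

lemma edge_moment:
  assumes "e \<in> potential_edges N"
  shows "measure_pmf.expectation G (\<lambda>E. (of_bool (e \<in> E) - p) ^ c) = p * (1 - p) ^ c + (1 - p) * (- p) ^ c"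
proof -
  have eq: "(of_bool (e \<in> E) - p) ^ c = (1 - p) ^ c * indicator {E. e \<in> E} E
      + (- p) ^ c * (1 - indicator {E. e \<in> E} E)" for E :: "nat set set"
    by (auto simp: indicator_def)
  have "measure_pmf.expectation G (\<lambda>E. (of_bool (e \<in> E) - p) ^ c) =
     (1 - p) ^ c * p + (- p) ^ c * (1 - p)"
    unfolding eq using edge_prob[OF assms]
    by (subst Bochner_Integration.integral_add) (simp_all add: Bochner_Integration.integral_diff)
  then show ?thesis by (simp add: mult.commute)
qed

text \<open>At most \<open>k\<close> distinct edges occur, so the expectation factorises; an edge
  occurring once contributes a factor 0.\<close>

lemma expectation_prod_list_le:
  assumes es: "set es \<subseteq> potential_edges N" "length es \<le> k"
  shows "measure_pmf.expectation G (\<lambda>E. prod_list (map (\<lambda>e. of_bool (e \<in> E) - p) es))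
    \<le> (if doubled es then p ^ card (set es) else 0)"
proof -
  let ?m = "\<lambda>c. p * (1 - p) ^ c + (1 - p) * (- p) ^ c"
  have "card (set es) \<le> k" using card_length[of es] es(2) by linarith
  from indep[OF es(1) this]
  have "prob_space.indep_vars (measure_pmf G) (\<lambda>_. borel)
      (\<lambda>e E. (of_bool (e \<in> E) - p) ^ count_list es e) (set es)"
    by (rule prob_space.indep_vars_compose2[OF measure_pmf.prob_space_axioms]) auto
  then have "measure_pmf.expectation G (\<lambda>E. \<Prod>e\<in>set es. (of_bool (e \<in> E) - p) ^ count_list es e)
      = (\<Prod>e\<in>set es. measure_pmf.expectation G (\<lambda>E. (of_bool (e \<in> E) - p) ^ count_list es e))"
    by (intro prob_space.indep_vars_lebesgue_integral measure_pmf.prob_space_axioms) auto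
  also have "\<dots> = (\<Prod>e\<in>set es. ?m (count_list es e))"
    using es(1) by (intro prod.cong refl edge_moment) auto
  finally have eq: "measure_pmf.expectation G (\<lambda>E. prod_list (map (\<lambda>e. of_bool (e \<in> E) - p) es))
      = (\<Prod>e\<in>set es. ?m (count_list es e))"
    by (simp add: prod_list_eq_prod_power[of "set es"])
  show ?thesis
  proof (cases "doubled es")
    case True
    have "(\<Prod>e\<in>set es. ?m (count_list es e)) \<le> (\<Prod>e\<in>set es. \<bar>?m (count_list es e)\<bar>)"
      by (subst abs_prod[symmetric]) (rule abs_ge_self)
    also have "\<dots> \<le> (\<Prod>e\<in>set es. p)"
      using True p01 by (intro prod_mono conjI centred_bernoulli_moment(2)) (auto simp: doubled_def)
    finally show ?thesis using True eq by simp
  next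
    case False
    then obtain e where e: "e \<in> set es" "count_list es e < 2" by (auto simp: doubled_def not_le)
    then have "?m (count_list es e) = 0"
      using centred_bernoulli_moment(1)[of p "count_list es e"] p01 count_list_0_iff[of es e] by auto
    then have "(\<Prod>e\<in>set es. ?m (count_list es e)) = 0" using e(1) by (intro prod_zero) auto
    with eq have "measure_pmf.expectation G (\<lambda>E. prod_list (map (\<lambda>e. of_bool (e \<in> E) - p) es)) = 0"
      by (rule trans)
    then show ?thesis using False by simp
  qed
qed

definition centred :: "nat set set \<Rightarrow> nat \<Rightarrow> nat \<Rightarrow> real" where
  "centred E = sym_entries (\<lambda>e. of_bool (e \<in> E) - p)"

lemma expectation_trace_le:
  assumes "2 * m \<le> k" "0 < m" "real N * p + m + 1 \<le> real n"
  shows "measure_pmf.expectation G (\<lambda>E. trace_power {1..N} (centred E) (2 * m))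
    \<le> 2 * real N * (norm_const * real n) ^ m"
proof -
  let ?W = "words {1..N} (2 * m)"
  have n: "0 < n" "m \<le> n"
  proof -
    have "0 \<le> real N * p" using p01 by simp
    then show "0 < n" "m \<le> n" using assms(3) by linarith+
  qed
  have "measure_pmf.expectation G (\<lambda>E. trace_power {1..N} (centred E) (2 * m)) =
     (\<Sum>w\<in>?W. measure_pmf.expectation G (\<lambda>E. prod_list (map2 (centred E) (last w # w) w)))"
    using assms(2) by (simp add: trace_power_walks)
  also have "\<dots> \<le> (\<Sum>w\<in>?W. if double_walk w then p ^ (card (set w) - 1) else 0)"
  proof (rule sum_mono)
    fix w assume w: "w \<in> ?W"
    show "measure_pmf.expectation G (\<lambda>E. prod_list (map2 (centred E) (last w # w) w))
        \<le> (if double_walk w then p ^ (card (set w) - 1) else 0)"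
    proof (cases "\<forall>e\<in>set (walk_edges w). card e = 2")
      case True
      have "prod_list (map2 (centred E) (last w # w) w) =
          prod_list (map (\<lambda>e. of_bool (e \<in> E) - p) (walk_edges w))" for E
        unfolding centred_def prod_list_walk using True
        by (intro arg_cong[of _ _ prod_list] map_cong) auto
      moreover have "set (walk_edges w) \<subseteq> potential_edges N"
        using walk_edges_subset w True by (fastforce simp: potential_edges_def words_def)
      moreover have "length (walk_edges w) \<le> k" using w assms(1) by (simp add: length_walk_edges words_def)
      \<comment> \<open>A connected walk has at least as many edges as vertices minus one, and
        \<open>p < 1\<close>.\<close>
      moreover have "p ^ card (set (walk_edges w)) \<le> p ^ (card (set w) - 1)"
        using p01 card_walk_vertices[of w] by (intro power_decreasing) auto
      ultimately show ?thesis
        using expectation_prod_list_le[of "walk_edges w"] True by (auto simp: double_walk_def split: if_splits)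
    next
      case False
      then have "prod_list (map2 (centred E) (last w # w) w) = 0" for E
        unfolding centred_def prod_list_walk by (auto simp: prod_list_zero_iff image_iff)
      moreover have "\<not> double_walk w" using False by (simp add: double_walk_def)
      ultimately show ?thesis by simp
    qed
  qed
  also have "\<dots> = (\<Sum>w | w \<in> ?W \<and> double_walk w. p ^ (card (set w) - 1))"
    by (simp add: sum.If_cases finite_words Int_def)
  finally have E: "measure_pmf.expectation G (\<lambda>E. trace_power {1..N} (centred E) (2 * m)) \<le>
    (\<Sum>w | w \<in> ?W \<and> double_walk w. p ^ (card (set w) - 1))" .
  have "real (card {..<n}) * (\<Sum>w | w \<in> ?W \<and> double_walk w. p ^ (card (set w) - 1))
    \<le> real (card {1..N}) * real (card {w \<in> words {..<n} (2 * m). double_walk w})"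
    using assms p01 by (intro words_compare[where m = m] double_walk_map double_walk_card) auto
  also have "\<dots> \<le> real N * (2 * real n * (norm_const * real n) ^ m)"
    using card_double_walks_le[OF n assms(2)] by (simp add: mult_left_mono)
  finally have "real n * (\<Sum>w | w \<in> ?W \<and> double_walk w. p ^ (card (set w) - 1))
    \<le> real n * (2 * real N * (norm_const * real n) ^ m)" by (simp add: mult_ac)
  then show ?thesis using E n(1) by (simp add: mult_le_cancel_left)
qed

text \<open>A star has as many edges as leaves. The resulting extra factor \<open>p\<close> cancels
  the ratio of alphabet sizes in \<open>words_compare\<close>, because
  \<open>card ?A * p \<le> n\<close>.\<close>

lemma expectation_degree_moment_le:
  assumes "2 * m \<le> k" "0 < m" "real N * p + m + 1 \<le> real n" and v: "v \<in> {1..N}"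
  shows "measure_pmf.expectation G (\<lambda>E. (\<Sum>u\<in>{1..N} - {v}. of_bool ({v, u} \<in> E) - p) ^ (2 * m))
    \<le> 2 * (4 * exp 4 * real m * real n) ^ m"
proof -
  let ?A = "{1..N} - {v}"
  let ?W = "words ?A (2 * m)"
  have Np: "0 \<le> real N * p" using p01 by simp
  have n: "0 < n" using Np assms(3) by linarith
  have cA: "real (card ?A) \<le> real N" using v by simp
  have "measure_pmf.expectation G (\<lambda>E. (\<Sum>u\<in>?A. of_bool ({v, u} \<in> E) - p) ^ (2 * m)) =
     (\<Sum>w\<in>?W. measure_pmf.expectation G (\<lambda>E. prod_list (map (\<lambda>u. of_bool ({v, u} \<in> E) - p) w)))"
    by (simp add: sum_power_words)
  also have "\<dots> \<le> (\<Sum>w\<in>?W. if doubled w then p ^ card (set w) else 0)"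
  proof (rule sum_mono)
    fix w assume w: "w \<in> ?W"
    let ?es = "map (\<lambda>u. {v, u}) w"
    have inj: "inj_on (\<lambda>u. {v, u}) (set w)" by (auto simp: inj_on_def doubleton_eq_iff)
    have "set ?es \<subseteq> potential_edges N"
      using w v by (force simp: words_def potential_edges_def card_2_iff)
    moreover have "length ?es \<le> k" using w assms(1) by (simp add: words_def)
    moreover have "card (set ?es) = card (set w)" using card_image[OF inj] by simp
    ultimately show "measure_pmf.expectation G (\<lambda>E. prod_list (map (\<lambda>u. of_bool ({v, u} \<in> E) - p) w))
        \<le> (if doubled w then p ^ card (set w) else 0)"
      using expectation_prod_list_le[of ?es] doubled_map_inj[OF inj] by (auto simp: comp_def split: if_splits)
  qed
  also have "\<dots> = (\<Sum>w | w \<in> ?W \<and> doubled w. p ^ card (set w))"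
    by (simp add: sum.If_cases finite_words Int_def)
  also have "\<dots> = p * (\<Sum>w | w \<in> ?W \<and> doubled w. p ^ (card (set w) - 1))"
  proof -
    have "p ^ card (set w) = p * p ^ (card (set w) - 1)" if "w \<in> ?W" for w
    proof -
      have "w \<noteq> []" using that assms(2) by (auto simp: words_def)
      then have "0 < card (set w)" by (simp add: card_gt_0_iff)
      then show ?thesis by (simp flip: power_Suc)
    qed
    then show ?thesis by (simp add: sum_distrib_left)
  qed
  finally have E: "measure_pmf.expectation G (\<lambda>E. (\<Sum>u\<in>?A. of_bool ({v, u} \<in> E) - p) ^ (2 * m)) \<le>
    p * (\<Sum>w | w \<in> ?W \<and> doubled w. p ^ (card (set w) - 1))" .
  let ?s = "\<Sum>w | w \<in> ?W \<and> doubled w. p ^ (card (set w) - 1)"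
  let ?c = "real (card {w \<in> words {..<n} (2 * m). doubled w})"
  have "real (card ?A) * p \<le> real N * p" using cA p01 by (intro mult_right_mono) auto
  then have Ap: "real (card ?A) * p + m + 1 \<le> real (card {..<n})" using assms(3) by simp
  have "real (card {..<n}) * ?s \<le> real (card ?A) * ?c"
  proof (rule words_compare[where m = m])
    show "card (set w) \<le> m + 1" if "length w = 2 * m" "doubled w" for w :: "nat list"
      using doubled_card_le[OF that(2)] that(1) by simp
  qed (use assms p01 Ap in \<open>auto intro: doubled_map\<close>)
  then have "p * (real n * ?s) \<le> p * (real (card ?A) * ?c)" using p01 by (intro mult_left_mono) auto
  also have "\<dots> = (real (card ?A) * p) * ?c" by (simp only: mult_ac)
  also have "\<dots> \<le> real n * ?c" using Ap by (intro mult_right_mono) auto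
  finally have "real n * (p * ?s) \<le> real n * ?c" by (simp only: mult_ac)
  then have "p * ?s \<le> ?c" using n by (simp add: mult_le_cancel_left)
  then show ?thesis using E card_doubled_words_le[OF n assms(2)] by linarith
qed

end

section \<open>Pseudo-random graphs are Hamiltonian\<close>

lemma ip_of_bool:
  assumes "finite I" "A \<subseteq> I"
  shows "ip I (\<lambda>i. of_bool (i \<in> A)) x = sum x A"
  unfolding ip_def using assms
  by (intro sum.mono_neutral_cong_right) (auto simp: of_bool_def)

lemma mv_of_bool:
  assumes "finite I" "B \<subseteq> I"
  shows "mv I M (\<lambda>i. of_bool (i \<in> B)) i = sum (M i) B"
  unfolding mv_def using assms
  by (intro sum.mono_neutral_cong_right) (auto simp: of_bool_def)

context kwise_graph
begin

lemma centred_commute: "centred E i j = centred E j i"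
  unfolding centred_def by (rule sym_entries_commute)

text \<open>The expander mixing lemma for the indicator vectors of \<open>A\<close> and
  \<open>B\<close>.\<close>

lemma square_sum_centred_le:
  assumes tr: "trace_power {1..N} (centred E) (2 * 2 ^ j) \<le> b ^ (2 ^ j)" "0 \<le> b"
    and AB: "A \<subseteq> {1..N}" "B \<subseteq> {1..N}"
  shows "(\<Sum>a\<in>A. \<Sum>b\<in>B. centred E a b)\<^sup>2 \<le> real (card A) * (b * real (card B))"
proof -
  let ?I = "{1..N}"
  let ?A = "\<lambda>i. of_bool (i \<in> A) :: real" and ?B = "\<lambda>i. of_bool (i \<in> B) :: real"
  have "(\<Sum>a\<in>A. \<Sum>b\<in>B. centred E a b)\<^sup>2 = (ip ?I ?A (mv ?I (centred E) ?B))\<^sup>2"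
    using AB by (simp add: ip_of_bool mv_of_bool)
  also have "\<dots> \<le> ip ?I ?A ?A * ip ?I (mv ?I (centred E) ?B) (mv ?I (centred E) ?B)"
    by (rule ip_Cauchy_Schwarz)
  also have "\<dots> \<le> ip ?I ?A ?A * (b * ip ?I ?B ?B)"
    by (intro mult_left_mono norm_mv_le_of_trace[OF _ centred_commute tr] ip_self_nonneg) simp
  also have "\<dots> = real (card A) * (b * real (card B))"
    using AB by (simp add: ip_of_bool)
  finally show ?thesis .
qed

text \<open>The trace hypothesis bounds the norm by \<open>p q / 2\<close>. Unjoined
  \<open>q\<close>-sets would have deviation \<open>- p |A| |B|\<close>, too large for it. A badly
  expanding \<open>U\<close> would send all its edges into a small \<open>W\<close>, far more than
  the mixing lemma allows.\<close>

lemma hamiltonian_of_trace_and_degrees: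
  assumes tr: "trace_power {1..N} (centred E) (2 * 2 ^ j) \<le> (p * real q / 2) ^ (2 * 2 ^ j)"
    and deg: "\<And>v. v \<in> {1..N} \<Longrightarrow> \<bar>\<Sum>u\<in>{1..N} - {v}. of_bool ({v, u} \<in> E) - p\<bar> \<le> real N * p / 4"
    and q: "0 < q" and g: "0 < g" "q \<le> g ^ t" "4 * (2 * g + 1) * q \<le> N"
    and large: "(13 * q + 2) * (2 * t + 4) + q \<le> N"
  shows "hamiltonian N E"
proof -
  define b where "b = (p * real q / 2)\<^sup>2"
  have pq: "0 < p * real q" using p01 q by simp
  have b: "0 \<le> b" "trace_power {1..N} (centred E) (2 * 2 ^ j) \<le> b ^ (2 ^ j)"
    using tr by (simp_all add: b_def power_mult)
  note jumbled = square_sum_centred_le[OF b(2,1)]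
  have N4: "4 \<le> N" using large by (simp add: algebra_simps)
  interpret joined_graph "{1..N}" E q
  proof
    fix A B assume AB: "A \<subseteq> {1..N}" "B \<subseteq> {1..N}" "A \<inter> B = {}" "q \<le> card A" "q \<le> card B"
    show "\<exists>a\<in>A. \<exists>b\<in>B. {a, b} \<in> E"
    proof (rule ccontr)
      assume no: "\<not> ?thesis"
      have "(\<Sum>a\<in>A. \<Sum>b\<in>B. centred E a b) = (\<Sum>a\<in>A. \<Sum>b\<in>B. - p)"
        using no AB(3) by (intro sum.cong refl) (auto simp: centred_def sym_entries_def)
      then have "(real (card A) * real (card B) * p)\<^sup>2 \<le> real (card A) * (b * real (card B))"
        using jumbled[OF AB(1,2)] by (simp add: power_mult_distrib)
      then have "(real (card A) * real (card B)) * (real (card A) * real (card B) * p\<^sup>2)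
          \<le> (real (card A) * real (card B)) * b"
        by (simp add: power2_eq_square mult_ac)
      moreover have "0 < real (card A) * real (card B)" using AB q by simp
      ultimately have "real (card A) * real (card B) * p\<^sup>2 \<le> b" by (rule mult_left_le_imp_le)
      moreover have "real q * real q * p\<^sup>2 \<le> real (card A) * real (card B) * p\<^sup>2"
        using AB by (intro mult_right_mono mult_mono) auto
      moreover have "real q * real q * p\<^sup>2 = 4 * b" by (simp add: b_def power2_eq_square)
      moreover have "0 < b" unfolding b_def using pq by (intro zero_less_power) simp
      ultimately show False by linarith
    qed
  qed (use q in auto)
  interpret expander "{1..N}" E q g t
  proof
    fix U assume U: "U \<subseteq> {1..N}" "U \<noteq> {}" "card U \<le> q"
    show "2 * g * card U \<le> card (nbhd U - U)"
    proof (rule ccontr)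
      assume "\<not> ?thesis"
      then have less: "card (nbhd U - U) < 2 * g * card U" by simp
      define W where "W = U \<union> nbhd U"
      have WV: "W \<subseteq> {1..N}" unfolding W_def nbhd_def using U(1) by blast
      have finU: "finite U" using U finite_subset by blast
      have cU: "0 < card U" using U finU by (simp add: card_gt_0_iff)
      have "card W = card (U \<union> (nbhd U - U))" by (simp add: W_def)
      also have "\<dots> \<le> card U + card (nbhd U - U)" by (rule card_Un_le)
      also have "\<dots> \<le> (2 * g + 1) * card U" using less by (simp add: algebra_simps)
      finally have cW: "card W \<le> (2 * g + 1) * card U" .
      also have "\<dots> \<le> (2 * g + 1) * q" using U(3) by (rule mult_le_mono2)
      finally have "4 * card W \<le> N" using g(3) by (simp add: algebra_simps)
      then have W4: "real (card W) * p \<le> real N * p / 4" using p01 by simp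
      \<comment> \<open>All neighbours of \<open>u\<close> lie in \<open>W\<close>, so the row sum
        is the degree, at least \<open>(N - 1) p - N p / 4\<close>, minus at most
        \<open>card W * p \<le> N p / 4\<close>; the third quarter pays for the single
        \<open>p\<close>.\<close>
      have row: "real N * p / 4 \<le> (\<Sum>w\<in>W. centred E u w)" if u: "u \<in> U" for u
      proof -
        let ?d = "\<Sum>w\<in>{1..N} - {u}. of_bool ({u, w} \<in> E) :: real"
        have uV: "u \<in> {1..N}" using U u by auto
        have finW: "finite W" using WV finite_subset by blast
        have "(\<Sum>w\<in>W. centred E u w) = (\<Sum>w\<in>W - {u}. of_bool ({u, w} \<in> E) - p)"
          using finW by (intro sum.mono_neutral_cong_right) (auto simp: centred_def sym_entries_def)
        also have "\<dots> = (\<Sum>w\<in>W - {u}. of_bool ({u, w} \<in> E)) - real (card (W - {u})) * p"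
          by (simp add: sum_subtractf)
        also have "(\<Sum>w\<in>W - {u}. of_bool ({u, w} \<in> E)) = ?d"
        proof (rule sum.mono_neutral_left)
          show "\<forall>w\<in>{1..N} - {u} - (W - {u}). of_bool ({u, w} \<in> E) = 0"
          proof
            fix w assume w: "w \<in> {1..N} - {u} - (W - {u})"
            have "{u, w} \<notin> E" using w u unfolding W_def nbhd_def by blast
            then show "of_bool ({u, w} \<in> E) = 0" by simp
          qed
        qed (use WV in auto)
        finally have eq: "(\<Sum>w\<in>W. centred E u w) = ?d - real (card (W - {u})) * p" .
        have "real (card (W - {u})) * p \<le> real (card W) * p"
          using p01 finW by (intro mult_right_mono) (auto intro: card_mono)
        moreover have "(\<Sum>w\<in>{1..N} - {u}. of_bool ({u, w} \<in> E) - p) = ?d - (real N - 1) * p"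
          using uV by (simp add: sum_subtractf of_nat_diff)
        then have "(real N - 1) * p - real N * p / 4 \<le> ?d" using deg[OF uV] by linarith
        moreover have "p \<le> real N * p / 4" using N4 p01 by simp
        ultimately show ?thesis using eq W4 by (simp add: algebra_simps)
      qed
      have "real (card U) * (real N * p / 4) \<le> (\<Sum>u\<in>U. \<Sum>w\<in>W. centred E u w)"
        using sum_mono[of U "\<lambda>_. real N * p / 4", OF row] by simp
      then have "(real (card U) * (real N * p / 4))\<^sup>2 \<le> (\<Sum>u\<in>U. \<Sum>w\<in>W. centred E u w)\<^sup>2"
        using p01 by (intro power_mono) auto
      also have "\<dots> \<le> real (card U) * (b * real (card W))" by (rule jumbled[OF U(1) WV])
      also have "\<dots> \<le> real (card U) * (b * (real (2 * g + 1) * real (card U)))"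
        using b(1) of_nat_mono[OF cW, where 'a = real] by (intro mult_left_mono) (simp_all only: of_nat_mult of_nat_0_le_iff)
      finally have "(real (card U))\<^sup>2 * (real N * p / 4)\<^sup>2 \<le> (real (card U))\<^sup>2 * (b * real (2 * g + 1))"
        by (simp add: power2_eq_square mult_ac)
      then have "(real N * p / 4)\<^sup>2 \<le> b * real (2 * g + 1)"
        using cU by (simp add: mult_le_cancel_left)
      then have "p\<^sup>2 * (real N)\<^sup>2 \<le> p\<^sup>2 * (4 * (real q)\<^sup>2 * real (2 * g + 1))"
        by (simp add: b_def power_mult_distrib power_divide field_simps)
      then have le: "(real N)\<^sup>2 \<le> 4 * (real q)\<^sup>2 * real (2 * g + 1)"
        using p01 by (simp add: mult_le_cancel_left)
      define r where "r = real (2 * g + 1)"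
      have r1: "1 \<le> r" by (simp add: r_def)
      \<comment> \<open>\<open>N^2 \<le> 4 q^2 r\<close> and \<open>4 r q \<le> N\<close> leave
        \<open>16 r^2 \<le> 4 r\<close>, impossible for \<open>r \<ge> 1\<close>.\<close>
      have "real (4 * (2 * g + 1) * q) \<le> real N" using g(3) by (rule of_nat_mono)
      then have "(4 * r * real q)\<^sup>2 \<le> (real N)\<^sup>2" by (intro power_mono) (simp_all add: r_def)
      then have "(real q)\<^sup>2 * (16 * (r * r)) \<le> (real q)\<^sup>2 * (4 * r)"
        using le unfolding r_def[symmetric] by (simp add: power2_eq_square mult_ac)
      then have "16 * (r * r) \<le> 4 * r" using q by (simp add: mult_le_cancel_left)
      moreover have "1 * r \<le> r * r" using r1 by (intro mult_right_mono) auto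
      ultimately show False using r1 by linarith
    qed
  qed (use g large in auto)
  obtain c where "is_path E c" "set c = {1..N}" "{hd c, last c} \<in> E" using hamiltonian_cycle_exists by blast
  then show ?thesis using hamiltonian_of_path N4 by auto
qed

end

section \<open>Failure probability\<close>

context kwise_graph
begin

lemma prob_ge_le:
  assumes "\<And>E. 0 \<le> f E" "0 < (c::real)"
  shows "measure_pmf.prob G {E. c \<le> f E} \<le> measure_pmf.expectation G f / c"
  using integral_Markov_inequality_measure[of "measure_pmf G" f UNIV c] assms by simp

text \<open>Markov's inequality for the trace, and for each of the \<open>N\<close> degrees with a
  union bound. The matching adds no failure event, since it is contained in the cycle.\<close>

lemma prob_not_hamiltonian_le:
  assumes m: "m = 2 ^ j" "2 * m \<le> k" and n: "real N * p + m + 1 \<le> real n"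
    and q: "0 < q" and g: "0 < g" "q \<le> g ^ t" "4 * (2 * g + 1) * q \<le> N"
    and large: "(13 * q + 2) * (2 * t + 4) + q \<le> N"
  shows "1 - measure_pmf.prob G {E. hamiltonian N E \<and> (even N \<longrightarrow> (\<exists>M. perfect_matching N E M))}
    \<le> 2 * real N * (norm_const * real n) ^ m / (p * real q / 2) ^ (2 * m)
      + real N * (2 * (4 * exp 4 * real m * real n) ^ m / (real N * p / 4) ^ (2 * m))"
proof -
  define S where "S v E = (\<Sum>u\<in>{1..N} - {v}. of_bool ({v, u} \<in> E) - p)" for v and E :: "nat set set"
  define H where "H = {E. hamiltonian N E \<and> (even N \<longrightarrow> (\<exists>M. perfect_matching N E M))}"
  define A where "A = {E. (p * real q / 2) ^ (2 * m) \<le> trace_power {1..N} (centred E) (2 * m)}"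
  define B where "B v = {E. (real N * p / 4) ^ (2 * m) \<le> S v E ^ (2 * m)}" for v
  have m0: "0 < m" using m by simp
  have pos: "0 < p * real q / 2" "0 < real N * p / 4" using p01 q large by auto
  have "- H \<subseteq> A \<union> (\<Union>v\<in>{1..N}. B v)"
  proof
    fix E assume "E \<in> - H"
    show "E \<in> A \<union> (\<Union>v\<in>{1..N}. B v)"
    proof (rule ccontr)
      assume no: "E \<notin> A \<union> (\<Union>v\<in>{1..N}. B v)"
      have "\<bar>S v E\<bar> \<le> real N * p / 4" if "v \<in> {1..N}" for v
      proof (rule ccontr)
        assume "\<not> ?thesis"
        then have "(real N * p / 4) ^ (2 * m) \<le> \<bar>S v E\<bar> ^ (2 * m)" using pos by (intro power_mono) auto
        then show False using no that by (auto simp: B_def power_even_abs)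
      qed
      moreover have "trace_power {1..N} (centred E) (2 * 2 ^ j) \<le> (p * real q / 2) ^ (2 * 2 ^ j)"
        using no by (simp add: A_def m(1))
      ultimately have "hamiltonian N E"
        unfolding S_def by (intro hamiltonian_of_trace_and_degrees[OF _ _ q g large])
      then have "E \<in> H" using hamiltonian_imp_perfect_matching by (auto simp: H_def)
      then show False using \<open>E \<in> - H\<close> by simp
    qed
  qed
  then have "measure_pmf.prob G (- H) \<le> measure_pmf.prob G (A \<union> (\<Union>v\<in>{1..N}. B v))"
    by (intro measure_pmf.finite_measure_mono) auto
  also have "\<dots> \<le> measure_pmf.prob G A + measure_pmf.prob G (\<Union>v\<in>{1..N}. B v)"
    by (intro measure_Un_le) auto
  also have "\<dots> \<le> measure_pmf.prob G A + (\<Sum>v\<in>{1..N}. measure_pmf.prob G (B v))"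
    by (intro add_left_mono measure_pmf.finite_measure_subadditive_finite) auto
  also have "\<dots> \<le> 2 * real N * (norm_const * real n) ^ m / (p * real q / 2) ^ (2 * m)
      + (\<Sum>v\<in>{1..N}. 2 * (4 * exp 4 * real m * real n) ^ m / (real N * p / 4) ^ (2 * m))"
  proof (intro add_mono sum_mono)
    have nonneg: "0 \<le> trace_power {1..N} (centred E) (2 * m)" for E
      using trace_power_even[of "{1..N}" "centred E" m] centred_commute
      by (simp add: sum_nonneg ip_self_nonneg)
    have "measure_pmf.prob G A \<le> measure_pmf.expectation G (\<lambda>E. trace_power {1..N} (centred E) (2 * m))
        / (p * real q / 2) ^ (2 * m)"
      unfolding A_def by (rule prob_ge_le[OF nonneg]) (use pos in simp)
    also have "\<dots> \<le> 2 * real N * (norm_const * real n) ^ m / (p * real q / 2) ^ (2 * m)"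
      using pos by (intro divide_right_mono expectation_trace_le m(2) m0 n) auto
    finally show "measure_pmf.prob G A \<le> 2 * real N * (norm_const * real n) ^ m / (p * real q / 2) ^ (2 * m)" .
  next
    fix v assume v: "v \<in> {1..N}"
    have "measure_pmf.prob G (B v) \<le> measure_pmf.expectation G (\<lambda>E. S v E ^ (2 * m)) / (real N * p / 4) ^ (2 * m)"
      unfolding B_def by (rule prob_ge_le) (use pos in auto)
    also have "\<dots> \<le> 2 * (4 * exp 4 * real m * real n) ^ m / (real N * p / 4) ^ (2 * m)"
      unfolding S_def using pos
      by (intro divide_right_mono expectation_degree_moment_le m(2) m0 n v) auto
    finally show "measure_pmf.prob G (B v) \<le> 2 * (4 * exp 4 * real m * real n) ^ m / (real N * p / 4) ^ (2 * m)" .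
  qed
  also have "measure_pmf.prob G (- H) = 1 - measure_pmf.prob G H"
    using measure_pmf.prob_compl[of H G] by (simp add: Compl_eq_Diff_UNIV)
  finally show ?thesis by (simp add: H_def)
qed

text \<open>The choice \<open>n \<le> 3 N p\<close> and \<open>q \<ge> a\<close> makes both bounds powers of explicit ratios.\<close>

lemma prob_not_hamiltonian_le':
  assumes m: "m = 2 ^ j" "2 * m \<le> k" "real m + 2 \<le> 2 * (real N * p)"
    and a: "0 < a" "a \<le> real q" and g: "0 < g" "q \<le> g ^ t" "4 * (2 * g + 1) * q \<le> N"
    and large: "(13 * q + 2) * (2 * t + 4) + q \<le> N"
  shows "1 - measure_pmf.prob G {E. hamiltonian N E \<and> (even N \<longrightarrow> (\<exists>M. perfect_matching N E M))}
    \<le> 2 * real N * (12 * norm_const * (real N / (p * a\<^sup>2))) ^ m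
      + 2 * real N * (192 * exp 4 * (real m / (real N * p))) ^ m"
proof -
  define n where "n = nat \<lceil>real N * p + m + 1\<rceil>"
  have Np: "0 < real N * p" using p01 large by auto
  have n: "real N * p + m + 1 \<le> real n" unfolding n_def by linarith
  have "real n \<le> real N * p + m + 2" unfolding n_def using Np by linarith
  then have n3: "real n \<le> 3 * (real N * p)" using m(3) by linarith
  have q: "0 < q" using a by (cases q) auto
  have nc: "0 < norm_const" by (simp add: norm_const_def)
  have "2 * real N * (norm_const * real n) ^ m / (p * real q / 2) ^ (2 * m)
      = 2 * real N * (norm_const * real n / (p * real q / 2)\<^sup>2) ^ m"
    by (simp only: power_mult power_divide times_divide_eq_right)
  also have "\<dots> \<le> 2 * real N * (norm_const * (3 * (real N * p)) / (p * a / 2)\<^sup>2) ^ m"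
    using nc n3 a p01 Np
    by (intro mult_left_mono power_mono frac_le divide_right_mono mult_left_mono) auto
  also have "norm_const * (3 * (real N * p)) / (p * a / 2)\<^sup>2 = 12 * norm_const * (real N / (p * a\<^sup>2))"
    using p01 a by (simp add: power2_eq_square field_simps)
  finally have 1: "2 * real N * (norm_const * real n) ^ m / (p * real q / 2) ^ (2 * m)
      \<le> 2 * real N * (12 * norm_const * (real N / (p * a\<^sup>2))) ^ m" .
  have "real N * (2 * (4 * exp 4 * real m * real n) ^ m / (real N * p / 4) ^ (2 * m))
      = 2 * real N * (4 * exp 4 * real m * real n / (real N * p / 4)\<^sup>2) ^ m"
  proof -
    have "c * (2 * x ^ m / y ^ (2 * m)) = 2 * c * (x / y\<^sup>2) ^ m" for c x y :: real
      by (simp add: power_mult power_divide)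
    then show ?thesis by blast
  qed
  also have "\<dots> \<le> 2 * real N * (4 * exp 4 * real m * (3 * (real N * p)) / (real N * p / 4)\<^sup>2) ^ m"
    using n3 by (intro mult_left_mono power_mono divide_right_mono) auto
  also have "4 * exp 4 * real m * (3 * (real N * p)) / (real N * p / 4)\<^sup>2 = 192 * exp 4 * (real m / (real N * p))"
    using Np by (simp add: power2_eq_square field_simps)
  finally have 2: "real N * (2 * (4 * exp 4 * real m * real n) ^ m / (real N * p / 4) ^ (2 * m))
      \<le> 2 * real N * (192 * exp 4 * (real m / (real N * p))) ^ m" .
  show ?thesis using prob_not_hamiltonian_le[OF m(1,2) n q g large] 1 2 by linarith
qed

end

section \<open>Asymptotics\<close>

text \<open>Both upper bounds hold with room: \<open>g q\<close> is of order
  \<open>N sqrt (log log N / log N)\<close>, and \<open>q t\<close> of order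
  \<open>N / sqrt (log log N)\<close>.\<close>

lemma eventually_parameters:
  "\<forall>\<^sub>F N in sequentially. \<exists>q g t :: nat. 0 < g \<and> q \<le> g ^ t \<and> 4 * (2 * g + 1) * q \<le> N \<and>
     (13 * q + 2) * (2 * t + 4) + q \<le> N \<and>
     real N * sqrt (log 2 (log 2 (real N))) / log 2 (real N) \<le> real q"
proof -
  have "\<forall>\<^sub>F N in sequentially. 4 * (2 * sqrt (log 2 (real N)) + 1) *
      (real N * sqrt (log 2 (log 2 (real N))) / log 2 (real N) + 1) \<le> real N"
    by real_asymp
  moreover have "\<forall>\<^sub>F N in sequentially.
      (13 * (real N * sqrt (log 2 (log 2 (real N))) / log 2 (real N) + 1) + 2) *
      (2 * (log 2 (real N) / log 2 (sqrt (log 2 (real N)) - 1) + 1) + 4) +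
      (real N * sqrt (log 2 (log 2 (real N))) / log 2 (real N) + 1) \<le> real N"
    by real_asymp
  moreover have "\<forall>\<^sub>F N in sequentially. 3 \<le> sqrt (log 2 (real N))" by real_asymp
  moreover have "\<forall>\<^sub>F N in sequentially. 0 \<le> real N * sqrt (log 2 (log 2 (real N))) / log 2 (real N)"
    by real_asymp
  moreover have "\<forall>\<^sub>F N in sequentially. 0 < real N" by real_asymp
  ultimately show ?thesis
  proof eventually_elim
    case (elim N)
    define L where "L = log 2 (real N)"
    define x where "x = real N * sqrt (log 2 L) / L"
    \<comment> \<open>\<open>t\<close> is made for \<open>g ^ t \<ge> N\<close>, with
      \<open>sqrt L - 1\<close> as a lower bound for the rounded \<open>g\<close>.\<close>
    define q g t where "q = nat \<lceil>x\<rceil>" and "g = nat \<lfloor>sqrt L\<rfloor>" and "t = nat \<lceil>L / log 2 (sqrt L - 1)\<rceil>"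
    have e1: "4 * (2 * sqrt L + 1) * (x + 1) \<le> real N"
      and e2: "(13 * (x + 1) + 2) * (2 * (L / log 2 (sqrt L - 1) + 1) + 4) + (x + 1) \<le> real N"
      and L3: "3 \<le> sqrt L" and x0: "0 \<le> x"
      using elim by (simp_all add: L_def x_def)
    have L0: "0 < L" using L3 by (metis less_le_trans zero_less_numeral real_sqrt_gt_0_iff)
    have N0: "0 < real N" using elim(5) .
    have lg: "0 < log 2 (sqrt L - 1)" using L3 by (subst zero_less_log_cancel_iff) linarith+
    have q: "x \<le> real q" "real q \<le> x + 1" unfolding q_def using x0 by linarith+
    have g: "sqrt L - 1 \<le> real g" "real g \<le> sqrt L" unfolding g_def using L3 by linarith+
    have t0: "0 \<le> L / log 2 (sqrt L - 1)" using L0 lg by simp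
    then have t: "L / log 2 (sqrt L - 1) \<le> real t" "real t \<le> L / log 2 (sqrt L - 1) + 1"
      unfolding t_def by linarith+
    have "4 * (2 * real g + 1) * real q \<le> 4 * (2 * sqrt L + 1) * (x + 1)"
      using g q x0 L0 by (intro mult_mono) auto
    also note e1
    finally have "real (4 * (2 * g + 1) * q) \<le> real N" by (simp add: algebra_simps)
    then have 1: "4 * (2 * g + 1) * q \<le> N" by (rule of_nat_le_iff[THEN iffD1])
    have "real (13 * q + 2) * real (2 * t + 4) \<le> (13 * (x + 1) + 2) * (2 * (L / log 2 (sqrt L - 1) + 1) + 4)"
      using q t x0 t0 by (intro mult_mono) auto
    then have "real ((13 * q + 2) * (2 * t + 4) + q) \<le> real N" using e2 q(2) by (simp only: of_nat_add of_nat_mult)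
    then have 2: "(13 * q + 2) * (2 * t + 4) + q \<le> N" by (rule of_nat_le_iff[THEN iffD1])
    have lgg: "log 2 (sqrt L - 1) \<le> log 2 (real g)" using g(1) L3 by (intro log_mono) linarith+
    have "L = log 2 (sqrt L - 1) * (L / log 2 (sqrt L - 1))" using lg by simp
    also have "\<dots> \<le> log 2 (real g) * real t"
      using lgg t(1) lg t0 by (intro mult_mono) auto
    also have "\<dots> = log 2 (real g ^ t)" using g(1) L3 by (simp add: log_nat_power)
    finally have "log 2 (real N) \<le> log 2 (real g ^ t)" by (simp add: L_def)
    then have "real N \<le> real g ^ t" using N0 g(1) L3 by (subst (asm) log_le_cancel_iff) auto
    then have "N \<le> g ^ t" by (simp flip: of_nat_power)
    moreover have "q \<le> N" using 2 by simp
    ultimately have 3: "q \<le> g ^ t" by simp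
    have "0 < real g" using g(1) L3 by linarith
    then have 4: "0 < g" by simp
    show ?case using 1 2 3 4 q(1) unfolding x_def L_def by blast
  qed
qed

text \<open>The norm bound works by repeated doubling, so \<open>m\<close> has to be a power of
  two.\<close>

lemma power_of_two_between:
  fixes x :: real
  assumes "1 \<le> x"
  obtains j :: nat where "x < 2 ^ j" "2 ^ j \<le> 2 * x"
proof -
  have "1 \<le> nat \<lfloor>2 * x\<rfloor>" using assms by linarith
  then obtain j where j: "2 ^ j \<le> nat \<lfloor>2 * x\<rfloor>" "nat \<lfloor>2 * x\<rfloor> < 2 ^ (j + 1)"
    using ex_power_ivl1[of 2 "nat \<lfloor>2 * x\<rfloor>"] by auto
  have "real (2 ^ j) \<le> real (nat \<lfloor>2 * x\<rfloor>)" using j(1) by (rule of_nat_mono)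
  moreover have "real (nat \<lfloor>2 * x\<rfloor>) \<le> 2 * x" using assms by linarith
  ultimately have "real (2 ^ j) \<le> 2 * x" by linarith
  then have 1: "2 ^ j \<le> 2 * x" by simp
  have "real (nat \<lfloor>2 * x\<rfloor> + 1) \<le> real (2 ^ (j + 1))" using j(2) by (intro of_nat_mono) simp
  moreover have "2 * x < real (nat \<lfloor>2 * x\<rfloor> + 1)" using assms by linarith
  ultimately have "2 * x < real (2 ^ (j + 1))" by linarith
  then show ?thesis using that[of j] 1 by simp
qed

text \<open>\<open>q\<close>, \<open>g\<close>, \<open>t\<close> depend on \<open>N\<close> alone;
  the two regimes differ only in \<open>m\<close> and in the majorant
  \<open>\<epsilon>\<close>.\<close>

lemma tendsto_prob_hamiltonian:
  fixes k :: "nat \<Rightarrow> nat" and p \<epsilon> :: "nat \<Rightarrow> real" and G :: "nat \<Rightarrow> nat set set pmf"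
  defines "X \<equiv> \<lambda>N. measure_pmf.prob (G N) {E. hamiltonian N E \<and> (even N \<longrightarrow> (\<exists>M. perfect_matching N E M))}"
    and "a \<equiv> \<lambda>N. real N * sqrt (log 2 (log 2 (real N))) / log 2 (real N)"
  assumes p: "\<forall>N. 0 < p N \<and> p N < 1" and G: "kwise_independent_random_graph k p G"
    and ev: "\<forall>\<^sub>F N in sequentially. \<exists>j m. m = 2 ^ j \<and> 2 * m \<le> k N \<and> real m + 2 \<le> 2 * (real N * p N) \<and>
      2 * real N * (12 * norm_const * (real N / (p N * (a N)\<^sup>2))) ^ m
      + 2 * real N * (192 * exp 4 * (real m / (real N * p N))) ^ m \<le> \<epsilon> N"
    and \<epsilon>: "\<epsilon> \<longlonglongrightarrow> 0"
  shows "X \<longlonglongrightarrow> 1"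
proof -
  have kg: "kwise_graph N (k N) (p N) (G N)" for N
    using p G unfolding kwise_independent_random_graph_def by unfold_locales blast+
  have pos: "\<forall>\<^sub>F N in sequentially. 0 < a N" unfolding a_def by real_asymp
  have "\<forall>\<^sub>F N in sequentially. 1 - \<epsilon> N \<le> X N"
    using ev pos eventually_parameters
  proof eventually_elim
    case (elim N)
    obtain j m where m: "m = 2 ^ j" "2 * m \<le> k N" "real m + 2 \<le> 2 * (real N * p N)"
      and le: "2 * real N * (12 * norm_const * (real N / (p N * (a N)\<^sup>2))) ^ m
      + 2 * real N * (192 * exp 4 * (real m / (real N * p N))) ^ m \<le> \<epsilon> N" using elim(1) by blast
    obtain q g t :: nat where qgt: "0 < g" "q \<le> g ^ t" "4 * (2 * g + 1) * q \<le> N"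
      "(13 * q + 2) * (2 * t + 4) + q \<le> N" "a N \<le> real q" using elim(3) unfolding a_def by blast
    show ?case
      using kwise_graph.prob_not_hamiltonian_le'[OF kg m elim(2) qgt(5) qgt(1-4)] le
      unfolding X_def by linarith
  qed
  moreover have "\<forall>\<^sub>F N in sequentially. X N \<le> 1" by (simp add: X_def)
  moreover have "(\<lambda>N. 1 - \<epsilon> N) \<longlonglongrightarrow> 1" using tendsto_diff[OF tendsto_const[of 1] \<epsilon>] by simp
  ultimately show ?thesis using tendsto_sandwich[of "\<lambda>N. 1 - \<epsilon> N" X sequentially "\<lambda>_. 1" 1] by simp
qed

lemma norm_const_pos: "0 < norm_const"
  by (simp add: norm_const_def)

text \<open>For \<open>m = 2\<close> the first term is
  \<open>288 norm_const^2 / (log log N)^2\<close> times \<open>log^4 N / (p^2 N) \<le> 1\<close>: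
  the threshold for \<open>p\<close> is just used up, and all decay comes from the factor
  \<open>sqrt (log log N)\<close> in \<open>a\<close>.\<close>

lemma four_wise_bound:
  fixes k :: "nat \<Rightarrow> nat" and p :: "nat \<Rightarrow> real"
  defines "a \<equiv> \<lambda>N. real N * sqrt (log 2 (log 2 (real N))) / log 2 (real N)"
  assumes "\<forall>\<^sub>F N in sequentially. 4 \<le> k N \<and> (log 2 (real N))^2 / sqrt (real N) \<le> p N"
  shows "\<forall>\<^sub>F N in sequentially. \<exists>j m. m = 2 ^ j \<and> 2 * m \<le> k N \<and> real m + 2 \<le> 2 * (real N * p N) \<and>
      2 * real N * (12 * norm_const * (real N / (p N * (a N)\<^sup>2))) ^ m
      + 2 * real N * (192 * exp 4 * (real m / (real N * p N))) ^ m
      \<le> 288 * norm_const\<^sup>2 / (log 2 (log 2 (real N)))\<^sup>2 + 2 * (384 * exp 4)\<^sup>2 / log 2 (real N) ^ 4"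
proof -
  have "\<forall>\<^sub>F N in sequentially. 2 \<le> sqrt (real N) * (log 2 (real N))\<^sup>2" by real_asymp
  moreover have "\<forall>\<^sub>F N in sequentially. 0 < log 2 (log 2 (real N))" by real_asymp
  moreover have "\<forall>\<^sub>F N in sequentially. 0 < log 2 (real N)" by real_asymp
  moreover have "\<forall>\<^sub>F N in sequentially. 0 < real N" by real_asymp
  ultimately show ?thesis using assms(2)
  proof eventually_elim
    case (elim N)
    define L l P where "L = log 2 (real N)" and "l = log 2 L" and "P = p N"
    have pos: "0 < l" "0 < L" "0 < real N" using elim by (simp_all add: L_def l_def)
    have P: "L\<^sup>2 / sqrt (real N) \<le> P" using elim(5) by (simp add: L_def P_def)
    have P0: "0 < P" using P pos by (smt (verit) divide_pos_pos real_sqrt_gt_0_iff zero_less_power)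
    have "(L\<^sup>2 / sqrt (real N))\<^sup>2 \<le> P\<^sup>2" using P pos by (intro power_mono) auto
    then have P2: "L ^ 4 \<le> P\<^sup>2 * real N"
      using pos by (simp add: power_divide divide_le_eq flip: power_mult)
    have "real N * (L\<^sup>2 / sqrt (real N)) \<le> real N * P" using P by (intro mult_left_mono) auto
    also have "real N * (L\<^sup>2 / sqrt (real N)) = sqrt (real N) * L\<^sup>2"
      using pos real_div_sqrt[of "real N"] by (metis less_imp_le times_divide_eq_right mult.commute)
    finally have NP: "2 \<le> real N * P" using elim(1) by (simp add: L_def)
    have a2: "(a N)\<^sup>2 = (real N)\<^sup>2 * l / L\<^sup>2"
      using pos unfolding a_def L_def[symmetric] l_def[symmetric]
      by (simp add: power_divide power_mult_distrib)
    have "2 * real N * (12 * norm_const * (real N / (P * (a N)\<^sup>2)))\<^sup>2 = 288 * norm_const\<^sup>2 / l\<^sup>2 * (L ^ 4 / (P\<^sup>2 * real N))"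
      unfolding a2 using pos P0 by (simp add: field_simps power2_eq_square power4_eq_xxxx)
    also have "\<dots> \<le> 288 * norm_const\<^sup>2 / l\<^sup>2 * 1"
      using pos P0 P2 by (intro mult_left_mono) auto
    finally have 1: "2 * real N * (12 * norm_const * (real N / (P * (a N)\<^sup>2)))\<^sup>2 \<le> 288 * norm_const\<^sup>2 / l\<^sup>2" by simp
    have "2 * real N * (192 * exp 4 * (2 / (real N * P)))\<^sup>2 = 2 * (384 * exp 4)\<^sup>2 / (P\<^sup>2 * real N)"
      using pos P0 by (simp add: field_simps power2_eq_square)
    also have "\<dots> \<le> 2 * (384 * exp 4)\<^sup>2 / L ^ 4" using P2 pos P0 by (intro divide_left_mono mult_pos_pos) auto
    finally have 2: "2 * real N * (192 * exp 4 * (2 / (real N * P)))\<^sup>2 \<le> 2 * (384 * exp 4)\<^sup>2 / L ^ 4" .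
    show ?case
    proof (intro exI conjI)
      show "2 = (2::nat) ^ 1" by simp
      show "2 * 2 \<le> k N" using elim(5) by simp
      show "real 2 + 2 \<le> 2 * (real N * p N)" using NP by (simp add: P_def)
      show "2 * real N * (12 * norm_const * (real N / (p N * (a N)\<^sup>2))) ^ 2
        + 2 * real N * (192 * exp 4 * (real 2 / (real N * p N))) ^ 2
        \<le> 288 * norm_const\<^sup>2 / (log 2 (log 2 (real N)))\<^sup>2 + 2 * (384 * exp 4)\<^sup>2 / log 2 (real N) ^ 4"
        using 1 2 by (simp add: P_def l_def L_def)
    qed
  qed
qed

text \<open>As \<open>m > log N\<close>, a base of at most \<open>1/4\<close> already gives
  \<open>N^(-2)\<close>, which absorbs the prefactor \<open>N\<close>; the bases need not tend to
  0.\<close>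

lemma log_wise_bound:
  fixes k :: "nat \<Rightarrow> nat" and p :: "nat \<Rightarrow> real"
  defines "a \<equiv> \<lambda>N. real N * sqrt (log 2 (log 2 (real N))) / log 2 (real N)"
  assumes "\<forall>\<^sub>F N in sequentially. 4 * log 2 (real N) \<le> real (k N) \<and> (log 2 (real N))^2 / real N \<le> p N"
  shows "\<forall>\<^sub>F N in sequentially. \<exists>j m. m = 2 ^ j \<and> 2 * m \<le> k N \<and> real m + 2 \<le> 2 * (real N * p N) \<and>
      2 * real N * (12 * norm_const * (real N / (p N * (a N)\<^sup>2))) ^ m
      + 2 * real N * (192 * exp 4 * (real m / (real N * p N))) ^ m \<le> 4 / real N"
proof -
  \<comment> \<open>The constants put both bases below \<open>1/4\<close>: they are at most
    \<open>12 * norm_const / l\<close> and \<open>384 * exp 4 / L\<close>.\<close>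
  have "\<forall>\<^sub>F N in sequentially. 48 * norm_const \<le> log 2 (log 2 (real N))" by real_asymp
  moreover have "\<forall>\<^sub>F N in sequentially. 1536 * exp 4 \<le> log 2 (real N)" by real_asymp
  moreover have "\<forall>\<^sub>F N in sequentially. 2 \<le> log 2 (real N)" by real_asymp
  moreover have "\<forall>\<^sub>F N in sequentially. 0 < real N" by real_asymp
  ultimately show ?thesis using assms(2)
  proof eventually_elim
    case (elim N)
    define L l P where "L = log 2 (real N)" and "l = log 2 L" and "P = p N"
    have l: "48 * norm_const \<le> l" and L: "1536 * exp 4 \<le> L" "2 \<le> L" and N0: "0 < real N"
      using elim by (simp_all add: L_def l_def)
    have l0: "0 < l" using l norm_const_pos by linarith
    have "L\<^sup>2 / real N \<le> P" using elim(5) by (simp add: L_def P_def)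
    then have NP: "L\<^sup>2 \<le> real N * P" using N0 by (simp add: pos_divide_le_eq mult.commute)
    have "0 < L\<^sup>2" using L(2) by simp
    then have "0 < real N * P" using NP by linarith
    then have P0: "0 < P" using N0 by (simp add: zero_less_mult_iff)
    obtain j where j: "L < 2 ^ j" "2 ^ j \<le> 2 * L" using power_of_two_between[of L] L(2) by auto
    define m where "m = (2::nat) ^ j"
    have m: "L < real m" "real m \<le> 2 * L" using j by (simp_all add: m_def)
    have quarter: "2 * real N * y ^ m \<le> 2 / real N" if "0 \<le> y" "y \<le> 1/4" for y
    proof -
      have "y ^ m \<le> (1/4) ^ m" using that by (intro power_mono)
      also have "(1/4::real) ^ m = (1/4) powr real m" by (simp add: powr_realpow)
      also have "\<dots> \<le> (1/4) powr L" using m(1) by (intro powr_mono') auto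
      also have "\<dots> = 1 / (real N)\<^sup>2"
      proof -
        have "2 powr L = real N" using N0 by (simp add: L_def)
        then have "(4::real) powr L = (real N)\<^sup>2"
          using powr_mult[of 2 2 L] by (simp add: power2_eq_square)
        then show ?thesis by (simp add: powr_divide)
      qed
      finally have "2 * real N * y ^ m \<le> 2 * real N * (1 / (real N)\<^sup>2)" by (intro mult_left_mono) auto
      also have "\<dots> = 2 / real N" by (simp add: power2_eq_square)
      finally show ?thesis .
    qed
    have a2: "(a N)\<^sup>2 = (real N)\<^sup>2 * l / L\<^sup>2"
      using l0 unfolding a_def L_def[symmetric] l_def[symmetric]
      by (simp add: power_divide power_mult_distrib)
    have "12 * norm_const * (real N / (P * (a N)\<^sup>2)) = 12 * norm_const / l * (L\<^sup>2 / (real N * P))"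
      unfolding a2 using N0 P0 L(2) l0 by (simp add: field_simps power2_eq_square)
    also have "\<dots> \<le> (1/4) * 1"
      using l l0 norm_const_pos NP N0 P0 by (intro mult_mono) (auto simp: field_simps)
    finally have 1: "2 * real N * (12 * norm_const * (real N / (P * (a N)\<^sup>2))) ^ m \<le> 2 / real N"
      using norm_const_pos N0 P0 by (intro quarter) auto
    have "real m / (real N * P) \<le> (2 * L) / L\<^sup>2"
      using m(2) NP L(2) by (intro frac_le) auto
    also have "\<dots> = 2 / L" using L(2) by (simp add: power2_eq_square)
    finally have "192 * exp 4 * (real m / (real N * P)) \<le> 192 * exp 4 * (2 / L)" by (intro mult_left_mono) auto
    also have "\<dots> \<le> 1/4" using L by (simp add: field_simps)
    finally have 2: "2 * real N * (192 * exp 4 * (real m / (real N * P))) ^ m \<le> 2 / real N"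
      using N0 P0 by (intro quarter) auto
    show ?case
    proof (intro exI conjI)
      show "m = 2 ^ j" by (rule m_def)
      \<comment> \<open>Rounding to a power of two may bring \<open>m\<close> up to
        \<open>2 log N\<close>, which consumes \<open>k \<ge> 4 log N\<close>.\<close>
      have "real (2 * m) \<le> real (k N)" using m(2) elim(5) by (simp add: L_def)
      then show "2 * m \<le> k N" by (rule of_nat_le_iff[THEN iffD1])
      have "2 * L \<le> L * L" using L(2) by (intro mult_right_mono) auto
      then show "real m + 2 \<le> 2 * (real N * p N)"
        using m(2) NP L(2) unfolding P_def power2_eq_square by linarith
      show "2 * real N * (12 * norm_const * (real N / (p N * (a N)\<^sup>2))) ^ m
        + 2 * real N * (192 * exp 4 * (real m / (real N * p N))) ^ m \<le> 4 / real N"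
        using add_mono[OF 1 2] by (simp add: P_def)
    qed
  qed
qed

theorem mainTheorem3:
  fixes k :: "nat \<Rightarrow> nat" and p :: "nat \<Rightarrow> real" and G :: "nat \<Rightarrow> nat set set pmf"
  assumes "\<forall>N. 0 < p N \<and> p N < 1"
    and "kwise_independent_random_graph k p G"
    and "(\<forall>\<^sub>F N in sequentially. 4 \<le> k N \<and> (log 2 (real N))^2 / sqrt (real N) \<le> p N) \<or>
         (\<forall>\<^sub>F N in sequentially. 4 * log 2 (real N) \<le> real (k N) \<and> (log 2 (real N))^2 / real N \<le> p N)"
  shows "(\<lambda>N. measure_pmf.prob (G N)
            {E. hamiltonian N E \<and> (even N \<longrightarrow> (\<exists>M. perfect_matching N E M))}) \<longlonglongrightarrow> 1"
  using assms(3)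
proof
  assume "\<forall>\<^sub>F N in sequentially. 4 \<le> k N \<and> (log 2 (real N))^2 / sqrt (real N) \<le> p N"
  from four_wise_bound[OF this] show ?thesis
    by (rule tendsto_prob_hamiltonian[OF assms(1,2)]) real_asymp
next
  assume "\<forall>\<^sub>F N in sequentially. 4 * log 2 (real N) \<le> real (k N) \<and> (log 2 (real N))^2 / real N \<le> p N"
  from log_wise_bound[OF this] show ?thesis
    by (rule tendsto_prob_hamiltonian[OF assms(1,2)]) real_asymp
qed

end
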